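(* Let $(M,d)$ be a proper geodesic hyperbolic space, $o\in M$, and assume that $G=\mathrm{Isom}(M)$ acts cocompactly on $M$. Let $\mu$ be a non-elementary probability measure on $G$ with bounded support $S$, and let $\nu$ be the $\mu$-harmonic measure on the Gromov boundary $\partial M$. Then for every $$s<\sup_{r\in[0,1)}\frac{1}{\kappa_S}\ln\left(\frac{1}{\|\lambda_G(\mu_{r,\mathrm{lazy}})\|_2}\right),$$ we have $$\sup_{x\in M\cup\partial M}\int_{\partial M}e^{s\,(x|y)_o}\,d\nu(y)=:K(\mu,s)<+\infty.$$ In particular, for each such $s>0$ and for every $x\in M$ and $t\ge 0$, $$\nu\left\{y\in\partial M:(x|y)_o\geq t\right\}\leq K(\mu,s)\,e^{-st}.$$
   Context: $M$ is hyperbolic if for some $\delta\ge0$, $(x|y)_o\geq\min\{(x|z)_o,(z|y)_o\}-\delta$ for all $x,y,z,o\in M$, where $(x|y)_o=\frac12(d(x,o)+d(y,o)-d(x,y))$. For $x,y\in M\cup\partial M$, $(x|y)_o=\inf\liminf_{n\to\infty}(x_n|y_n)_o$, the infimum being over all sequences $x_n,y_n$ in $M$ converging to $x$ and $y$ respectively (in the usual topology on $M\cup\partial M$). An isometry $\gamma$ is loxodromic if $(\gamma^nx)_{n\in\mathbb{Z}}$ is a quasi-geodesic for any $x \in M$; it then fixes exactly two points of $\partial M$; two loxodromic elements are independent if their fixed point pairs are disjoint. $\mu$ is non-elementary if the semigroup generated by its support contains two independent loxodromic elements. With $(X_i)$ i.i.d. of law $\mu$ and $R_n=X_1\cdots X_n$,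 the sequence $R_no$ converges a.s. to a point of $\partial M$ and the $\mu$-harmonic measure $\nu$ is the law of the limit (it is the unique $\mu$-stationary probability measure on $\partial M$). $\kappa_S=\sup_{g\in S}d(go,o)$ and $S$ is bounded if $\kappa_S<\infty$; $\mu_{r,\mathrm{lazy}}=r\delta_{\mathrm{id}}+(1-r)\mu$; $\lambda_G(\mu)$ is the image of $\mu$ under the left-regular representation on $L^2(G)$ (Haar measure on the locally compact group $G$), with operator norm $\|\cdot\|_2$. *)

theory Defs
  imports "HOL-Probability.Probability"
begin

text \<open>The space \<open>M\<close> is the whole carrier of a type \<open>'a :: metric_space\<close>.\<close>

section \<open>Proper geodesic hyperbolic spaces\<close>

definition proper_space :: "'a::metric_space itself \<Rightarrow> bool" where
  "proper_space _ \<longleftrightarrow> (\<forall>(x::'a) r. compact (cball x r))"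

definition geodesic_space :: "'a::metric_space itself \<Rightarrow> bool" where
  "geodesic_space _ \<longleftrightarrow>
     (\<forall>x y::'a. \<exists>c::real \<Rightarrow> 'a. c 0 = x \<and> c (dist x y) = y \<and>
        (\<forall>s\<in>{0..dist x y}. \<forall>t\<in>{0..dist x y}. dist (c s) (c t) = \<bar>s - t\<bar>))"

definition gromov_product :: "'a::metric_space \<Rightarrow> 'a \<Rightarrow> 'a \<Rightarrow> real" where
  "gromov_product b x y = (dist x b + dist y b - dist x y) / 2"

definition gromov_hyperbolic :: "'a::metric_space itself \<Rightarrow> bool" where
  "gromov_hyperbolic _ \<longleftrightarrow>
     (\<exists>\<delta>\<ge>0. \<forall>x y z b::'a.
        gromov_product b x y \<ge> min (gromov_product b x z) (gromov_product b z y) - \<delta>)"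


section \<open>The Gromov boundary and the bordification\<close>

definition converges_to_infinity :: "'a::metric_space \<Rightarrow> (nat \<Rightarrow> 'a) \<Rightarrow> bool" where
  "converges_to_infinity b x \<longleftrightarrow>
     filterlim (\<lambda>(i, j). gromov_product b (x i) (x j)) at_top (sequentially \<times>\<^sub>F sequentially)"

definition gromov_equiv :: "'a::metric_space \<Rightarrow> ((nat \<Rightarrow> 'a) \<times> (nat \<Rightarrow> 'a)) set" where
  "gromov_equiv b =
     {(x, y). converges_to_infinity b x \<and> converges_to_infinity b y \<and>
        filterlim (\<lambda>(i, j). gromov_product b (x i) (y j)) at_top (sequentially \<times>\<^sub>F sequentially)}"

definition gromov_classes :: "'a::metric_space \<Rightarrow> (nat \<Rightarrow> 'a) set set" where
  "gromov_classes b = {x. converges_to_infinity b x} // gromov_equiv b"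

datatype 'a bord = Point 'a | Ideal "(nat \<Rightarrow> 'a) set"

definition gromov_boundary :: "'a::metric_space \<Rightarrow> 'a bord set" where
  "gromov_boundary b = Ideal ` gromov_classes b"

definition bordification :: "'a::metric_space \<Rightarrow> 'a bord set" where
  "bordification b = range Point \<union> gromov_boundary b"

text \<open>
  The usual topology on \<open>M \<union> \<partial>M\<close>: it restricts to the metric topology on the open
  subset \<open>M\<close>, and the sets \<open>ideal_nhd b \<xi> r\<close> form a neighbourhood base at the boundary point
  \<open>\<xi>\<close>. (They need not be open themselves.)
\<close>

definition ideal_nhd :: "'a::metric_space \<Rightarrow> (nat \<Rightarrow> 'a) set \<Rightarrow> real \<Rightarrow> 'a bord set" where
  "ideal_nhd b \<xi> r =
     {Ideal \<eta> | \<eta>. \<eta> \<in> gromov_classes b \<and>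
        (\<exists>x\<in>\<xi>. \<exists>y\<in>\<eta>. ereal r \<le> Liminf (sequentially \<times>\<^sub>F sequentially)
                               (\<lambda>(i, j). ereal (gromov_product b (x i) (y j))))}
   \<union> {Point y | y. \<exists>x\<in>\<xi>. ereal r \<le> liminf (\<lambda>i. ereal (gromov_product b (x i) y))}"

definition bord_open :: "'a::metric_space \<Rightarrow> 'a bord set \<Rightarrow> bool" where
  "bord_open b U \<longleftrightarrow> U \<subseteq> bordification b \<and> open (Point -` U) \<and>
     (\<forall>\<xi>. Ideal \<xi> \<in> U \<longrightarrow> (\<exists>r. ideal_nhd b \<xi> r \<subseteq> U))"

definition bord_topology :: "'a::metric_space \<Rightarrow> 'a bord topology" where
  "bord_topology b = topology (bord_open b)"

lemma ideal_nhd_antimono: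
  assumes "r \<le> r'"
  shows "ideal_nhd b \<xi> r' \<subseteq> ideal_nhd b \<xi> r"
proof -
  have *: "ereal r \<le> c" if "ereal r' \<le> c" for c
    using assms that by (metis ereal_less_eq(3) order_trans)
  show ?thesis
    unfolding ideal_nhd_def by (blast dest: *)
qed

lemma istopology_bord_open: "istopology (bord_open b)"
  unfolding istopology_def
proof (intro conjI allI impI)
  fix U V assume U: "bord_open b U" and V: "bord_open b V"
  have "\<exists>r. ideal_nhd b \<xi> r \<subseteq> U \<inter> V" if "Ideal \<xi> \<in> U \<inter> V" for \<xi>
  proof -
    obtain r r' where "ideal_nhd b \<xi> r \<subseteq> U" "ideal_nhd b \<xi> r' \<subseteq> V"
      using U V \<open>Ideal \<xi> \<in> U \<inter> V\<close> unfolding bord_open_def by blast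
    then show ?thesis
      using ideal_nhd_antimono[of r "max r r'" b \<xi>] ideal_nhd_antimono[of r' "max r r'" b \<xi>]
      by (intro exI[of _ "max r r'"]) auto
  qed
  then show "bord_open b (U \<inter> V)"
    using U V unfolding bord_open_def by (auto simp: vimage_Int)
next
  fix \<K> assume K: "\<forall>U\<in>\<K>. bord_open b U"
  have "open (Point -` \<Union>\<K>)"
    using K unfolding bord_open_def by (auto simp: vimage_Union)
  then show "bord_open b (\<Union>\<K>)"
    using K unfolding bord_open_def by (metis Union_iff Union_least Union_upper order_trans)
qed

lemma openin_bord_topology: "openin (bord_topology b) U \<longleftrightarrow> bord_open b U"
  unfolding bord_topology_def by (simp add: topology_inverse'[OF istopology_bord_open])

lemma topspace_bord_topology: "topspace (bord_topology b) = bordification b"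
proof
  show "topspace (bord_topology b) \<subseteq> bordification b"
    using openin_topspace[of "bord_topology b"]
    unfolding openin_bord_topology bord_open_def by blast
  have "bord_open b (bordification b)"
    unfolding bord_open_def
  proof (intro conjI allI impI subset_refl)
    show "open (Point -` bordification b)"
    proof -
      have "Point -` bordification b = UNIV"
        by (auto simp: bordification_def)
      then show ?thesis by simp
    qed
    show "\<exists>r. ideal_nhd b \<xi> r \<subseteq> bordification b" for \<xi>
      by (rule exI[of _ 0])
         (auto simp: ideal_nhd_def bordification_def gromov_boundary_def)
  qed
  then show "bordification b \<subseteq> topspace (bord_topology b)"
    by (simp add: openin_bord_topology openin_subset)
qed

text \<open>Extension of the Gromov product to \<open>M \<union> \<partial>M\<close>, with values in \<open>[0, \<infinity>]\<close>.\<close>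

definition ext_gromov_product :: "'a::metric_space \<Rightarrow> 'a bord \<Rightarrow> 'a bord \<Rightarrow> ereal" where
  "ext_gromov_product b p q =
     Inf {liminf (\<lambda>n. ereal (gromov_product b (x n) (y n))) | x y.
            limitin (bord_topology b) (\<lambda>n. Point (x n)) p sequentially \<and>
            limitin (bord_topology b) (\<lambda>n. Point (y n)) q sequentially}"


section \<open>The isometry group\<close>

definition isom_group :: "('a::metric_space \<Rightarrow> 'a) set" where
  "isom_group = {g. surj g \<and> (\<forall>x y. dist (g x) (g y) = dist x y)}"

text \<open>Compact-open topology.\<close>

definition isom_topology :: "('a::metric_space \<Rightarrow> 'a) topology" where
  "isom_topology = subtopology
     (topology_generated_by {{f. f ` K \<subseteq> U} | K U. compact K \<and> open U}) isom_group"

definition cocompact_isom_action :: "'a::metric_space itself \<Rightarrow> bool" where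
  "cocompact_isom_action _ \<longleftrightarrow>
     (\<exists>K::'a set. compact K \<and> (\<Union>g\<in>isom_group. g ` K) = UNIV)"

definition funpow_int :: "('a \<Rightarrow> 'a) \<Rightarrow> int \<Rightarrow> 'a \<Rightarrow> 'a" where
  "funpow_int g k = (if k \<ge> 0 then g ^^ nat k else (inv g) ^^ nat (- k))"

definition quasi_geodesic_int :: "(int \<Rightarrow> 'a::metric_space) \<Rightarrow> bool" where
  "quasi_geodesic_int c \<longleftrightarrow>
     (\<exists>L\<ge>1. \<exists>C\<ge>0. \<forall>m n. \<bar>of_int m - of_int n\<bar> / L - C \<le> dist (c m) (c n) \<and>
        dist (c m) (c n) \<le> L * \<bar>of_int m - of_int n\<bar> + C)"

definition loxodromic :: "('a::metric_space \<Rightarrow> 'a) \<Rightarrow> bool" where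
  "loxodromic g \<longleftrightarrow> g \<in> isom_group \<and> (\<forall>x. quasi_geodesic_int (\<lambda>n. funpow_int g n x))"

text \<open>An isometry acts on classes of sequences by composition.\<close>

definition boundary_fixed_points :: "'a::metric_space \<Rightarrow> ('a \<Rightarrow> 'a) \<Rightarrow> 'a bord set" where
  "boundary_fixed_points b g = {Ideal \<xi> | \<xi>. \<xi> \<in> gromov_classes b \<and> (\<lambda>x. g \<circ> x) ` \<xi> = \<xi>}"

definition independent_loxodromics ::
    "'a::metric_space \<Rightarrow> ('a \<Rightarrow> 'a) \<Rightarrow> ('a \<Rightarrow> 'a) \<Rightarrow> bool" where
  "independent_loxodromics b g h \<longleftrightarrow> loxodromic g \<and> loxodromic h \<and>
     boundary_fixed_points b g \<inter> boundary_fixed_points b h = {}"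


section \<open>Measures on the isometry group\<close>

definition borel_on :: "'b topology \<Rightarrow> 'b measure" where
  "borel_on T = sigma (topspace T) {U. openin T U}"

definition isom_support :: "('a::metric_space \<Rightarrow> 'a) measure \<Rightarrow> ('a \<Rightarrow> 'a) set" where
  "isom_support \<mu> =
     {g \<in> isom_group. \<forall>U. openin isom_topology U \<and> g \<in> U \<longrightarrow> emeasure \<mu> U > 0}"

inductive_set semigroup_generated :: "('a \<Rightarrow> 'a) set \<Rightarrow> ('a \<Rightarrow> 'a) set"
  for S :: "('a \<Rightarrow> 'a) set" where
  gen: "g \<in> S \<Longrightarrow> g \<in> semigroup_generated S"
| mult: "g \<in> semigroup_generated S \<Longrightarrow> h \<in> semigroup_generated S \<Longrightarrow>
         g \<circ> h \<in> semigroup_generated S"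

definition non_elementary :: "'a::metric_space \<Rightarrow> ('a \<Rightarrow> 'a) measure \<Rightarrow> bool" where
  "non_elementary b \<mu> \<longleftrightarrow>
     (\<exists>g\<in>semigroup_generated (isom_support \<mu>). \<exists>h\<in>semigroup_generated (isom_support \<mu>).
        independent_loxodromics b g h)"

definition bounded_isoms :: "'a::metric_space \<Rightarrow> ('a \<Rightarrow> 'a) set \<Rightarrow> bool" where
  "bounded_isoms b S \<longleftrightarrow> bdd_above ((\<lambda>g. dist (g b) b) ` S)"

definition kappa :: "'a::metric_space \<Rightarrow> ('a \<Rightarrow> 'a) set \<Rightarrow> real" where
  "kappa b S = (SUP g\<in>S. dist (g b) b)"

definition lazy_measure :: "real \<Rightarrow> ('a \<Rightarrow> 'a) measure \<Rightarrow> ('a \<Rightarrow> 'a) measure" where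
  "lazy_measure r \<mu> = measure_of (space \<mu>) (sets \<mu>)
     (\<lambda>A. ennreal r * indicator A id + ennreal (1 - r) * emeasure \<mu> A)"

text \<open>Left Haar measures: nonzero left-invariant Radon measures.\<close>

definition left_haar_measure :: "('a::metric_space \<Rightarrow> 'a) measure \<Rightarrow> bool" where
  "left_haar_measure m \<longleftrightarrow>
     sets m = sets (borel_on isom_topology) \<and>
     emeasure m (space m) \<noteq> 0 \<and>
     (\<forall>g\<in>isom_group. \<forall>A\<in>sets m. emeasure m ((\<lambda>h. g \<circ> h) ` A) = emeasure m A) \<and>
     (\<forall>K. compactin isom_topology K \<longrightarrow> emeasure m K < \<infinity>) \<and>
     (\<forall>A\<in>sets m. emeasure m A = (INF U\<in>{U. openin isom_topology U \<and> A \<subseteq> U}. emeasure m U)) \<and>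
     (\<forall>U. openin isom_topology U \<longrightarrow>
        emeasure m U = (SUP K\<in>{K. compactin isom_topology K \<and> K \<subseteq> U}. emeasure m K))"

text \<open>
  \<open>L\<^sup>2\<close> is handled through representatives: square-integrable complex functions, with the
  \<open>L\<^sup>2\<close>-seminorm. Neither the operator below nor its norm depends on the choice of
  representative modulo null sets.
\<close>

definition L2_functions :: "'b measure \<Rightarrow> ('b \<Rightarrow> complex) set" where
  "L2_functions m = {f \<in> borel_measurable m. integrable m (\<lambda>h. (cmod (f h))\<^sup>2)}"

definition L2_seminorm :: "'b measure \<Rightarrow> ('b \<Rightarrow> complex) \<Rightarrow> real" where
  "L2_seminorm m f = sqrt (LINT h|m. (cmod (f h))\<^sup>2)"

text \<open>
  \<open>\<lambda>\<^sub>G(g) f (h) = f (g\<inverse> h)\<close> and \<open>\<lambda>\<^sub>G(\<mu>) f = \<integral> \<lambda>\<^sub>G(g) f d\<mu>(g)\<close>.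
  The inner integral converges for Haar-almost every \<open>h\<close>.
\<close>

definition left_regular ::
    "('a \<Rightarrow> 'a) measure \<Rightarrow> (('a \<Rightarrow> 'a) \<Rightarrow> complex) \<Rightarrow> ('a \<Rightarrow> 'a) \<Rightarrow> complex" where
  "left_regular \<mu> f h = (LINT g|\<mu>. f (inv g \<circ> h))"

definition left_regular_norm :: "('a \<Rightarrow> 'a) measure \<Rightarrow> ('a \<Rightarrow> 'a) measure \<Rightarrow> real" where
  "left_regular_norm m \<mu> =
     (SUP f\<in>{f \<in> L2_functions m. L2_seminorm m f \<le> 1}. L2_seminorm m (left_regular \<mu> f))"


section \<open>Random walk and harmonic measure\<close>

definition boundary_borel :: "'a::metric_space \<Rightarrow> 'a bord measure" where
  "boundary_borel b = borel_on (subtopology (bord_topology b) (gromov_boundary b))"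

text \<open>The increments \<open>X\<^sub>1, X\<^sub>2, \<dots>\<close> are \<open>\<omega> 0, \<omega> 1, \<dots>\<close>.\<close>

primrec walk :: "(nat \<Rightarrow> 'a \<Rightarrow> 'a) \<Rightarrow> nat \<Rightarrow> 'a \<Rightarrow> 'a" where
  "walk \<omega> 0 = id"
| "walk \<omega> (Suc n) = walk \<omega> n \<circ> \<omega> n"

definition increments :: "('a \<Rightarrow> 'a) measure \<Rightarrow> (nat \<Rightarrow> 'a \<Rightarrow> 'a) measure" where
  "increments \<mu> = (\<Pi>\<^sub>M i\<in>(UNIV::nat set). \<mu>)"

definition is_harmonic_measure ::
    "'a::metric_space \<Rightarrow> ('a \<Rightarrow> 'a) measure \<Rightarrow> 'a bord measure \<Rightarrow> bool" where
  "is_harmonic_measure b \<mu> \<nu> \<longleftrightarrow>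
     (\<exists>Z \<in> measurable (increments \<mu>) (boundary_borel b).
        (AE \<omega> in increments \<mu>.
           limitin (bord_topology b) (\<lambda>n. Point (walk \<omega> n b)) (Z \<omega>) sequentially) \<and>
        \<nu> = distr (increments \<mu>) (boundary_borel b) Z)"

text \<open>\<open>exp\<close> on the extended reals, with \<open>exp (-\<infinity>) = 0\<close>. Recall \<open>0 * \<infinity> = 0\<close> in \<open>ereal\<close>.\<close>

definition ereal_exp :: "ereal \<Rightarrow> ennreal" where
  "ereal_exp x = (case x of ereal r \<Rightarrow> ennreal (exp r) | PInfty \<Rightarrow> \<infinity> | MInfty \<Rightarrow> 0)"

definition K_const :: "'a::metric_space \<Rightarrow> 'a bord measure \<Rightarrow> real \<Rightarrow> ennreal" where
  "K_const b \<nu> s =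
     (SUP p\<in>bordification b. \<integral>\<^sup>+ q. ereal_exp (ereal s * ext_gromov_product b p q) \<partial>\<nu>)"

end

theory Submission
  imports Defs
begin

text \<open>
  Write \<open>\<rho>\<close> for the norm of the regular representation of a lazy version of \<open>\<mu>\<close>, and \<open>\<kappa>\<close> for
  the bound on the jumps. Applying powers of the operator to the indicator of a ball of \<open>G\<close> and averaging
  over a translated ball shows that \<open>R\<^sub>k o\<close> lies in a given orbit ball with probability at most \<open>C \<rho>\<^sup>k\<close>,
  uniformly in the ball; the lazy walk only delays the walk, so the same bound holds without laziness.
  Because of exponential growth the walk then escapes linearly, outside an event of exponentially small
  probability.

  Let \<open>(x|R\<^sub>n o) \<ge> t\<close> and let \<open>p\<close> be the point at distance \<open>t\<close> from \<open>o\<close> on a geodesic from \<open>o\<close> to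
  \<open>x\<close>. By linear escape the shadow of \<open>p\<close> is entered within \<open>N = O(t)\<close> steps, and a path of \<open>N\<close> bounded
  jumps that enters it comes within \<open>O(log N)\<close> of \<open>p\<close> by hyperbolicity. Reaching that neighbourhood of \<open>p\<close>
  takes at least \<open>t/\<kappa> - O(log t)\<close> steps, so this has probability \<open>\<rho>\<^bsup>t/\<kappa>\<^esup>\<close> up to a polynomial factor in
  \<open>t\<close>, which any \<open>s < ln (1/\<rho>) / \<kappa>\<close> absorbs. The extended Gromov product is an infimum over sequences,
  so \<open>(x|Z) \<ge> t\<close> forces \<open>(x\<^sub>n|R\<^sub>n o) \<ge> t - 1\<close> eventually for every \<open>x\<^sub>n \<rightarrow> x\<close>, and the tail bound passes to the limit.
\<close>

section \<open>The isometry group and its Borel structure\<close>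

text \<open>The rate \<open>1/\<kappa>\<close> has to survive exactly, so every loss must be
  polynomial in \<open>t\<close>. The candidate times number at most \<open>N + 1\<close>; the ball
  around \<open>p\<close> has radius \<open>O(log t)\<close> and, orbit growth being at most
  exponential, is covered by polynomially many orbit balls of one fixed radius; only the wait of
  about \<open>t/\<kappa>\<close> steps is exponential. Linear escape serves only to cap the time at
  \<open>N\<close>, so its poor rate is harmless: \<open>N\<close> is a multiple of \<open>t\<close>
  large enough to make a failure of escape as rare as \<open>exp (- s * t)\<close>. The other
  obstacle is measurability. The \<sigma>-algebra on the group is generated by the compact-open
  topology, whereas composition and Fubini live on product \<sigma>-algebras. Properness makes the
  topology second countable, with a base cut out by the functions \<open>dist (g x) y\<close>, so
  measurability reduces to such distances. It also makes the balls of the group compact, which puts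
  their indicators into \<open>L2\<close>. On the boundary, measurability of the extended product
  comes from lower semicontinuity.\<close>

lemma isom_group_dist: "g \<in> isom_group \<Longrightarrow> dist (g x) (g y) = dist x y"
  by (simp add: isom_group_def)

lemma isom_group_bij: "g \<in> isom_group \<Longrightarrow> bij g"
  unfolding isom_group_def bij_def inj_def by (auto, metis dist_eq_0_iff)

lemma isom_group_inv_apply:
  assumes "g \<in> isom_group"
  shows "g (inv g x) = x" "inv g (g x) = x"
  using isom_group_bij[OF assms] by (metis bij_inv_eq_iff)+

lemma isom_group_id [simp]: "id \<in> isom_group"
  by (simp add: isom_group_def)

lemma isom_group_comp [simp]: "g \<in> isom_group \<Longrightarrow> h \<in> isom_group \<Longrightarrow> g \<circ> h \<in> isom_group"
  unfolding isom_group_def using comp_surj[of h g] by simp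

lemma isom_group_inv [simp]:
  assumes "g \<in> isom_group"
  shows "inv g \<in> isom_group"
proof -
  have "dist (inv g x) (inv g y) = dist x y" for x y
    using isom_group_dist[OF assms, of "inv g x" "inv g y"]
    by (simp add: isom_group_inv_apply[OF assms])
  then show ?thesis
    using isom_group_bij[OF assms] by (simp add: isom_group_def bij_imp_bij_inv bij_is_surj)
qed

lemma isom_group_dist_inv:
  assumes "g \<in> isom_group"
  shows "dist (inv g x) y = dist x (g y)"
  using isom_group_dist[OF assms, of "inv g x" y]
  by (simp add: isom_group_inv_apply[OF assms])

lemma isom_group_comp_inv:
  assumes "g \<in> isom_group"
  shows "g \<circ> (inv g \<circ> h) = h" "inv g \<circ> (g \<circ> h) = h"
  by (simp_all add: fun_eq_iff isom_group_inv_apply[OF assms])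

lemma isom_group_inv_comp:
  assumes "g \<in> isom_group" "h \<in> isom_group"
  shows "inv (g \<circ> h) = inv h \<circ> inv g"
  using assms by (intro o_inv_distrib isom_group_bij)

lemma topspace_isom_topology [simp]: "topspace isom_topology = isom_group"
proof -
  have "UNIV \<in> {{f. f ` K \<subseteq> U} | K U. compact K \<and> open U}"
    by (intro CollectI exI[of _ "{}"]) auto
  then show ?thesis
    unfolding isom_topology_def topspace_subtopology topology_generated_by_topspace by blast
qed

lemma space_borel_on [simp]: "space (borel_on T) = topspace T"
  unfolding borel_on_def by (rule space_measure_of) (auto dest: openin_subset)

lemma sets_borel_on: "sets (borel_on T) = sigma_sets (topspace T) {U. openin T U}"
  unfolding borel_on_def by (rule sets_measure_of) (auto dest: openin_subset)

lemma openin_imp_sets_borel_on: "openin T U \<Longrightarrow> U \<in> sets (borel_on T)"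
  by (simp add: sets_borel_on)

lemma openin_isom_eval: "openin isom_topology {g \<in> isom_group. dist (g x) y < e}"
proof -
  have "openin (topology_generated_by {{f. f ` K \<subseteq> U} | K U. compact K \<and> open U})
     {f::'a \<Rightarrow> 'a. f ` {x} \<subseteq> ball y e}"
    by (intro topology_generated_by_Basis CollectI exI[of _ "{x}"] exI[of _ "ball y e"] conjI)
       simp_all
  moreover have "{g \<in> isom_group. dist (g x) y < e} = {f. f ` {x} \<subseteq> ball y e} \<inter> isom_group"
    by (auto simp: dist_commute)
  ultimately show ?thesis
    unfolding isom_topology_def openin_subtopology by blast
qed

lemma borel_measurable_isom_eval:
  "(\<lambda>g. dist (g x) y) \<in> borel_measurable (borel_on isom_topology)"
proof (rule borel_measurableI_less)
  fix e
  show "{g \<in> space (borel_on isom_topology). dist (g x) y < e} \<in> sets (borel_on isom_topology)"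
    unfolding space_borel_on topspace_isom_topology
    by (rule openin_imp_sets_borel_on[OF openin_isom_eval])
qed

section \<open>Countable base of the compact-open topology\<close>

locale proper_metric_space =
  fixes b :: "'a::metric_space"
  assumes proper: "proper_space TYPE('a)"
begin

lemma compact_cball': "compact (cball (x::'a) r)"
  using proper by (simp add: proper_space_def)

definition dense_seq :: "'a set" where
  "dense_seq = (SOME D. countable D \<and> (\<forall>x. \<forall>e>0. \<exists>y\<in>D. dist x y < e))"

lemma dense_seq:
  shows "countable dense_seq" and dense_seqE: "e > 0 \<Longrightarrow> \<exists>y\<in>dense_seq. dist x y < e"
proof -
  have "\<exists>k. finite k \<and> cball b (real n) \<subseteq> (\<Union>x\<in>k. ball x (1 / real (Suc j)))" for n j
    using compact_cball'[of b "real n"] unfolding compact_eq_totally_bounded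
    by (metis zero_less_divide_1_iff of_nat_0_less_iff zero_less_Suc)
  then obtain k where k: "\<And>n j. finite (k n j)"
      "\<And>n j. cball b (real n) \<subseteq> (\<Union>x\<in>k n j. ball x (1 / real (Suc j)))"
    by metis
  define D where "D = (\<Union>n j. k n j)"
  have "countable D"
    unfolding D_def using k(1) by (intro countable_UN) (auto simp: countable_finite)
  moreover have "\<exists>y\<in>D. dist x y < e" if e: "e > 0" for x and e :: real
  proof -
    obtain j where j: "1 / real (Suc j) < e"
      using nat_approx_posE[OF e] by metis
    obtain n where "dist b x \<le> real n"
      using real_arch_simple by blast
    then obtain y where "y \<in> k n j" "dist y x < 1 / real (Suc j)"
      using k(2)[of n j] by (auto simp: subset_iff)
    then show ?thesis
      using j unfolding D_def by (force simp: dist_commute)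
  qed
  ultimately have "\<exists>D. countable D \<and> (\<forall>x. \<forall>e>0. \<exists>y\<in>D. dist (x::'a) y < e)"
    by blast
  from someI_ex[OF this]
  show "countable dense_seq" "e > 0 \<Longrightarrow> \<exists>y\<in>dense_seq. dist x y < e"
    unfolding dense_seq_def by blast+
qed

text \<open>Isometries are equicontinuous: closeness at the points of a finite
  \<open>e/3\<close>-net controls \<open>h\<close> on all of \<open>K\<close>. Hence on the group
  the compact-open topology is that of pointwise convergence, tested at finitely many points of the
  dense set.\<close>

lemma compact_open_nhd:
  assumes g: "g \<in> isom_group" and K: "compact K" and U: "open U" and gK: "g ` K \<subseteq> (U :: 'a set)"
  obtains X e where "finite X" "X \<subseteq> dense_seq" "e > 0"
    "\<And>h. h \<in> isom_group \<Longrightarrow> (\<And>x. x \<in> X \<Longrightarrow> dist (h x) (g x) < e) \<Longrightarrow> h ` K \<subseteq> U"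
proof -
  have "continuous_on K g"
    unfolding continuous_on_iff by (auto simp: isom_group_dist[OF g])
  then have "compact (g ` K)"
    using K by (rule compact_continuous_image)
  then obtain e where e: "e > 0" "(\<Union>x\<in>g ` K. ball x e) \<subseteq> U"
    using compact_subset_open_imp_ball_epsilon_subset[OF _ U gK] by blast
  have "\<exists>D'\<subseteq>dense_seq. finite D' \<and> K \<subseteq> (\<Union>x\<in>D'. ball x (e/3))"
  proof -
    have "K \<subseteq> (\<Union>x\<in>dense_seq. ball x (e/3))"
    proof
      fix x
      obtain y where "y \<in> dense_seq" "dist x y < e/3"
        using dense_seqE[of "e/3" x] e(1) by auto
      then show "x \<in> (\<Union>x\<in>dense_seq. ball x (e/3))"
        by (auto simp: dist_commute)
    qed
    from compactE_image[OF K _ this] show ?thesis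
      by (metis open_ball)
  qed
  then obtain X where X: "X \<subseteq> dense_seq" "finite X" "K \<subseteq> (\<Union>x\<in>X. ball x (e/3))"
    by blast
  show ?thesis
  proof (rule that[OF X(2,1), of "e/3"])
    show "e / 3 > 0" using e by simp
    fix h assume h: "h \<in> isom_group" "\<And>x. x \<in> X \<Longrightarrow> dist (h x) (g x) < e/3"
    show "h ` K \<subseteq> U"
    proof
      fix y assume "y \<in> h ` K"
      then obtain x where x: "x \<in> K" "y = h x" by blast
      then obtain z where z: "z \<in> X" "dist z x < e/3" using X by auto
      have "dist (h x) (g x) \<le> dist (h x) (h z) + dist (h z) (g z) + dist (g z) (g x)"
        by (smt (verit) dist_triangle)
      also have "\<dots> < e"
        using h(2)[OF z(1)] z(2)
        by (simp add: isom_group_dist[OF g] isom_group_dist[OF h(1)] dist_commute[of x z])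
      finally have "h x \<in> ball (g x) e"
        by (simp add: dist_commute)
      then show "y \<in> U"
        using x e(2) by blast
    qed
  qed
qed

text \<open>The target \<open>y\<close> replaces the unknown value \<open>g x\<close>, and the radii
  are \<open>1 / (k + 1)\<close>: only countably many indices remain once \<open>x\<close> and
  \<open>y\<close> range over the dense set.\<close>

definition isom_base :: "('a \<times> 'a \<times> nat) set \<Rightarrow> ('a \<Rightarrow> 'a) set" where
  "isom_base F = {h \<in> isom_group. \<forall>(x, y, k)\<in>F. dist (h x) y < 1 / real (Suc k)}"

definition base_index :: "('a \<times> 'a \<times> nat) set set" where
  "base_index = {F. finite F \<and> F \<subseteq> dense_seq \<times> dense_seq \<times> UNIV}"

lemma countable_base_index: "countable base_index"
proof -
  have "countable (dense_seq \<times> dense_seq \<times> (UNIV :: nat set))"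
    using dense_seq(1) by auto
  from countable_Collect_finite_subset[OF this] show ?thesis
    by (simp add: base_index_def)
qed

lemma isom_base_nhd:
  assumes g: "g \<in> isom_group" and X: "finite X" "X \<subseteq> dense_seq" and e: "e > 0"
  obtains F where "F \<in> base_index" "g \<in> isom_base F"
    "\<And>h x. h \<in> isom_base F \<Longrightarrow> x \<in> X \<Longrightarrow> dist (h x) (g x) < e"
proof -
  obtain k where k: "1 / real (Suc k) < e / 2"
    using nat_approx_posE[of "e/2"] e by (metis half_gt_zero)
  have "\<exists>y. y \<in> dense_seq \<and> dist (g x) y < 1 / real (Suc k)" for x
    using dense_seqE[of "1 / real (Suc k)" "g x"] by (auto simp del: of_nat_Suc)
  then obtain y where y: "\<And>x. y x \<in> dense_seq" "\<And>x. dist (g x) (y x) < 1 / real (Suc k)"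
    by metis
  show ?thesis
  proof (rule that[of "(\<lambda>x. (x, y x, k)) ` X"])
    show "(\<lambda>x. (x, y x, k)) ` X \<in> base_index"
      using X y by (auto simp: base_index_def)
    show "g \<in> isom_base ((\<lambda>x. (x, y x, k)) ` X)"
      using g y by (auto simp: isom_base_def simp del: of_nat_Suc)
    fix h x assume "h \<in> isom_base ((\<lambda>x. (x, y x, k)) ` X)" "x \<in> X"
    then have "dist (h x) (y x) < 1 / real (Suc k)"
      by (auto simp: isom_base_def simp del: of_nat_Suc)
    then show "dist (h x) (g x) < e"
      using y(2)[of x] k dist_triangle2[of "h x" "g x" "y x"] by linarith
  qed
qed

lemma isom_base_Un: "isom_base (F \<union> F') = isom_base F \<inter> isom_base F'"
  unfolding isom_base_def by blast

lemma base_index_Un: "F \<in> base_index \<Longrightarrow> F' \<in> base_index \<Longrightarrow> F \<union> F' \<in> base_index"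
  by (auto simp: base_index_def)

text \<open>With \<open>countable_base_index\<close> this is second countability. It lets countable
  unions of base sets stand in for arbitrary open sets in measurability and null-set
  arguments.\<close>

lemma openin_isom_base:
  assumes "openin isom_topology W" "g \<in> W"
  obtains F where "F \<in> base_index" "g \<in> isom_base F" "isom_base F \<subseteq> W"
proof -
  have *: "\<exists>F\<in>base_index. g \<in> isom_base F \<and> isom_base F \<subseteq> T"
    if "generate_topology_on {{f. f ` K \<subseteq> U} | K U. compact K \<and> open U} T"
      "g \<in> isom_group" "g \<in> T" for T and g :: "'a \<Rightarrow> 'a"
    using that(1) that(2,3)
  proof (induction arbitrary: g rule: generate_topology_on.induct)
    case Empty
    then show ?case by simp
  next
    case (Int A B)
    have "g \<in> A" "g \<in> B"
      using Int.prems(2) by auto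
    from Int.IH(1)[OF Int.prems(1) this(1)] obtain F where
      F: "F \<in> base_index" "g \<in> isom_base F" "isom_base F \<subseteq> A"
      by blast
    from Int.IH(2)[OF Int.prems(1) \<open>g \<in> B\<close>] obtain F' where
      F': "F' \<in> base_index" "g \<in> isom_base F'" "isom_base F' \<subseteq> B"
      by blast
    have "g \<in> isom_base (F \<union> F')" "isom_base (F \<union> F') \<subseteq> A \<inter> B"
      unfolding isom_base_Un using F(2,3) F'(2,3) by blast+
    then show ?case
      using base_index_Un[OF F(1) F'(1)] by blast
  next
    case (UN K)
    from UN.prems(2) obtain k where k: "k \<in> K" "g \<in> k" by blast
    from UN.IH[OF k(1) UN.prems(1) k(2)] obtain F where
      F: "F \<in> base_index" "g \<in> isom_base F" "isom_base F \<subseteq> k"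
      by blast
    have "isom_base F \<subseteq> \<Union> K"
      using F(3) k(1) by blast
    with F(1,2) show ?case by blast
  next
    case (Basis s)
    from Basis(1) obtain K U where KU: "s = {f. f ` K \<subseteq> U}" "compact K" "open U" by blast
    have "g ` K \<subseteq> U" using Basis(3) KU(1) by simp
    from compact_open_nhd[OF Basis(2) KU(2,3) this]
    obtain X e where X: "finite X" "X \<subseteq> dense_seq" "e > 0"
    "\<And>h. h \<in> isom_group \<Longrightarrow> (\<And>x. x \<in> X \<Longrightarrow> dist (h x) (g x) < e) \<Longrightarrow> h ` K \<subseteq> U"
      by metis
    from isom_base_nhd[OF Basis(2) X(1-3)]
    obtain F where F: "F \<in> base_index" "g \<in> isom_base F"
      "\<And>h x. h \<in> isom_base F \<Longrightarrow> x \<in> X \<Longrightarrow> dist (h x) (g x) < e"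
      by metis
    have "h \<in> s" if "h \<in> isom_base F" for h
    proof -
      have "h \<in> isom_group"
        using that by (simp add: isom_base_def)
      from X(4)[OF this F(3)[OF that]] show ?thesis
        by (simp add: KU(1))
    qed
    with F(1,2) show ?case by blast
  qed
  from assms(1)[unfolded isom_topology_def openin_subtopology]
  obtain T where T: "openin (topology_generated_by {{f. f ` K \<subseteq> U} | K U. compact K \<and> open U}) T"
      "W = T \<inter> isom_group"
    by (elim exE conjE)
  have "g \<in> isom_group" "g \<in> T"
    using assms(2) T(2) by blast+
  from *[OF T(1)[unfolded openin_topology_generated_by_iff] this]
  obtain F where F: "F\<in>base_index" "g \<in> isom_base F" "isom_base F \<subseteq> T"
    by blast
  have "isom_base F \<subseteq> W"
    using F(3) unfolding T(2) isom_base_def by blast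
  with F(1,2) show ?thesis
    by (rule that)
qed

lemma openin_isom_countable_Union:
  assumes "openin isom_topology W"
  shows "W = (\<Union>F\<in>{F\<in>base_index. isom_base F \<subseteq> W}. isom_base F)"
  using openin_isom_base[OF assms] by blast

section \<open>Measurability of group-valued maps\<close>

text \<open>The preimage of an open set is a countable union of preimages of base sets, each of them
  a finite conjunction of inequalities between distances.\<close>

lemma measurable_into_isom:
  assumes "\<And>\<omega>. \<omega> \<in> space N \<Longrightarrow> \<phi> \<omega> \<in> isom_group"
    and "\<And>x y. (\<lambda>\<omega>. dist (\<phi> \<omega> (x::'a)) y) \<in> borel_measurable N"
  shows "\<phi> \<in> measurable N (borel_on isom_topology)"
proof (rule measurable_sigma_sets[OF sets_borel_on])
  show "{U. openin isom_topology U} \<subseteq> Pow (topspace isom_topology)"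
    using openin_subset[of "isom_topology"] by auto
  show "\<phi> \<in> space N \<rightarrow> topspace isom_topology"
    using assms(1) by auto
  fix W assume "W \<in> {U. openin (isom_topology :: ('a \<Rightarrow> 'a) topology) U}"
  then have W: "openin isom_topology W" by simp
  have *: "\<phi> -` isom_base F \<inter> space N \<in> sets N" if "F \<in> base_index" for F
  proof -
    have "\<phi> -` isom_base F \<inter> space N = {\<omega> \<in> space N. \<forall>p\<in>F. dist (\<phi> \<omega> (fst p)) (fst (snd p)) < 1 / real (Suc (snd (snd p)))}"
      using assms(1) by (auto simp: isom_base_def)
    also have "\<dots> \<in> sets N"
      using that assms(2) unfolding base_index_def
      by (intro sets.sets_Collect_finite_All) (auto intro!: borel_measurable_less simp del: of_nat_Suc)
    finally show ?thesis .
  qed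
  have "\<phi> -` W \<inter> space N = (\<Union>F\<in>{F\<in>base_index. isom_base F \<subseteq> W}. \<phi> -` isom_base F \<inter> space N)"
    by (subst openin_isom_countable_Union[OF W]) auto
  also have "\<dots> \<in> sets N"
    using countable_base_index * by (intro sets.countable_UN') (auto intro: countable_subset)
  finally show "\<phi> -` W \<inter> space N \<in> sets N" .
qed

lemma isom_base_sets: 
  assumes "F \<in> base_index"
  shows "isom_base F \<in> sets (borel_on isom_topology)"
proof -
  have "isom_base F = {h \<in> space (borel_on isom_topology). \<forall>p\<in>F. dist (h (fst p)) (fst (snd p)) < 1 / real (Suc (snd (snd p)))}"
    by (auto simp: isom_base_def)
  also have "\<dots> \<in> sets (borel_on isom_topology)"
    using assms borel_measurable_isom_eval unfolding base_index_def
    by (intro sets.sets_Collect_finite_All) (auto intro!: borel_measurable_less simp del: of_nat_Suc space_borel_on)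
  finally show ?thesis .
qed

text \<open>The strict inequality factors through a point \<open>z\<close> of the dense set, so the
  joint distance is handled by a countable union in which each random point is compared with a fixed
  one.\<close>

lemma borel_measurable_dist_comp:
  assumes "\<And>x y. (\<lambda>\<omega>. dist (\<phi> \<omega> (x::'a)) (y::'a)) \<in> borel_measurable N"
    and "\<And>x y. (\<lambda>\<omega>. dist (\<psi> \<omega> (x::'a)) (y::'a)) \<in> borel_measurable N"
  shows "(\<lambda>\<omega>. dist (\<phi> \<omega> (x::'a)) (\<psi> \<omega> (y::'a))) \<in> borel_measurable N"
proof (rule borel_measurableI_less)
  fix c
  have *: "dist (\<phi> \<omega> x) (\<psi> \<omega> y) < c \<longleftrightarrow> (\<exists>z\<in>dense_seq. dist (\<phi> \<omega> x) z + dist (\<psi> \<omega> y) z < c)" for \<omega>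
  proof
    assume "dist (\<phi> \<omega> x) (\<psi> \<omega> y) < c"
    then have "0 < (c - dist (\<phi> \<omega> x) (\<psi> \<omega> y)) / 2" by simp
    from dense_seqE[OF this, of "\<psi> \<omega> y"] obtain z where
      "z \<in> dense_seq" and z: "2 * dist (\<psi> \<omega> y) z < c - dist (\<phi> \<omega> x) (\<psi> \<omega> y)"
      by (auto simp: field_simps)
    have "dist (\<phi> \<omega> x) z \<le> dist (\<phi> \<omega> x) (\<psi> \<omega> y) + dist (\<psi> \<omega> y) z"
      by (rule dist_triangle)
    then have "dist (\<phi> \<omega> x) z + dist (\<psi> \<omega> y) z < c"
      using z by linarith
    then show "\<exists>z\<in>dense_seq. dist (\<phi> \<omega> x) z + dist (\<psi> \<omega> y) z < c"
      using \<open>z \<in> dense_seq\<close> by blast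
  next
    assume "\<exists>z\<in>dense_seq. dist (\<phi> \<omega> x) z + dist (\<psi> \<omega> y) z < c"
    then obtain z where "dist (\<phi> \<omega> x) z + dist (\<psi> \<omega> y) z < c" by blast
    then show "dist (\<phi> \<omega> x) (\<psi> \<omega> y) < c"
      using dist_triangle2[of "\<phi> \<omega> x" "\<psi> \<omega> y" z] by linarith
  qed
  show "{\<omega> \<in> space N. dist (\<phi> \<omega> x) (\<psi> \<omega> y) < c} \<in> sets N"
  proof -
    have "{\<omega> \<in> space N. dist (\<phi> \<omega> x) (\<psi> \<omega> y) < c} =
        (\<Union>z\<in>dense_seq. {\<omega> \<in> space N. dist (\<phi> \<omega> x) z + dist (\<psi> \<omega> y) z < c})"
      unfolding * by blast
    also have "\<dots> \<in> sets N"
      by (intro sets.countable_UN'' dense_seq(1) borel_measurable_less borel_measurable_add assms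
          borel_measurable_const)
    finally show ?thesis .
  qed
qed

text \<open>The combination \<open>inv \<phi> \<circ> \<psi>\<close> comes before inversion and
  composition, because its distances \<open>dist (\<psi> x) (\<phi> y)\<close> no longer contain an
  inverse. Inversion is the case \<open>\<psi> = id\<close>, and composition inverts twice.\<close>

lemma measurable_isom_inv_comp:
  assumes \<phi>: "\<phi> \<in> measurable N (borel_on isom_topology)" and \<psi>: "\<psi> \<in> measurable N (borel_on isom_topology)"
  shows "(\<lambda>\<omega>. inv (\<phi> \<omega>) \<circ> (\<psi> \<omega> :: 'a \<Rightarrow> 'a)) \<in> measurable N (borel_on isom_topology)"
proof (rule measurable_into_isom)
  have in_group: "\<phi> \<omega> \<in> isom_group" "\<psi> \<omega> \<in> isom_group" if "\<omega> \<in> space N" for \<omega>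
    using measurable_space[OF \<phi> that] measurable_space[OF \<psi> that] by auto
  then show "inv (\<phi> \<omega>) \<circ> \<psi> \<omega> \<in> isom_group" if "\<omega> \<in> space N" for \<omega>
    using that by simp
  fix x y
  have "(\<lambda>\<omega>. dist (\<psi> \<omega> x) (\<phi> \<omega> y)) \<in> borel_measurable N"
    by (rule borel_measurable_dist_comp)
       (use measurable_compose[OF \<phi> borel_measurable_isom_eval] measurable_compose[OF \<psi> borel_measurable_isom_eval] in auto)
  then show "(\<lambda>\<omega>. dist ((inv (\<phi> \<omega>) \<circ> \<psi> \<omega>) x) y) \<in> borel_measurable N"
    by (rule measurable_cong[THEN iffD1, rotated]) (simp add: isom_group_dist_inv in_group)
qed

lemma measurable_isom_inv_comp' [measurable]:
  "(\<lambda>p. inv (fst p) \<circ> (snd p :: 'a \<Rightarrow> 'a)) \<in> measurable (borel_on isom_topology \<Otimes>\<^sub>M borel_on isom_topology) (borel_on isom_topology)"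
  using measurable_isom_inv_comp[OF measurable_fst measurable_snd] .

lemma measurable_isom_comp:
  assumes \<phi>: "\<phi> \<in> measurable N (borel_on isom_topology)" and \<psi>: "\<psi> \<in> measurable N (borel_on isom_topology)"
  shows "(\<lambda>\<omega>. \<phi> \<omega> \<circ> (\<psi> \<omega> :: 'a \<Rightarrow> 'a)) \<in> measurable N (borel_on isom_topology)"
proof -
  have in_group: "\<phi> \<omega> \<in> isom_group" "\<psi> \<omega> \<in> isom_group" if "\<omega> \<in> space N" for \<omega>
    using measurable_space[OF \<phi> that] measurable_space[OF \<psi> that] by auto
  have "(\<lambda>\<omega>. inv (\<phi> \<omega>) \<circ> (id :: 'a \<Rightarrow> 'a)) \<in> measurable N (borel_on isom_topology)"
    using measurable_isom_inv_comp[OF \<phi> measurable_const[of id]] by simp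
  from measurable_isom_inv_comp[OF this \<psi>] show ?thesis
    by (rule measurable_cong[THEN iffD1, rotated]) (simp add: inv_inv_eq isom_group_bij in_group)
qed

end

section \<open>Haar measure and the regular representation\<close>

context proper_metric_space
begin

definition isom_ball :: "real \<Rightarrow> ('a \<Rightarrow> 'a) set" where
  "isom_ball R = {g \<in> isom_group. dist (g b) b \<le> R}"

lemma isom_ball_sets: "isom_ball R \<in> sets (borel_on isom_topology)"
proof -
  have "isom_ball R = {g \<in> space (borel_on isom_topology). dist (g b) b \<le> R}"
    by (simp add: isom_ball_def)
  also have "\<dots> \<in> sets (borel_on isom_topology)"
    by (intro borel_measurable_le borel_measurable_isom_eval borel_measurable_const)
  finally show ?thesis .
qed

text \<open>The first coordinate of a pair \<open>(f, f')\<close> with \<open>d(f x, y) = d(x, f' y)\<close> for all \<open>x, y\<close> is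
  a surjective isometry with inverse \<open>f'\<close>. This condition on pairs is closed under pointwise convergence,
  so Tychonoff's theorem applies without a discussion of surjectivity of limits.\<close>

definition adjoint_pairs :: "real \<Rightarrow> ('a + 'a \<Rightarrow> 'a) set" where
  "adjoint_pairs R = {F. \<forall>x y. dist (F (Inl x)) y = dist x (F (Inr y))} \<inter>
     (\<Pi>\<^sub>E i\<in>UNIV. cball b (R + dist (case_sum id id i) b))"

lemma compact_adjoint_pairs: "compact (adjoint_pairs R)"
proof -
  have "compactin (product_topology (\<lambda>_. euclidean) UNIV)
      (\<Pi>\<^sub>E i\<in>UNIV. cball b (R + dist (case_sum id id i) b))"
    by (simp add: compactin_PiE compact_cball')
  then have "compact (\<Pi>\<^sub>E i\<in>UNIV. cball b (R + dist (case_sum id id i) b) :: ('a + 'a \<Rightarrow> 'a) set)"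
    by (simp add: euclidean_product_topology)
  moreover have "closed {F :: 'a + 'a \<Rightarrow> 'a. \<forall>x y. dist (F (Inl x)) y = dist x (F (Inr y))}"
    by (intro closed_Collect_all closed_Collect_eq continuous_on_dist continuous_on_product_coordinates
        continuous_on_const)
  ultimately show ?thesis
    unfolding adjoint_pairs_def by (rule closed_Int_compact[rotated])
qed

lemma adjoint_pairs_isom:
  assumes "F \<in> adjoint_pairs R"
  shows "F \<circ> Inl \<in> isom_group"
proof -
  have adj: "dist (F (Inl x)) y = dist x (F (Inr y))" for x y
    using assms by (simp add: adjoint_pairs_def)
  have 1: "F (Inl (F (Inr y))) = y" for y
    using adj[of "F (Inr y)" y] by simp
  have 2: "F (Inr (F (Inl x))) = x" for x
    using adj[of x "F (Inl x)"] by simp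
  have "dist (F (Inl x)) (F (Inl y)) = dist x y" for x y
    using adj[of x "F (Inl y)"] by (simp add: 2)
  moreover have "surj (F \<circ> Inl)"
    by (rule surjI[of _ "F \<circ> Inr"]) (simp add: 1)
  ultimately show ?thesis
    by (simp add: isom_group_def)
qed

lemma isom_ball_eq_image: "isom_ball R = (\<lambda>F. F \<circ> Inl) ` adjoint_pairs R"
proof (intro equalityI subsetI)
  fix g assume "g \<in> isom_ball R"
  then have g: "g \<in> isom_group" "dist (g b) b \<le> R"
    by (auto simp: isom_ball_def)
  have "dist (g x) b \<le> R + dist x b" for x
    using dist_triangle[of "g x" b "g b"] g(2) isom_group_dist[OF g(1), of x b] by linarith
  moreover have "dist (inv g x) b \<le> R + dist x b" for x
    using dist_triangle[of x "g b" b] g(2)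
    by (simp add: isom_group_dist_inv[OF g(1)] dist_commute[of b])
  ultimately have "case_sum g (inv g) \<in> adjoint_pairs R"
    by (auto simp: adjoint_pairs_def isom_group_dist_inv[OF g(1)] dist_commute split: sum.split)
       (metis isom_group_dist_inv[OF g(1)] dist_commute)
  then show "g \<in> (\<lambda>F. F \<circ> Inl) ` adjoint_pairs R"
    by (rule rev_image_eqI) (simp add: fun_eq_iff)
next
  fix g assume "g \<in> (\<lambda>F. F \<circ> Inl) ` adjoint_pairs R"
  then obtain F where F: "F \<in> adjoint_pairs R" "g = F \<circ> Inl" by blast
  then have "F (Inl b) \<in> cball b (R + dist (case_sum id id (Inl b)) b)"
    unfolding adjoint_pairs_def by blast
  then have "dist (F (Inl b)) b \<le> R"
    by (simp add: dist_commute)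
  then show "g \<in> isom_ball R"
    using adjoint_pairs_isom[OF F(1)] by (simp add: isom_ball_def F(2))
qed

text \<open>A base set constrains finitely many coordinates, so restriction to the first summand is
  continuous from the product topology and transports the compactness of
  \<open>adjoint_pairs\<close>. The purpose is finiteness of Haar measure on these balls.\<close>

lemma compactin_isom_ball: "compactin isom_topology (isom_ball R)"
  unfolding isom_ball_eq_image
proof (rule image_compactin)
  show "compactin (top_of_set (adjoint_pairs R)) (adjoint_pairs R)"
    using compact_adjoint_pairs[of R] by (simp add: compactin_subtopology)
  show "continuous_map (top_of_set (adjoint_pairs R)) isom_topology (\<lambda>F. F \<circ> Inl)"
    unfolding continuous_map
  proof (intro conjI allI impI)
    show "(\<lambda>F. F \<circ> Inl) ` topspace (top_of_set (adjoint_pairs R)) \<subseteq> topspace isom_topology"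
      using adjoint_pairs_isom by auto
    fix W :: "('a \<Rightarrow> 'a) set" assume W: "openin isom_topology W"
    have "open {F :: 'a + 'a \<Rightarrow> 'a. \<forall>p\<in>B. dist (F (Inl (fst p))) (fst (snd p)) < 1 / real (Suc (snd (snd p)))}" 
      if "finite B" for B :: "('a \<times> 'a \<times> nat) set"
      using that
      by (induction B)
         (auto simp del: of_nat_Suc intro!: open_Collect_conj open_Collect_less continuous_on_dist
           continuous_on_product_coordinates continuous_on_const)
    then have *: "openin (top_of_set (adjoint_pairs R))
        (adjoint_pairs R \<inter> {F. \<forall>p\<in>B. dist (F (Inl (fst p))) (fst (snd p)) < 1 / real (Suc (snd (snd p)))})"
      if "B \<in> base_index" for B
      using that by (simp add: base_index_def openin_open_Int del: of_nat_Suc)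
    have base: "adjoint_pairs R \<inter> {F. \<forall>p\<in>B. dist (F (Inl (fst p))) (fst (snd p)) < 1 / real (Suc (snd (snd p)))}
        = {F \<in> adjoint_pairs R. F \<circ> Inl \<in> isom_base B}" for B
      using adjoint_pairs_isom by (auto simp: isom_base_def simp del: of_nat_Suc)
    have "{F \<in> topspace (top_of_set (adjoint_pairs R)). F \<circ> Inl \<in> W} =
        (\<Union>B\<in>{B\<in>base_index. isom_base B \<subseteq> W}. {F \<in> adjoint_pairs R. F \<circ> Inl \<in> isom_base B})"
      by (subst openin_isom_countable_Union[OF W]) auto
    also have "openin (top_of_set (adjoint_pairs R)) \<dots>"
      using * unfolding base by (intro openin_Union) auto
    finally show "openin (top_of_set (adjoint_pairs R))
        {F \<in> topspace (top_of_set (adjoint_pairs R)). F \<circ> Inl \<in> W}" .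
  qed
qed

end

section \<open>Haar measure of balls and invariance of its integrals\<close>

locale proper_haar = proper_metric_space b for b :: "'a::metric_space" +
  fixes m :: "('a \<Rightarrow> 'a) measure"
  assumes haar: "left_haar_measure m"
begin

lemma sets_m [measurable_cong]: "sets m = sets (borel_on isom_topology)"
  using haar by (simp add: left_haar_measure_def)

lemma space_m [simp]: "space m = isom_group"
  using sets_eq_imp_space_eq[OF sets_m] by simp

lemma emeasure_isom_ball_finite: "emeasure m (isom_ball R) < \<infinity>"
  using haar compactin_isom_ball by (simp add: left_haar_measure_def)

lemma isom_ball_in_sets [measurable]: "isom_ball R \<in> sets m"
  using isom_ball_sets sets_m by blast

lemma UN_isom_ball: "(\<Union>n. isom_ball (real n)) = isom_group"
proof -
  have "\<exists>n. dist (g b) b \<le> real n" for g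
    by (rule real_arch_simple)
  then show ?thesis
    unfolding isom_ball_def by blast
qed

lemma isom_ball_pos: obtains R where "R \<ge> 0" "emeasure m (isom_ball R) > 0"
proof -
  have "\<exists>n. emeasure m (isom_ball (real n)) > 0"
  proof (rule ccontr)
    assume "\<nexists>n. emeasure m (isom_ball (real n)) > 0"
    then have "isom_ball (real n) \<in> null_sets m" for n
      by (intro null_setsI) (auto simp: zero_less_iff_neq_zero)
    then have "(\<Union>n. isom_ball (real n)) \<in> null_sets m"
      by (rule null_sets_UN)
    then show False
      using haar by (auto simp: UN_isom_ball left_haar_measure_def)
  qed
  then show ?thesis
    by (metis that of_nat_0_le_iff)
qed

sublocale sigma_finite_measure m
proof
  show "\<exists>A. countable A \<and> A \<subseteq> sets m \<and> \<Union>A = space m \<and> (\<forall>a\<in>A. emeasure m a \<noteq> \<infinity>)"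
    by (rule exI[of _ "range (\<lambda>n::nat. isom_ball (real n))"])
       (use emeasure_isom_ball_finite UN_isom_ball in \<open>auto simp: less_top\<close>)
qed

lemma left_translation_sets:
  assumes "g \<in> isom_group" "A \<in> sets m"
  shows "(\<lambda>h. inv g \<circ> h) -` A \<inter> space m = (\<lambda>h. g \<circ> h) ` A"
proof -
  have "A \<subseteq> isom_group"
    using sets.sets_into_space[OF assms(2)] by simp
  moreover have "h \<in> (\<lambda>h. g \<circ> h) ` A" if "inv g \<circ> h \<in> A" for h
    using that isom_group_comp_inv(1)[OF assms(1), of h] by (metis imageI)
  ultimately show ?thesis
    using assms(1) isom_group_comp_inv(2)[OF assms(1)] by auto
qed

lemma measurable_left_translation:
  assumes "g \<in> isom_group"
  shows "(\<lambda>h. inv g \<circ> h) \<in> measurable m m"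
proof -
  have "(\<lambda>h. inv g \<circ> h) \<in> measurable (borel_on isom_topology) (borel_on (isom_topology :: ('a \<Rightarrow> 'a) topology))"
    by (rule measurable_isom_inv_comp[of "\<lambda>_. g" "borel_on isom_topology" "\<lambda>h. h"])
       (simp_all add: assms)
  then show ?thesis
    using measurable_cong_sets[OF sets_m sets_m] by blast
qed

lemma distr_left_translation:
  assumes g: "g \<in> isom_group"
  shows "distr m m (\<lambda>h. inv g \<circ> h) = m"
proof (rule measure_eqI)
  fix A assume "A \<in> sets (distr m m (\<lambda>h. inv g \<circ> h))"
  then have A: "A \<in> sets m" by simp
  have "emeasure m ((\<lambda>h. g \<circ> h) ` A) = emeasure m A"
    using haar g A by (simp add: left_haar_measure_def)
  then show "emeasure (distr m m (\<lambda>h. inv g \<circ> h)) A = emeasure m A"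
    using emeasure_distr[OF measurable_left_translation[OF g] A]
    unfolding left_translation_sets[OF g A] by simp
qed simp

lemma nn_integral_left_translation:
  assumes g: "g \<in> isom_group" and f: "f \<in> borel_measurable m"
  shows "(\<integral>\<^sup>+h. f (inv g \<circ> h) \<partial>m) = (\<integral>\<^sup>+h. f h \<partial>m)"
  using nn_integral_distr[OF measurable_left_translation[OF g], of f] f
  by (simp add: distr_left_translation[OF g])

end

text \<open>Cauchy-Schwarz against the constant 1, of total mass 1. Where the integral does not
  converge its value is 0 and the bound is trivial, so no exceptional set of points has to be
  carried along.\<close>

lemma (in prob_space) norm_integral_square_le:
  fixes f :: "'a \<Rightarrow> 'b::{banach, second_countable_topology}"
  assumes f: "f \<in> borel_measurable M"
  shows "ennreal ((norm (LINT x|M. f x))\<^sup>2) \<le> (\<integral>\<^sup>+x. ennreal ((norm (f x))\<^sup>2) \<partial>M)"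
proof (cases "integrable M f")
  case True
  have "ennreal ((norm (LINT x|M. f x))\<^sup>2) = (ennreal (norm (LINT x|M. f x)))\<^sup>2"
    by (simp add: ennreal_power)
  also have "\<dots> \<le> (\<integral>\<^sup>+x. ennreal (norm (f x)) \<partial>M)\<^sup>2"
    by (intro power_mono integral_norm_bound_ennreal True) simp
  also have "\<dots> \<le> (\<integral>\<^sup>+x. ennreal (norm (f x)) ^ 2 \<partial>M) * (\<integral>\<^sup>+x. 1 ^ 2 \<partial>M)"
    using Cauchy_Schwarz_nn_integral[of "\<lambda>x. ennreal (norm (f x))" M "\<lambda>_. 1"] f by simp
  also have "\<dots> = (\<integral>\<^sup>+x. ennreal ((norm (f x))\<^sup>2) \<partial>M)"
    by (simp add: ennreal_power emeasure_space_1)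
  finally show ?thesis .
qed (simp add: not_integrable_integral_eq)

locale walk_measure = proper_metric_space b + prob_space \<mu>
  for b :: "'a::metric_space" and \<mu> :: "('a \<Rightarrow> 'a) measure" +
  assumes sets_mu [measurable_cong]: "sets \<mu> = sets (borel_on isom_topology)"
begin

lemma space_mu [simp]: "space \<mu> = isom_group"
  using sets_eq_imp_space_eq[OF sets_mu] by simp

end

locale haar_walk = proper_haar b m + mu: walk_measure b \<mu>
  for b :: "'a::metric_space" and m \<mu> :: "('a \<Rightarrow> 'a) measure"
begin

lemma measurable_quotient_fst_snd: "(\<lambda>p. inv (fst p) \<circ> (snd p :: 'a \<Rightarrow> 'a)) \<in> measurable (\<mu> \<Otimes>\<^sub>M m) m"
  using measurable_isom_inv_comp' measurable_cong_sets[OF sets_pair_measure_cong[OF mu.sets_mu sets_m] sets_m]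
  by blast

text \<open>Jensen under the outer integral, then Fubini and left invariance. This a priori norm
  bound 1 makes the real supremum in \<open>left_regular_norm\<close> one of a bounded set, so that
  it really bounds the operator.\<close>

lemma left_regular_contraction:
  assumes f: "f \<in> borel_measurable m"
  shows "left_regular \<mu> f \<in> borel_measurable m"
    and "(\<integral>\<^sup>+h. ennreal ((cmod (left_regular \<mu> f h))\<^sup>2) \<partial>m) \<le> (\<integral>\<^sup>+h. ennreal ((cmod (f h))\<^sup>2) \<partial>m)"
proof -
  interpret P: pair_sigma_finite \<mu> m ..
  have swap: "(\<lambda>p. inv (snd p) \<circ> (fst p :: 'a \<Rightarrow> 'a)) \<in> measurable (m \<Otimes>\<^sub>M \<mu>) m"
    using measurable_compose[OF measurable_pair_swap' measurable_quotient_fst_snd]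
    by (simp add: case_prod_beta)
  have fm: "(\<lambda>p. f (inv (snd p) \<circ> fst p)) \<in> borel_measurable (m \<Otimes>\<^sub>M \<mu>)"
    using measurable_compose[OF swap f] .
  have fm': "(\<lambda>p. f (inv (fst p) \<circ> snd p)) \<in> borel_measurable (\<mu> \<Otimes>\<^sub>M m)"
    using measurable_compose[OF measurable_quotient_fst_snd f] .
  have "(\<lambda>h. LINT g|\<mu>. f (inv g \<circ> h)) \<in> borel_measurable m"
    by (rule mu.borel_measurable_lebesgue_integral) (use fm in \<open>simp add: case_prod_beta\<close>)
  then show "left_regular \<mu> f \<in> borel_measurable m"
    by (simp add: left_regular_def[abs_def])
  have "(\<lambda>g. f (inv g \<circ> h)) \<in> borel_measurable \<mu>" if "h \<in> isom_group" for h
    using measurable_compose[OF measurable_Pair1' fm, of h] that by simp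
  then have "(\<integral>\<^sup>+h. ennreal ((cmod (left_regular \<mu> f h))\<^sup>2) \<partial>m)
      \<le> (\<integral>\<^sup>+h. (\<integral>\<^sup>+g. ennreal ((cmod (f (inv g \<circ> h)))\<^sup>2) \<partial>\<mu>) \<partial>m)"
    unfolding left_regular_def by (intro nn_integral_mono mu.norm_integral_square_le) simp
  also have "\<dots> = (\<integral>\<^sup>+g. (\<integral>\<^sup>+h. ennreal ((cmod (f (inv g \<circ> h)))\<^sup>2) \<partial>m) \<partial>\<mu>)"
    by (rule P.Fubini') (use fm' in \<open>simp add: case_prod_beta\<close>)
  also have "\<dots> = (\<integral>\<^sup>+g. (\<integral>\<^sup>+h. ennreal ((cmod (f h))\<^sup>2) \<partial>m) \<partial>\<mu>)"
  proof (rule nn_integral_cong)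
    fix g assume "g \<in> space \<mu>"
    then show "(\<integral>\<^sup>+h. ennreal ((cmod (f (inv g \<circ> h)))\<^sup>2) \<partial>m) = (\<integral>\<^sup>+h. ennreal ((cmod (f h))\<^sup>2) \<partial>m)"
      using nn_integral_left_translation[of g "\<lambda>h. ennreal ((cmod (f h))\<^sup>2)"] f by simp
  qed
  also have "\<dots> = (\<integral>\<^sup>+h. ennreal ((cmod (f h))\<^sup>2) \<partial>m)"
    by (simp add: mu.emeasure_space_1[simplified])
  finally show "(\<integral>\<^sup>+h. ennreal ((cmod (left_regular \<mu> f h))\<^sup>2) \<partial>m) \<le> (\<integral>\<^sup>+h. ennreal ((cmod (f h))\<^sup>2) \<partial>m)" .
qed

end

section \<open>From the operator norm to pointwise bounds\<close>

text \<open>The regular representation on real functions defined everywhere. Pointwise values and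
  the order of the reals are both used later, and neither exists on classes of complex
  functions.\<close>

definition conv_op :: "('a \<Rightarrow> 'a) measure \<Rightarrow> (('a \<Rightarrow> 'a) \<Rightarrow> real) \<Rightarrow> ('a \<Rightarrow> 'a) \<Rightarrow> real" where
  "conv_op \<mu> u h = (LINT g|\<mu>. u (inv g \<circ> h))"

text \<open>Bounds at every point make the integrals against a probability measure converge for
  every \<open>h\<close> in the group, not merely almost every one, and are preserved by
  \<open>conv_op\<close>.\<close>

definition unit_fun :: "(('a::metric_space \<Rightarrow> 'a) \<Rightarrow> real) \<Rightarrow> bool" where
  "unit_fun u \<longleftrightarrow> u \<in> borel_measurable (borel_on isom_topology) \<and> (\<forall>h. 0 \<le> u h \<and> u h \<le> 1)"

context walk_measure
begin

lemma measurable_quotient_snd_fst: "(\<lambda>p. inv (snd p) \<circ> (fst p :: 'a \<Rightarrow> 'a)) \<in> measurable (borel_on isom_topology \<Otimes>\<^sub>M \<mu>) (borel_on isom_topology)"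
proof -
  have "(\<lambda>p. inv (snd p) \<circ> (fst p :: 'a \<Rightarrow> 'a)) \<in> measurable (borel_on isom_topology \<Otimes>\<^sub>M borel_on isom_topology) (borel_on isom_topology)"
    by (rule measurable_isom_inv_comp[OF measurable_snd measurable_fst])
  then show ?thesis
    using measurable_cong_sets[OF sets_pair_measure_cong[OF refl sets_mu] refl] by blast
qed

lemma measurable_translate:
  assumes "u \<in> borel_measurable (borel_on isom_topology)" "h \<in> isom_group"
  shows "(\<lambda>g. u (inv g \<circ> (h :: 'a \<Rightarrow> 'a))) \<in> borel_measurable \<mu>"
  using measurable_compose[OF measurable_Pair1' measurable_compose[OF measurable_quotient_snd_fst assms(1)], of h]
    assms(2) by simp

lemma integrable_translate:
  assumes "unit_fun u" "h \<in> isom_group"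
  shows "integrable \<mu> (\<lambda>g. u (inv g \<circ> h))"
  by (rule integrable_const_bound[where B = 1])
     (use assms measurable_translate[of u h] in \<open>auto simp: unit_fun_def\<close>)

lemma unit_fun_conv_op:
  assumes "unit_fun u"
  shows "unit_fun (conv_op \<mu> u)"
proof -
  have "(\<lambda>h. LINT g|\<mu>. u (inv g \<circ> h)) \<in> borel_measurable (borel_on isom_topology)"
    by (rule borel_measurable_lebesgue_integral)
       (use assms measurable_compose[OF measurable_quotient_snd_fst, of u] in \<open>simp add: case_prod_unfold unit_fun_def\<close>)
  moreover have "0 \<le> conv_op \<mu> u h" for h
    unfolding conv_op_def using assms by (simp add: unit_fun_def)
  moreover have "conv_op \<mu> u h \<le> 1" for h
  proof (cases "integrable \<mu> (\<lambda>g. u (inv g \<circ> h))")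
    case True
    then show ?thesis
      unfolding conv_op_def using assms by (intro integral_le_const) (auto simp: unit_fun_def)
  next
    \<comment> \<open>By \<open>integrable_translate\<close> this happens only for \<open>h\<close>
      outside the group; the integral is then 0 by convention.\<close>
    case False
    then show ?thesis
      by (simp add: conv_op_def not_integrable_integral_eq)
  qed
  ultimately show ?thesis
    by (simp add: unit_fun_def conv_op_def[abs_def])
qed

lemma unit_fun_conv_op_pow: "unit_fun u \<Longrightarrow> unit_fun ((conv_op \<mu> ^^ n) u)"
  by (induction n) (auto intro: unit_fun_conv_op)

text \<open>The relation \<open>dist (g b) (h b) \<le> a\<close> is unchanged when both elements are
  multiplied on the left by the same \<open>inv x\<close>, so a comparison of \<open>u\<close> with
  \<open>v\<close> passes through the operator.\<close>

lemma conv_op_mono_dist: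
  assumes "unit_fun u" "unit_fun v"
    and le: "\<And>g h. g \<in> isom_group \<Longrightarrow> h \<in> isom_group \<Longrightarrow> dist (g b) (h b) \<le> a \<Longrightarrow> u g \<le> c * v h"
    and gh: "g \<in> isom_group" "h \<in> isom_group" "dist (g b) (h b) \<le> a"
  shows "conv_op \<mu> u g \<le> c * conv_op \<mu> v h"
proof -
  have "conv_op \<mu> u g \<le> (LINT x|\<mu>. c * v (inv x \<circ> h))"
    unfolding conv_op_def
  proof (rule integral_mono)
    show "u (inv x \<circ> g) \<le> c * v (inv x \<circ> h)" if "x \<in> space \<mu>" for x
      using that gh by (intro le) (simp_all add: isom_group_dist)
  qed (use assms(1,2) gh integrable_translate in auto)
  then show ?thesis
    by (simp add: conv_op_def)
qed

lemma conv_op_pow_mono_dist: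
  assumes "unit_fun u" "unit_fun v"
    and "\<And>g h. g \<in> isom_group \<Longrightarrow> h \<in> isom_group \<Longrightarrow> dist (g b) (h b) \<le> a \<Longrightarrow> u g \<le> v h"
    and "g \<in> isom_group" "h \<in> isom_group" "dist (g b) (h b) \<le> a"
  shows "(conv_op \<mu> ^^ n) u g \<le> (conv_op \<mu> ^^ n) v h"
  using assms(4-)
proof (induction n arbitrary: g h)
  case (Suc n)
  show ?case
    using conv_op_mono_dist[OF unit_fun_conv_op_pow[OF assms(1)] unit_fun_conv_op_pow[OF assms(2)],
        of a n 1 n g h] Suc by simp
qed (use assms(3) in simp)

lemma unit_fun_indicator_isom_ball: "unit_fun (indicator (isom_ball R))"
  using isom_ball_sets by (auto simp: unit_fun_def indicator_def)

text \<open>A Harnack-type comparison: moving the point by \<open>a\<close> is paid for by enlarging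
  the radius by \<open>a\<close>.\<close>

lemma conv_op_pow_indicator_mono:
  assumes "g \<in> isom_group" "h \<in> isom_group" "dist (g b) (h b) \<le> a"
  shows "(conv_op \<mu> ^^ n) (indicator (isom_ball R)) g \<le> (conv_op \<mu> ^^ n) (indicator (isom_ball (R + a))) h"
proof (rule conv_op_pow_mono_dist[OF unit_fun_indicator_isom_ball unit_fun_indicator_isom_ball _ assms])
  fix g h :: "'a \<Rightarrow> 'a" assume "g \<in> isom_group" "h \<in> isom_group" "dist (g b) (h b) \<le> a"
  then show "(indicator (isom_ball R) g :: real) \<le> indicator (isom_ball (R + a)) h"
    using dist_triangle3[of "h b" b "g b"]
    by (auto simp: isom_ball_def indicator_def)
qed

end

section \<open>Operator norm and powers on square-integrable functions\<close>

context haar_walk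
begin

lemma L2_seminorm_nonneg: "0 \<le> L2_seminorm m f"
  by (simp add: L2_seminorm_def)

lemma L2_functions_iff:
  "f \<in> L2_functions m \<longleftrightarrow> f \<in> borel_measurable m \<and> (\<integral>\<^sup>+h. ennreal ((cmod (f h))\<^sup>2) \<partial>m) < \<infinity>"
  unfolding L2_functions_def integrable_iff_bounded by auto

lemma L2_seminorm_square:
  assumes "f \<in> L2_functions m"
  shows "ennreal ((L2_seminorm m f)\<^sup>2) = (\<integral>\<^sup>+h. ennreal ((cmod (f h))\<^sup>2) \<partial>m)"
  using assms unfolding L2_seminorm_def L2_functions_def
  by (subst nn_integral_eq_integral) auto

lemma left_regular_L2:
  assumes f: "f \<in> L2_functions m"
  shows "left_regular \<mu> f \<in> L2_functions m" and "L2_seminorm m (left_regular \<mu> f) \<le> L2_seminorm m f"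
proof -
  have meas: "f \<in> borel_measurable m" using f by (simp add: L2_functions_iff)
  show L2: "left_regular \<mu> f \<in> L2_functions m"
    using left_regular_contraction[OF meas] f le_less_trans unfolding L2_functions_iff by blast
  have "ennreal ((L2_seminorm m (left_regular \<mu> f))\<^sup>2) \<le> ennreal ((L2_seminorm m f)\<^sup>2)"
    using left_regular_contraction(2)[OF meas] by (simp add: L2_seminorm_square f L2)
  then have "(L2_seminorm m (left_regular \<mu> f))\<^sup>2 \<le> (L2_seminorm m f)\<^sup>2"
    by simp
  then show "L2_seminorm m (left_regular \<mu> f) \<le> L2_seminorm m f"
    using L2_seminorm_nonneg by (rule power2_le_imp_le)
qed

lemma left_regular_norm_bdd:
  "bdd_above ((\<lambda>f. L2_seminorm m (left_regular \<mu> f)) ` {f \<in> L2_functions m. L2_seminorm m f \<le> 1})"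
  using left_regular_L2(2) by (intro bdd_aboveI[of _ 1]) force

lemma left_regular_norm_nonneg: "0 \<le> left_regular_norm m \<mu>"
proof -
  have "(\<lambda>_. 0) \<in> {f \<in> L2_functions m. L2_seminorm m f \<le> 1}"
    by (simp add: L2_functions_def L2_seminorm_def)
  from cSUP_upper[OF this left_regular_norm_bdd] show ?thesis
    using L2_seminorm_nonneg order_trans unfolding left_regular_norm_def by blast
qed

lemma left_regular_norm_bound:
  assumes f: "f \<in> L2_functions m"
  shows "L2_seminorm m (left_regular \<mu> f) \<le> left_regular_norm m \<mu> * L2_seminorm m f"
proof (cases "L2_seminorm m f = 0")
  \<comment> \<open>Such a function cannot be normalised to seminorm 1, but the contraction bound
    already forces the left side to be 0.\<close>
  case True
  then show ?thesis
    using left_regular_L2(2)[OF f] by simp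
next
  case False
  define c where "c = inverse (L2_seminorm m f)"
  have c: "c > 0" "c * L2_seminorm m f = 1"
    using False L2_seminorm_nonneg[of f] by (simp_all add: c_def)
  have scale: "L2_seminorm m (\<lambda>h. complex_of_real c * F h) = c * L2_seminorm m F" for F
    using c(1) by (simp add: L2_seminorm_def norm_mult power_mult_distrib real_sqrt_mult)
  have "(\<lambda>h. c * f h) \<in> L2_functions m"
    using f by (auto simp: L2_functions_def norm_mult power_mult_distrib)
  then have "(\<lambda>h. c * f h) \<in> {f \<in> L2_functions m. L2_seminorm m f \<le> 1}"
    by (simp add: scale c)
  from cSUP_upper[OF this left_regular_norm_bdd]
  have "L2_seminorm m (left_regular \<mu> (\<lambda>h. c * f h)) \<le> left_regular_norm m \<mu>"
    unfolding left_regular_norm_def .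
  moreover have "left_regular \<mu> (\<lambda>h. c * f h) = (\<lambda>h. c * left_regular \<mu> f h)"
    by (simp add: left_regular_def fun_eq_iff)
  ultimately have "c * L2_seminorm m (left_regular \<mu> f) \<le> left_regular_norm m \<mu>"
    by (simp add: scale)
  then show ?thesis
    using c(1) False L2_seminorm_nonneg[of f] unfolding c_def by (simp add: field_simps)
qed

lemma conv_op_pow_L2:
  assumes u: "unit_fun u" "(\<lambda>h. complex_of_real (u h)) \<in> L2_functions m"
  shows "(\<lambda>h. complex_of_real ((conv_op \<mu> ^^ n) u h)) \<in> L2_functions m"
    and "L2_seminorm m (\<lambda>h. complex_of_real ((conv_op \<mu> ^^ n) u h))
      \<le> left_regular_norm m \<mu> ^ n * L2_seminorm m (\<lambda>h. complex_of_real (u h))"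
proof (induction n)
  case (Suc n)
  define w where "w = (\<lambda>h. complex_of_real ((conv_op \<mu> ^^ n) u h))"
  have w: "(\<lambda>h. complex_of_real ((conv_op \<mu> ^^ Suc n) u h)) = left_regular \<mu> w"
    by (simp add: w_def left_regular_def conv_op_def fun_eq_iff)
  have L2: "w \<in> L2_functions m"
    using Suc(1) by (simp add: w_def)
  {
    case 1
    show ?case unfolding w by (rule left_regular_L2(1)[OF L2])
  next
    case 2
    have "L2_seminorm m (left_regular \<mu> w) \<le> left_regular_norm m \<mu> * L2_seminorm m w"
      by (rule left_regular_norm_bound[OF L2])
    also have "\<dots> \<le> left_regular_norm m \<mu> * (left_regular_norm m \<mu> ^ n * L2_seminorm m (\<lambda>h. complex_of_real (u h)))"
      using Suc(2) left_regular_norm_nonneg unfolding w_def by (rule mult_left_mono)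
    finally show ?case
      unfolding w by (simp add: mult.assoc)
  }
qed (use u in simp_all)

text \<open>Averaging over a ball around \<open>g\<close> turns the \<open>L\<^sup>2\<close> bound into a pointwise one.\<close>

lemma conv_op_pow_pointwise:
  obtains C where "C \<ge> 0"
    "\<And>n g. g \<in> isom_group \<Longrightarrow> (conv_op \<mu> ^^ n) (indicator (isom_ball R)) g \<le> C * left_regular_norm m \<mu> ^ n"
proof -
  obtain a where a: "a \<ge> 0" "emeasure m (isom_ball a) > 0"
    using isom_ball_pos by blast
  define M where "M = measure m (isom_ball a)"
  define M' where "M' = measure m (isom_ball (R + a))"
  have eM: "emeasure m (isom_ball a) = ennreal M" "emeasure m (isom_ball (R + a)) = ennreal M'"
    unfolding M_def M'_def using emeasure_isom_ball_finite
    by (simp_all add: emeasure_eq_ennreal_measure less_top)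
  have M: "M > 0" and M': "M' \<ge> 0"
    using a(2) eM(1) by (simp_all add: M'_def)
  define \<rho> where "\<rho> = left_regular_norm m \<mu>"
  have \<rho>: "\<rho> \<ge> 0" using left_regular_norm_nonneg by (simp add: \<rho>_def)
  define v :: "('a \<Rightarrow> 'a) \<Rightarrow> real" where "v = indicator (isom_ball (R + a))"
  have v_unit: "unit_fun v"
    unfolding v_def by (rule mu.unit_fun_indicator_isom_ball)
  have v_int: "(\<integral>\<^sup>+h. ennreal ((cmod (complex_of_real (v h)))\<^sup>2) \<partial>m) = ennreal M'"
  proof -
    have "(\<integral>\<^sup>+h. ennreal ((cmod (complex_of_real (v h)))\<^sup>2) \<partial>m) = (\<integral>\<^sup>+h. indicator (isom_ball (R + a)) h \<partial>m)"
      by (intro nn_integral_cong) (simp add: v_def indicator_def)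
    then show ?thesis
      by (simp add: eM)
  qed
  have v_meas: "v \<in> borel_measurable m"
    by (simp add: v_def)
  then have v_L2: "(\<lambda>h. complex_of_real (v h)) \<in> L2_functions m"
    unfolding L2_functions_iff v_int by simp
  have v_norm: "(L2_seminorm m (\<lambda>h. complex_of_real (v h)))\<^sup>2 = M'"
    using L2_seminorm_square[OF v_L2] M' unfolding v_int by simp
  \<comment> \<open>With \<open>A\<close> the translate by \<open>g\<close> of a ball of measure
    \<open>M\<close>, integrating \<open>U \<le> V\<close> over \<open>A\<close> and applying
    Cauchy-Schwarz gives \<open>U * M \<le> \<rho> ^ n * sqrt M' * sqrt M\<close>; dividing by
    \<open>M\<close> yields the constant.\<close>
  have "(conv_op \<mu> ^^ n) (indicator (isom_ball R)) g \<le> sqrt (M' / M) * \<rho> ^ n" if g: "g \<in> isom_group" for g n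
  proof -
    define U where "U = (conv_op \<mu> ^^ n) (indicator (isom_ball R)) g"
    define V where "V = (conv_op \<mu> ^^ n) v"
    define A where "A = (\<lambda>h. g \<circ> h) ` isom_ball a"
    have VL2: "(\<lambda>h. complex_of_real (V h)) \<in> L2_functions m"
      unfolding V_def by (rule conv_op_pow_L2(1)[OF v_unit v_L2])
    have V_unit: "unit_fun V"
      unfolding V_def using v_unit by (rule mu.unit_fun_conv_op_pow)
    then have Vm: "V \<in> borel_measurable m"
      using measurable_cong_sets[OF sets_m refl] by (auto simp: unit_fun_def)
    have U0: "U \<ge> 0"
      using mu.unit_fun_conv_op_pow[OF mu.unit_fun_indicator_isom_ball] by (simp add: U_def unit_fun_def)
    have Am: "A \<in> sets m"
      using measurable_sets[OF measurable_left_translation[OF g] isom_ball_in_sets[of a]]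
      unfolding A_def left_translation_sets[OF g isom_ball_in_sets[of a]] .
    have eA: "emeasure m A = ennreal M"
      using haar g by (simp add: A_def left_haar_measure_def eM(1)[symmetric] isom_ball_sets)
    have UV: "U \<le> V h" if hA: "h \<in> A" for h
    proof -
      obtain k where k: "k \<in> isom_group" "dist (k b) b \<le> a" "h = g \<circ> k"
        using hA by (auto simp: A_def isom_ball_def)
      then have "dist (g b) (h b) \<le> a"
        by (simp add: isom_group_dist[OF g] dist_commute)
      then show ?thesis
        unfolding U_def V_def v_def using g k by (intro mu.conv_op_pow_indicator_mono) auto
    qed
    have "ennreal (U * M) = ennreal U * emeasure m A"
      using U0 M by (simp add: eA ennreal_mult)
    also have "\<dots> = (\<integral>\<^sup>+h. ennreal U * indicator A h \<partial>m)"
      by (rule nn_integral_cmult_indicator[OF Am, symmetric])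
    also have "\<dots> \<le> (\<integral>\<^sup>+h. ennreal (V h) * indicator A h \<partial>m)"
      using UV by (intro nn_integral_mono) (auto simp: indicator_def intro: ennreal_leI)
    finally have "(ennreal (U * M))\<^sup>2 \<le> (\<integral>\<^sup>+h. ennreal (V h) * indicator A h \<partial>m)\<^sup>2"
      by (rule power_mono) simp
    also have "\<dots> \<le> (\<integral>\<^sup>+h. ennreal (V h) ^ 2 \<partial>m) * (\<integral>\<^sup>+h. indicator A h ^ 2 \<partial>m)"
      using Vm Am by (intro Cauchy_Schwarz_nn_integral) auto
    also have "(\<integral>\<^sup>+h. (indicator A h :: ennreal) ^ 2 \<partial>m) = (\<integral>\<^sup>+h. indicator A h \<partial>m)"
      by (intro nn_integral_cong) (simp add: indicator_def)
    also have "\<dots> = ennreal M"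
      using Am by (simp add: eA)
    also have "(\<integral>\<^sup>+h. ennreal (V h) ^ 2 \<partial>m) = ennreal ((L2_seminorm m (\<lambda>h. complex_of_real (V h)))\<^sup>2)"
      using V_unit by (simp add: L2_seminorm_square[OF VL2] ennreal_power unit_fun_def)
    also have "\<dots> \<le> ennreal ((\<rho> ^ n * L2_seminorm m (\<lambda>h. complex_of_real (v h)))\<^sup>2)"
      unfolding V_def \<rho>_def
      by (intro ennreal_leI power_mono conv_op_pow_L2(2)[OF v_unit v_L2] L2_seminorm_nonneg)
    finally have "(ennreal (U * M))\<^sup>2 \<le> ennreal ((\<rho> ^ n)\<^sup>2 * M') * ennreal M"
      by (simp add: power_mult_distrib v_norm mult_right_mono)
    then have "(U * M)\<^sup>2 \<le> (\<rho> ^ n)\<^sup>2 * M' * M"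
      using U0 M M' by (simp add: ennreal_power ennreal_mult[symmetric])
    then have "U\<^sup>2 * M \<le> (\<rho> ^ n)\<^sup>2 * M'"
      using M by (simp add: power2_eq_square mult_ac)
    then have "U\<^sup>2 \<le> (sqrt (M' / M) * \<rho> ^ n)\<^sup>2"
      using M M' by (simp add: power_mult_distrib field_simps)
    then have "U \<le> sqrt (M' / M) * \<rho> ^ n"
      by (rule power2_le_imp_le) (use M M' \<rho> in simp)
    then show ?thesis by (simp add: U_def)
  qed
  then show ?thesis
    using that[of "sqrt (M' / M)"] M M' by (simp add: \<rho>_def)
qed

end

section \<open>Laziness and the random walk\<close>

text \<open>The probability that the lazy walk has made exactly \<open>k\<close> proper steps by time \<open>n\<close>.\<close>

fun lazy_coeff :: "real \<Rightarrow> nat \<Rightarrow> nat \<Rightarrow> real" where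
  "lazy_coeff r 0 0 = 1"
| "lazy_coeff r 0 (Suc k) = 0"
| "lazy_coeff r (Suc n) 0 = r * lazy_coeff r n 0"
| "lazy_coeff r (Suc n) (Suc k) = r * lazy_coeff r n (Suc k) + (1 - r) * lazy_coeff r n k"

lemma lazy_coeff_nonneg: "0 \<le> r \<Longrightarrow> r \<le> 1 \<Longrightarrow> 0 \<le> lazy_coeff r n k"
  by (induction r n k rule: lazy_coeff.induct) auto

lemma lazy_coeff_eq_0: "n < k \<Longrightarrow> lazy_coeff r n k = 0"
  by (induction r n k rule: lazy_coeff.induct) auto

text \<open>The sum is the expected number of times \<open>n\<close> at which the lazy walk has made
  exactly \<open>k\<close> steps, a geometric waiting time of mean \<open>1 / (1 - r)\<close>,
  whatever \<open>k\<close> is.\<close>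

lemma lazy_coeff_sums:
  assumes r: "0 \<le> r" "r < 1"
  shows "(\<lambda>n. lazy_coeff r n k) sums (1 / (1 - r))"
proof (induction k)
  case 0
  have "lazy_coeff r n 0 = r ^ n" for n
    by (induction n) auto
  then show ?case
    using geometric_sums[of r] r by simp
next
  case (Suc k)
  have le: "(\<Sum>n<N. lazy_coeff r n k) \<le> 1 / (1 - r)" for N
    using sum_le_suminf[OF sums_summable[OF Suc], of "{..<N}"] lazy_coeff_nonneg r sums_unique[OF Suc]
    by auto
  \<comment> \<open>An infinite sum would also satisfy the recursion, so boundedness of the partial
    sums is established before solving for \<open>s\<close>.\<close>
  have bound: "(\<Sum>n<N. lazy_coeff r n (Suc k)) \<le> 1 / (1 - r)" for N
  proof (induction N)
    case (Suc N)
    have "(\<Sum>n<Suc N. lazy_coeff r n (Suc k)) =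
        r * (\<Sum>n<N. lazy_coeff r n (Suc k)) + (1 - r) * (\<Sum>n<N. lazy_coeff r n k)"
      unfolding sum.lessThan_Suc_shift by (simp add: sum.distrib sum_distrib_left)
    also have "\<dots> \<le> r * (1 / (1 - r)) + (1 - r) * (1 / (1 - r))"
      using r by (intro add_mono mult_left_mono Suc le) auto
    also have "\<dots> = 1 / (1 - r)"
      using r by (simp add: field_simps)
    finally show ?case .
  qed (use r in simp)
  have "summable (\<lambda>n. lazy_coeff r n (Suc k))"
    using lazy_coeff_nonneg r by (intro summableI_nonneg_bounded[OF _ bound]) auto
  then obtain s where s: "(\<lambda>n. lazy_coeff r n (Suc k)) sums s"
    by (auto simp: summable_def)
  then have "(\<lambda>n. lazy_coeff r (Suc n) (Suc k)) sums s"
    using sums_Suc_iff[of "\<lambda>n. lazy_coeff r n (Suc k)" s] by simp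
  moreover have "(\<lambda>n. lazy_coeff r (Suc n) (Suc k)) sums (r * s + (1 - r) * (1 / (1 - r)))"
    unfolding lazy_coeff.simps by (intro sums_add sums_mult s Suc)
  ultimately have "s = r * s + (1 - r) * (1 / (1 - r))"
    by (rule sums_unique2)
  then have "s = 1 / (1 - r)"
    using r by (simp add: field_simps)
  with s show ?case by simp
qed

text \<open>New increments enter on the right, so the first one stays outermost. Splitting it off
  leaves a walk driven by the shifted increments.\<close>

lemma walk_Suc_case_nat: "walk (case_nat s \<omega>) (Suc n) = s \<circ> walk \<omega> n"
proof (induction n)
  case (Suc n)
  have "walk (case_nat s \<omega>) (Suc (Suc n)) = walk (case_nat s \<omega>) (Suc n) \<circ> \<omega> n"
    by simp
  then show ?case
    unfolding Suc by (simp add: comp_assoc)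
qed simp

context walk_measure
begin

text \<open>\<open>lazy_measure\<close> is given by a formula on sets, and \<open>measure_of\<close>
  follows that formula only if it is a measure. Realising it as a mixture over a Bernoulli variable
  settles this and brings the integration rules for such mixtures.\<close>

lemma lazy_measure_eq_bind:
  assumes r: "0 \<le> r" "r < 1"
  shows "lazy_measure r \<mu> = measure_pmf (bernoulli_pmf r) \<bind> (\<lambda>c. if c then return \<mu> id else \<mu>)"
    (is "_ = ?N")
proof -
  have K: "(\<lambda>c. if c then return \<mu> id else \<mu>) \<in> measurable (measure_pmf (bernoulli_pmf r)) (subprob_algebra \<mu>)"
    by (auto simp: space_subprob_algebra subprob_space_return prob_space_imp_subprob_space[OF prob_space_axioms])
  have sets: "sets ?N = sets \<mu>"
    by (rule sets_bind) (auto simp: space_measure_pmf)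
  have "lazy_measure r \<mu> = measure_of (space \<mu>) (sets \<mu>) (emeasure ?N)"
    unfolding lazy_measure_def
  proof (rule measure_of_eq)
    fix A assume "A \<in> sigma_sets (space \<mu>) (sets \<mu>)"
    then have A: "A \<in> sets \<mu>"
      unfolding sets.sigma_sets_eq .
    show "ennreal r * indicator A id + ennreal (1 - r) * emeasure \<mu> A = emeasure ?N A"
      using r A by (subst emeasure_bind[OF _ K A]) (auto simp: mult.commute)
  qed (rule sets.space_closed)
  also have "\<dots> = ?N"
    using measure_of_of_measure[of ?N] sets sets_eq_imp_space_eq[OF sets] by simp
  finally show ?thesis .
qed

lemma
  assumes r: "0 \<le> r" "r < 1"
  shows walk_measure_lazy: "walk_measure (lazy_measure r \<mu>)"
    and conv_op_lazy: "unit_fun u \<Longrightarrow> h \<in> isom_group \<Longrightarrow>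
      conv_op (lazy_measure r \<mu>) u h = r * u h + (1 - r) * conv_op \<mu> u h"
proof -
  let ?K = "\<lambda>c. if c then return \<mu> (id :: 'a \<Rightarrow> 'a) else \<mu>"
  have K: "?K \<in> measurable (measure_pmf (bernoulli_pmf r)) (subprob_algebra \<mu>)"
    by (auto simp: space_subprob_algebra subprob_space_return prob_space_imp_subprob_space[OF prob_space_axioms])
  have sets: "sets (lazy_measure r \<mu>) = sets \<mu>"
    unfolding lazy_measure_eq_bind[OF r] by (rule sets_bind) (auto simp: space_measure_pmf)
  have nn: "(\<integral>\<^sup>+x. f x \<partial>lazy_measure r \<mu>) = ennreal r * f id + ennreal (1 - r) * (\<integral>\<^sup>+x. f x \<partial>\<mu>)"
    if "f \<in> borel_measurable \<mu>" for f
    unfolding lazy_measure_eq_bind[OF r] using r that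
    by (subst nn_integral_bind[OF that K]) (simp add: nn_integral_return mult.commute)
  have "emeasure (lazy_measure r \<mu>) (space (lazy_measure r \<mu>)) = 1"
  proof -
    have "emeasure (lazy_measure r \<mu>) (space (lazy_measure r \<mu>)) = (\<integral>\<^sup>+x. 1 \<partial>lazy_measure r \<mu>)"
      by simp
    also have "\<dots> = ennreal r * 1 + ennreal (1 - r) * (\<integral>\<^sup>+x. 1 \<partial>\<mu>)"
      by (rule nn) simp
    also have "(\<integral>\<^sup>+x. 1 \<partial>\<mu>) = 1"
      using emeasure_space_1 by simp
    also have "ennreal r * 1 + ennreal (1 - r) * 1 = ennreal (r + (1 - r))"
      using r by (subst ennreal_plus) auto
    finally show ?thesis by simp
  qed
  then interpret PL: prob_space "lazy_measure r \<mu>"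
    by (rule prob_spaceI)
  interpret L: walk_measure b "lazy_measure r \<mu>"
    by unfold_locales (simp add: sets sets_mu)
  show "walk_measure (lazy_measure r \<mu>)" ..
  assume u: "unit_fun u" and h: "h \<in> isom_group"
  let ?f = "\<lambda>g. u (inv g \<circ> h)"
  have f: "?f \<in> borel_measurable \<mu>" "0 \<le> ?f g" for g
    using measurable_translate[of u h] u h by (auto simp: unit_fun_def)
  have u0: "0 \<le> u h" using u by (simp add: unit_fun_def)
  have c0: "0 \<le> conv_op \<mu> u h" "0 \<le> conv_op (lazy_measure r \<mu>) u h"
    using unit_fun_conv_op[OF u] L.unit_fun_conv_op[OF u] by (auto simp: unit_fun_def)
  have "ennreal (conv_op (lazy_measure r \<mu>) u h) = (\<integral>\<^sup>+g. ennreal (?f g) \<partial>lazy_measure r \<mu>)"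
    unfolding conv_op_def by (rule nn_integral_eq_integral[symmetric])
      (use L.integrable_translate[OF u h] f(2) in auto)
  also have "\<dots> = ennreal r * ennreal (u h) + ennreal (1 - r) * (\<integral>\<^sup>+g. ennreal (?f g) \<partial>\<mu>)"
    using f(1) by (subst nn) auto
  also have "(\<integral>\<^sup>+g. ennreal (?f g) \<partial>\<mu>) = ennreal (conv_op \<mu> u h)"
    unfolding conv_op_def by (rule nn_integral_eq_integral)
      (use integrable_translate[OF u h] f(2) in auto)
  also have "ennreal r * ennreal (u h) + ennreal (1 - r) * ennreal (conv_op \<mu> u h)
      = ennreal (r * u h + (1 - r) * conv_op \<mu> u h)"
    using r u0 c0 by (simp add: ennreal_mult)
  finally show "conv_op (lazy_measure r \<mu>) u h = r * u h + (1 - r) * conv_op \<mu> u h"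
    using r u0 c0 by (subst (asm) ennreal_inj) auto
qed

text \<open>One step of the lazy operator is \<open>r\<close> times the identity plus
  \<open>1 - r\<close> times \<open>conv_op \<mu>\<close>. In the binomial expansion of its
  \<open>n\<close>-th power all terms are nonnegative, and only the one with exactly
  \<open>k\<close> proper steps is kept.\<close>

lemma conv_op_lazy_pow_ge:
  assumes r: "0 \<le> r" "r < 1" and u: "unit_fun u" and h: "h \<in> isom_group"
  shows "lazy_coeff r n k * (conv_op \<mu> ^^ k) u h \<le> (conv_op (lazy_measure r \<mu>) ^^ n) u h"
  using h
proof (induction n arbitrary: k h)
  case 0
  then show ?case
    using u by (cases k) (auto simp: unit_fun_def)
next
  case (Suc n)
  interpret L: walk_measure b "lazy_measure r \<mu>"
    by (rule walk_measure_lazy[OF r])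
  let ?V = "\<lambda>k. (conv_op \<mu> ^^ k) u" and ?U = "\<lambda>n. (conv_op (lazy_measure r \<mu>) ^^ n) u"
  have Un: "unit_fun (?U n)"
    using u by (rule L.unit_fun_conv_op_pow)
  have rec: "?U (Suc n) h = r * ?U n h + (1 - r) * conv_op \<mu> (?U n) h"
    using conv_op_lazy[OF r Un Suc.prems] by simp
  have U0: "0 \<le> conv_op \<mu> (?U n) h"
    using unit_fun_conv_op[OF Un] by (simp add: unit_fun_def)
  show ?case
  proof (cases k)
    case 0
    have "r * (lazy_coeff r n 0 * u h) \<le> r * ?U n h"
      using Suc.IH[OF Suc.prems, of 0] r by (intro mult_left_mono) auto
    moreover have "0 \<le> (1 - r) * conv_op \<mu> (?U n) h"
      using r U0 by simp
    ultimately show ?thesis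
      unfolding rec 0 by (simp add: mult.assoc)
  next
    case (Suc j)
    have "(LINT g|\<mu>. lazy_coeff r n j * ?V j (inv g \<circ> h)) \<le> (LINT g|\<mu>. ?U n (inv g \<circ> h))"
    proof (rule integral_mono)
      show "integrable \<mu> (\<lambda>g. lazy_coeff r n j * ?V j (inv g \<circ> h))"
        using integrable_translate[OF unit_fun_conv_op_pow[OF u] Suc.prems] by simp
      show "integrable \<mu> (\<lambda>g. ?U n (inv g \<circ> h))"
        by (rule integrable_translate[OF Un Suc.prems])
      show "lazy_coeff r n j * ?V j (inv g \<circ> h) \<le> ?U n (inv g \<circ> h)" if "g \<in> space \<mu>" for g
        using that Suc.prems by (intro Suc.IH isom_group_comp isom_group_inv) simp_all
    qed
    then have "lazy_coeff r n j * ?V (Suc j) h \<le> conv_op \<mu> (?U n) h"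
      by (simp add: conv_op_def)
    then have "(1 - r) * (lazy_coeff r n j * ?V (Suc j) h) \<le> (1 - r) * conv_op \<mu> (?U n) h"
      using r by (intro mult_left_mono) auto
    moreover have "r * (lazy_coeff r n (Suc j) * ?V (Suc j) h) \<le> r * ?U n h"
      using Suc.IH[OF Suc.prems, of "Suc j"] r by (intro mult_left_mono) auto
    ultimately show ?thesis
      unfolding rec Suc lazy_coeff.simps distrib_right mult.assoc by linarith
  qed
qed

section \<open>The law of the walk as an iterated convolution\<close>

lemma measurable_walk [measurable]:
  "(\<lambda>\<omega>. walk \<omega> n) \<in> measurable (increments \<mu>) (borel_on isom_topology)"
proof (induction n)
  case (Suc n)
  have "(\<lambda>\<omega>. \<omega> n) \<in> measurable (increments \<mu>) \<mu>"
    unfolding increments_def by measurable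
  then have "(\<lambda>\<omega>. \<omega> n) \<in> measurable (increments \<mu>) (borel_on isom_topology)"
    using measurable_cong_sets[OF refl sets_mu] by blast
  from measurable_isom_comp[OF Suc this] show ?case
    unfolding walk.simps .
next
  case 0
  show ?case
    unfolding walk.simps 
    by (rule measurable_const) (unfold space_borel_on topspace_isom_topology, rule isom_group_id)
qed

lemma prob_space_increments: "prob_space (increments \<mu>)"
  unfolding increments_def by (rule prob_space_PiM) (rule prob_space_axioms)

lemma walk_in_isom_group: "\<omega> \<in> space (increments \<mu>) \<Longrightarrow> walk \<omega> n \<in> isom_group"
  using measurable_space[OF measurable_walk] by simp

lemma integrable_walk:
  assumes u: "unit_fun u" and g: "g \<in> isom_group"
  shows "integrable (increments \<mu>) (\<lambda>\<omega>. u (inv (walk \<omega> n) \<circ> g))"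
proof -
  interpret P: prob_space "increments \<mu>" by (rule prob_space_increments)
  have "(\<lambda>\<omega>. inv (walk \<omega> n) \<circ> g) \<in> measurable (increments \<mu>) (borel_on isom_topology)"
    by (rule measurable_isom_inv_comp[OF measurable_walk measurable_const]) (simp add: g)
  from measurable_compose[OF this, of u borel]
  have "(\<lambda>\<omega>. u (inv (walk \<omega> n) \<circ> g)) \<in> borel_measurable (increments \<mu>)"
    using u by (simp add: unit_fun_def)
  then show ?thesis
    using u by (intro P.integrable_const_bound[where B = 1]) (auto simp: unit_fun_def)
qed

text \<open>The increments are one increment followed by an independent sequence of the same law.
  Since \<open>inv (s \<circ> w) \<circ> g = inv w \<circ> (inv s \<circ> g)\<close>, the first
  increment only moves the point \<open>g\<close>, which is why \<open>g\<close> is generalised in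
  the induction.\<close>

lemma conv_op_pow_eq_walk:
  assumes u: "unit_fun u" and "g \<in> isom_group"
  shows "(conv_op \<mu> ^^ n) u g = (LINT \<omega>|increments \<mu>. u (inv (walk \<omega> n) \<circ> g))"
  using assms(2)
proof (induction n arbitrary: g)
  case 0
  interpret P: prob_space "increments \<mu>" by (rule prob_space_increments)
  show ?case by (simp add: P.prob_space)
next
  case (Suc n)
  interpret S: sequence_space \<mu> ..
  have S: "S.S = increments \<mu>" by (simp add: increments_def)
  interpret P: prob_space "increments \<mu>" by (rule prob_space_increments)
  interpret PP: pair_sigma_finite \<mu> "increments \<mu>" ..
  let ?c = "\<lambda>(s, \<omega>). case_nat s \<omega>"
  let ?F = "\<lambda>\<omega>. u (inv (walk \<omega> (Suc n)) \<circ> g)"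
  have iter: "distr (\<mu> \<Otimes>\<^sub>M increments \<mu>) (increments \<mu>) ?c = increments \<mu>"
    using S.PiM_iter unfolding S .
  have c: "?c \<in> measurable (\<mu> \<Otimes>\<^sub>M increments \<mu>) (increments \<mu>)"
    unfolding increments_def by measurable
  have F: "integrable (increments \<mu>) ?F"
    using u Suc.prems by (rule integrable_walk)
  have "integrable (distr (\<mu> \<Otimes>\<^sub>M increments \<mu>) (increments \<mu>) ?c) ?F"
    unfolding iter by (rule F)
  then have int: "integrable (\<mu> \<Otimes>\<^sub>M increments \<mu>) (\<lambda>p. ?F (?c p))"
    using integrable_distr_eq[OF c, of ?F] F by (metis borel_measurable_integrable)
  have "(LINT \<omega>|increments \<mu>. ?F \<omega>) = (LINT p|(\<mu> \<Otimes>\<^sub>M increments \<mu>). ?F (?c p))"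
    using integral_distr[OF c, of ?F] F unfolding iter by (metis borel_measurable_integrable)
  also have "\<dots> = (LINT s|\<mu>. LINT \<omega>|increments \<mu>. ?F (case_nat s \<omega>))"
    using PP.integral_fst'[OF int] by (simp del: walk.simps)
  also have "\<dots> = (LINT s|\<mu>. LINT \<omega>|increments \<mu>. u (inv (walk \<omega> n) \<circ> (inv s \<circ> g)))"
  proof (intro Bochner_Integration.integral_cong refl)
    fix s \<omega> assume "s \<in> space \<mu>" "\<omega> \<in> space (increments \<mu>)"
    then show "?F (case_nat s \<omega>) = u (inv (walk \<omega> n) \<circ> (inv s \<circ> g))"
      unfolding walk_Suc_case_nat by (simp add: isom_group_inv_comp walk_in_isom_group comp_assoc)
  qed
  also have "\<dots> = (LINT s|\<mu>. (conv_op \<mu> ^^ n) u (inv s \<circ> g))"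
    using Suc.prems
    by (intro Bochner_Integration.integral_cong refl Suc.IH[symmetric] isom_group_comp isom_group_inv) simp_all
  also have "\<dots> = (conv_op \<mu> ^^ Suc n) u g"
    by (simp only: funpow.simps o_apply conv_op_def[of \<mu> "(conv_op \<mu> ^^ n) u"])
  finally show ?case
    by (rule sym)
qed

lemma walk_ball_event [measurable]:
  "{\<omega> \<in> space (increments \<mu>). dist (walk \<omega> n x) (y::'a) \<le> R} \<in> sets (increments \<mu>)"
  using measurable_compose[OF measurable_walk borel_measurable_isom_eval]
  by (intro borel_measurable_le borel_measurable_const)

lemma isom_ball_quotient_iff:
  assumes "w \<in> isom_group" "g \<in> isom_group"
  shows "inv w \<circ> g \<in> isom_ball R \<longleftrightarrow> dist (w b) (g b) \<le> R"
  using assms by (simp add: isom_ball_def isom_group_dist_inv dist_commute[of "g b" "w b"])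

lemma walk_ball_prob:
  assumes g: "g \<in> isom_group"
  shows "measure (increments \<mu>) {\<omega> \<in> space (increments \<mu>). dist (walk \<omega> n b) (g b) \<le> R}
    = (conv_op \<mu> ^^ n) (indicator (isom_ball R)) g"
proof -
  interpret P: prob_space "increments \<mu>" by (rule prob_space_increments)
  let ?A = "{\<omega> \<in> space (increments \<mu>). dist (walk \<omega> n b) (g b) \<le> R}"
  have "(conv_op \<mu> ^^ n) (indicator (isom_ball R)) g
      = (LINT \<omega>|increments \<mu>. indicator (isom_ball R) (inv (walk \<omega> n) \<circ> g))"
    by (rule conv_op_pow_eq_walk[OF unit_fun_indicator_isom_ball g])
  also have "\<dots> = (LINT \<omega>|increments \<mu>. indicator ?A \<omega>)"
    by (intro Bochner_Integration.integral_cong refl)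
       (auto simp: indicator_def isom_ball_quotient_iff walk_in_isom_group g)
  also have "\<dots> = measure (increments \<mu>) ?A"
    by simp
  finally show ?thesis by simp
qed

end

context haar_walk
begin

text \<open>The comparison with the lazy powers is summed over \<open>n\<close>, which avoids
  estimating any single binomial weight: the weights add up to \<open>1 / (1 - r)\<close> and the
  right-hand sides form a geometric series.\<close>

theorem walk_ball_prob_le:
  assumes r: "0 \<le> r" "r < 1" and \<rho>: "left_regular_norm m (lazy_measure r \<mu>) < 1"
  obtains C where "C \<ge> 0"
    "\<And>k g. g \<in> isom_group \<Longrightarrow>
      measure (increments \<mu>) {\<omega> \<in> space (increments \<mu>). dist (walk \<omega> k b) (g b) \<le> R}
        \<le> C * left_regular_norm m (lazy_measure r \<mu>) ^ k"
proof -
  interpret L: walk_measure b "lazy_measure r \<mu>"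
    by (rule mu.walk_measure_lazy[OF r])
  interpret L: haar_walk b m "lazy_measure r \<mu>" ..
  define \<rho> where "\<rho> = left_regular_norm m (lazy_measure r \<mu>)"
  have \<rho>: "0 \<le> \<rho>" "\<rho> < 1"
    using assms(3) L.left_regular_norm_nonneg by (auto simp: \<rho>_def)
  obtain C where C: "C \<ge> 0" "\<And>n g. g \<in> isom_group \<Longrightarrow>
      (conv_op (lazy_measure r \<mu>) ^^ n) (indicator (isom_ball R)) g \<le> C * \<rho> ^ n"
    using L.conv_op_pow_pointwise[of R] unfolding \<rho>_def by metis
  have "(conv_op \<mu> ^^ k) (indicator (isom_ball R)) g \<le> C / (1 - \<rho>) * \<rho> ^ k"
    if g: "g \<in> isom_group" for k g
  proof -
    define V where "V = (conv_op \<mu> ^^ k) (indicator (isom_ball R)) g"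
    have V: "0 \<le> V"
      using mu.unit_fun_conv_op_pow[OF mu.unit_fun_indicator_isom_ball] by (simp add: V_def unit_fun_def)
    \<comment> \<open>The weights vanish for \<open>n < k\<close>, so the series may start at
      \<open>n = k\<close>; this is where the factor \<open>\<rho> ^ k\<close> comes from.\<close>
    have "(\<lambda>n. lazy_coeff r (n + k) k) sums (1 / (1 - r) - (\<Sum>n<k. lazy_coeff r n k))"
      using lazy_coeff_sums[OF r, of k] by (rule sums_split_initial_segment)
    then have 1: "(\<lambda>n. lazy_coeff r (n + k) k * V) sums (1 / (1 - r) * V)"
      by (intro sums_mult2) (simp add: lazy_coeff_eq_0)
    have 2: "(\<lambda>n. C * \<rho> ^ k * \<rho> ^ n) sums (C * \<rho> ^ k * (1 / (1 - \<rho>)))"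
      using \<rho> by (intro sums_mult geometric_sums) simp
    have "lazy_coeff r (n + k) k * V \<le> C * \<rho> ^ k * \<rho> ^ n" for n
      using mu.conv_op_lazy_pow_ge[OF r mu.unit_fun_indicator_isom_ball g, of "n + k" k R] C(2)[OF g, of "n + k"]
      by (simp add: V_def power_add mult_ac)
    from sums_le[OF this 1 2] have "V / (1 - r) \<le> C / (1 - \<rho>) * \<rho> ^ k"
      by (simp add: field_simps)
    moreover have "V \<le> V / (1 - r)"
      using r V by (simp add: field_simps mult_left_le)
    ultimately show ?thesis by (simp add: V_def)
  qed
  then show ?thesis
    using that[of "C / (1 - \<rho>)"] C(1) \<rho> by (simp add: mu.walk_ball_prob \<rho>_def)
qed

end

section \<open>Hyperbolic geometry of paths and orbit growth\<close>

lemma gromov_product_ge_dist: "dist x p - dist x y \<le> gromov_product p x y"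
  unfolding gromov_product_def using dist_triangle2[of x p y] dist_triangle3[of x p y]
  by (simp add: field_simps dist_commute)

lemma gromov_product_le_dist: "gromov_product p x y \<le> dist x p"
  unfolding gromov_product_def using dist_triangle[of y p x] by (simp add: dist_commute)

lemma gromov_product_nonneg: "0 \<le> gromov_product p x y"
  unfolding gromov_product_def using dist_triangle2[of x y p] by simp

lemma gromov_product_commute: "gromov_product p x y = gromov_product p y x"
  unfolding gromov_product_def by (simp add: dist_commute)

text \<open>Cutting at a power of two uses hyperbolicity once per dyadic level, so the loss is
  logarithmic in the number of steps. Chaining point by point would lose a multiple of
  \<open>n\<close>.\<close>

lemma gromov_product_chain:
  fixes y :: "nat \<Rightarrow> 'a::metric_space"
  assumes hyp: "\<And>x y z p::'a. gromov_product p x y \<ge> min (gromov_product p x z) (gromov_product p z y) - \<delta>"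
    and \<delta>: "\<delta> \<ge> 0"
    and "1 \<le> n" "n \<le> 2 ^ j" "\<And>l. i \<le> l \<Longrightarrow> l < i + n \<Longrightarrow> a < gromov_product p (y l) (y (Suc l))"
  shows "a - real j * \<delta> < gromov_product p (y i) (y (i + n))"
  using assms(3-)
proof (induction j arbitrary: n i)
  case 0
  then have "n = 1" by simp
  then show ?case
    using 0(3)[of i] by simp
next
  case (Suc j)
  show ?case
  proof (cases "n \<le> 2 ^ j")
    case True
    then have "a - real j * \<delta> < gromov_product p (y i) (y (i + n))"
      using Suc.prems by (intro Suc.IH) auto
    moreover have "real j * \<delta> \<le> real (Suc j) * \<delta>"
      using \<delta> by (simp add: mult_right_mono)
    ultimately show ?thesis by linarith
  next
    case False
    define n' where "n' = n - 2 ^ j"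
    have n': "n = 2 ^ j + n'" "1 \<le> n'" "n' \<le> 2 ^ j"
      using False Suc.prems(2) by (auto simp: n'_def)
    have "a - real j * \<delta> < gromov_product p (y i) (y (i + 2 ^ j))"
      using Suc.prems(3) n' by (intro Suc.IH) auto
    moreover have "a - real j * \<delta> < gromov_product p (y (i + 2 ^ j)) (y (i + 2 ^ j + n'))"
      using Suc.prems(3) n' by (intro Suc.IH) auto
    ultimately have "a - real j * \<delta> - \<delta> < gromov_product p (y i) (y (i + 2 ^ j + n'))"
      using hyp[of p "y i" "y (i + 2 ^ j)" "y (i + 2 ^ j + n')"] by linarith
    then show ?thesis
      by (simp add: n'(1) add.assoc algebra_simps)
  qed
qed

lemma dist_path_le:
  fixes y :: "nat \<Rightarrow> 'a::metric_space"
  assumes "\<And>k. dist (y k) (y (Suc k)) \<le> \<kappa>"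
  shows "dist (y k) (y (k + l)) \<le> real l * \<kappa>"
proof (induction l)
  case (Suc l)
  then show ?case
    using dist_triangle[of "y k" "y (k + Suc l)" "y (k + l)"] assms[of "k + l"]
    by (simp add: algebra_simps)
qed simp

text \<open>Seen from \<open>p\<close>, the two ends of the path have Gromov product at most \<open>\<delta>\<close>, whereas the
  Gromov product of consecutive points is large as long as the path stays away from \<open>p\<close>.\<close>

lemma path_near_point:
  fixes y :: "nat \<Rightarrow> 'a::metric_space"
  assumes hyp: "\<And>x y z p::'a. gromov_product p x y \<ge> min (gromov_product p x z) (gromov_product p z y) - \<delta>"
    and \<delta>: "\<delta> \<ge> 0" and \<kappa>: "\<kappa> \<ge> 0"
    and jump: "\<And>k. dist (y k) (y (Suc k)) \<le> \<kappa>"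
    and m: "m \<le> 2 ^ j"
    and t: "t \<le> gromov_product (y 0) x (y m)"
    and p: "dist (y 0) p = t" "dist p x = dist (y 0) x - t"
  obtains k where "k \<le> m" "dist (y k) p \<le> \<kappa> + real (Suc j) * \<delta>"
proof (cases "m = 0")
  case True
  have "t \<le> gromov_product (y 0) x (y 0)"
    using t True by simp
  then have "t \<le> 0"
    by (simp add: gromov_product_def)
  then have "dist (y 0) p \<le> \<kappa> + real (Suc j) * \<delta>"
    using p \<delta> \<kappa> by (smt (verit) mult_nonneg_nonneg of_nat_0_le_iff)
  then show ?thesis using that by blast
next
  case False
  have "\<exists>k\<le>m. dist (y k) p \<le> \<kappa> + real (Suc j) * \<delta>"
  proof (rule ccontr)
    assume far: "\<not> (\<exists>k\<le>m. dist (y k) p \<le> \<kappa> + real (Suc j) * \<delta>)"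
    \<comment> \<open>Of these multiples of \<delta>, \<open>j\<close> are spent on the chain and
      the last one on the final contradiction; \<kappa> pays for the passage from distance to the
      product of consecutive points.\<close>
    have "real (Suc j) * \<delta> < gromov_product p (y l) (y (Suc l))" if "l < m" for l
    proof -
      have "\<kappa> + real (Suc j) * \<delta> < dist (y l) p"
        using far that by (meson less_imp_le not_le)
      then show ?thesis
        using gromov_product_ge_dist[of "y l" p "y (Suc l)"] jump[of l] by linarith
    qed
    then have "real (Suc j) * \<delta> - real j * \<delta> < gromov_product p (y 0) (y (0 + m))"
      using False m by (intro gromov_product_chain[OF hyp \<delta>]) auto
    then have 1: "\<delta> < gromov_product p (y 0) (y m)"
      by (simp add: algebra_simps)
    \<comment> \<open>The right side minus the left is
      \<open>gromov_product (y 0) x (y m) - t\<close>, by the two equations that place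
      \<open>p\<close> between \<open>y 0\<close> and \<open>x\<close>.\<close>
    have 2: "gromov_product p (y 0) (y m) \<le> gromov_product p (y m) x"
      using t p unfolding gromov_product_def by (simp add: dist_commute field_simps)
    have 3: "gromov_product p (y 0) x = 0"
      using p unfolding gromov_product_def by (simp add: dist_commute)
    show False
      using hyp[of p "y 0" "y m" x] 1 2 3 by linarith
  qed
  then show ?thesis using that by blast
qed

text \<open>Induction backwards from \<open>n\<close> in blocks of \<open>L\<close> steps. Over a
  block the guaranteed distance from \<open>p\<close> grows by \<open>c * L\<close>, which repays
  the \<delta> lost in one use of hyperbolicity; losses do not accumulate and the bound is uniform
  in \<open>n\<close>.\<close>

lemma escape_product:
  fixes y :: "nat \<Rightarrow> 'a::metric_space"
  assumes hyp: "\<And>x y z p::'a. gromov_product p x y \<ge> min (gromov_product p x z) (gromov_product p z y) - \<delta>"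
    and \<delta>: "\<delta> \<ge> 0" and \<kappa>: "\<kappa> \<ge> 0" and c: "c > 0"
    and jump: "\<And>k. dist (y k) (y (Suc k)) \<le> \<kappa>"
    and away: "\<And>k. N \<le> k \<Longrightarrow> c * real k \<le> dist (y k) p"
    and L: "1 \<le> L" "\<delta> \<le> c * real L"
    and k: "N \<le> k" "k \<le> n"
  shows "c * real k - real L * \<kappa> - \<delta> \<le> gromov_product p (y k) (y n)"
  using k
proof (induction "n - k" arbitrary: k rule: less_induct)
  case less
  have short: "c * real k - real L * \<kappa> \<le> gromov_product p (y k) (y (k + l))" if "l \<le> L" for l
  proof -
    have "dist (y k) (y (k + l)) \<le> real l * \<kappa>"
      by (rule dist_path_le) (rule jump)
    also have "\<dots> \<le> real L * \<kappa>"
      using that \<kappa> by (intro mult_right_mono) auto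
    finally show ?thesis
      using gromov_product_ge_dist[of "y k" p "y (k + l)"] away[OF less.prems(1)] by linarith
  qed
  show ?case
  proof (cases "n - k \<le> L")
    case True
    then show ?thesis
      using short[of "n - k"] less.prems \<delta> by simp
  next
    case False
    then have "n - (k + L) < n - k" "N \<le> k + L" "k + L \<le> n"
      using L less.prems by auto
    from less.hyps[OF this]
    have "c * real k + c * real L - real L * \<kappa> - \<delta> \<le> gromov_product p (y (k + L)) (y n)"
      by (simp add: algebra_simps)
    then show ?thesis
      using hyp[of p "y k" "y (k + L)" "y n"] short[of L] L(2) by linarith
  qed
qed

section \<open>Covering balls by orbit points\<close>

locale cocompact_space = proper_metric_space b for b :: "'a::metric_space" +
  assumes geodesic: "geodesic_space TYPE('a)"
    and cocompact: "cocompact_isom_action TYPE('a)"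
begin

lemma geodesic_point:
  assumes "0 \<le> t" "t \<le> dist x (y::'a)"
  obtains p where "dist x p = t" "dist p y = dist x y - t"
proof -
  from geodesic[unfolded geodesic_space_def, rule_format, of x y]
  obtain c where c: "c 0 = x" "c (dist x y) = y"
      "\<forall>s\<in>{0..dist x y}. \<forall>t\<in>{0..dist x y}. dist (c s) (c t) = \<bar>s - t\<bar>"
    by (elim exE conjE)
  have "dist (c 0) (c t) = t" "dist (c t) (c (dist x y)) = dist x y - t"
    using c(3) assms by auto
  then show ?thesis
    using that[of "c t"] c(1,2) by simp
qed

lemma orbit_coarsely_dense:
  obtains C where "C \<ge> 0" "\<And>y. \<exists>g\<in>isom_group. dist (g b) y \<le> C"
proof -
  obtain K where K: "compact K" "(\<Union>g\<in>isom_group. g ` K) = (UNIV :: 'a set)"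
    using cocompact unfolding cocompact_isom_action_def by blast
  obtain C where C: "\<And>k. k \<in> K \<Longrightarrow> dist b k \<le> C"
    using compact_imp_bounded[OF K(1)] unfolding bounded_any_center[of _ b] by blast
  have ex: "\<exists>g\<in>isom_group. dist (g b) y \<le> max C 0" for y
  proof -
    obtain g k where "g \<in> isom_group" "k \<in> K" "y = g k"
      using K(2) by blast
    then show ?thesis
      using C[of k] by (intro bexI[of _ g]) (auto simp: isom_group_dist)
  qed
  show ?thesis
    by (rule that[of "max C 0"]) (use ex in auto)
qed

text \<open>\<open>N\<close> counts orbit points that serve the fixed ball of radius
  \<open>C + 1\<close>. A point at distance at most \<open>n + 1\<close> is within 1 of one at
  distance at most \<open>n\<close>; pulled back by the group element serving the latter, it falls
  into that fixed ball. So each unit of radius costs a factor \<open>N\<close> while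
  \<open>C\<close> stays the same.\<close>

lemma orbit_growth:
  obtains C N where "C \<ge> 0" "N \<ge> (1::nat)"
    "\<And>y. \<exists>g\<in>isom_group. dist (g b) y \<le> C"
    "\<And>n. \<exists>F. finite F \<and> F \<subseteq> isom_group \<and> card F \<le> N ^ n \<and>
       (\<forall>y. dist b y \<le> real n \<longrightarrow> (\<exists>g\<in>F. dist (g b) y \<le> C))"
proof -
  obtain C0 where C0: "C0 \<ge> 0" "\<And>y. \<exists>g\<in>isom_group. dist (g b) y \<le> C0"
    using orbit_coarsely_dense by blast
  define C where "C = C0 + 1"
  obtain Y where Y: "finite Y" "cball b (C + 1) \<subseteq> (\<Union>y\<in>Y. ball y 1)"
    using compact_cball'[of b "C + 1"] unfolding compact_eq_totally_bounded by (metis zero_less_one)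
  from C0(2) obtain G where G: "\<And>y. G y \<in> isom_group" "\<And>y. dist (G y b) y \<le> C0"
    by metis
  define F1 where "F1 = G ` Y"
  have F1: "finite F1" "F1 \<subseteq> isom_group"
    using Y(1) G(1) by (auto simp: F1_def)
  have F1_cover: "\<exists>g\<in>F1. dist (g b) y \<le> C" if y: "dist b y \<le> C + 1" for y
  proof -
    obtain z where z: "z \<in> Y" "dist z y < 1"
      using Y(2) y by (auto simp: subset_iff)
    have "dist (G z b) y \<le> C"
      using dist_triangle[of "G z b" y z] G(2)[of z] z(2) by (simp add: C_def)
    then show ?thesis
      using z(1) by (auto simp: F1_def)
  qed
  define N where "N = card F1"
  have "F1 \<noteq> {}"
    using F1_cover[of b] C0(1) by (auto simp: C_def)
  then have N: "N \<ge> 1"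
    using F1(1) by (simp add: N_def Suc_le_eq card_gt_0_iff)
  have cover: "\<exists>F. finite F \<and> F \<subseteq> isom_group \<and> card F \<le> N ^ n \<and>
       (\<forall>y. dist b y \<le> real n \<longrightarrow> (\<exists>g\<in>F. dist (g b) y \<le> C))" for n
  proof (induction n)
    case 0
    show ?case
      using C0(1) by (intro exI[of _ "{id}"]) (auto simp: C_def)
  next
    case (Suc n)
    then obtain F where F: "finite F" "F \<subseteq> isom_group" "card F \<le> N ^ n"
       "\<And>y. dist b y \<le> real n \<Longrightarrow> \<exists>g\<in>F. dist (g b) y \<le> C"
      by blast
    define F' where "F' = (\<lambda>(g, f). g \<circ> f) ` (F \<times> F1)"
    have "finite F'" "F' \<subseteq> isom_group"
      using F(1) F1(1) isom_group_comp subsetD[OF F(2)] subsetD[OF F1(2)] unfolding F'_def by auto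
    moreover have "card F' \<le> N ^ Suc n"
    proof -
      have "card F' \<le> card F * card F1"
        unfolding F'_def using F(1) F1(1) by (metis card_cartesian_product card_image_le finite_SigmaI)
      also have "\<dots> \<le> N ^ n * N"
        using F(3) by (simp add: N_def)
      finally show ?thesis by (simp add: mult.commute)
    qed
    moreover have "\<exists>g\<in>F'. dist (g b) y \<le> C" if y: "dist b y \<le> real (Suc n)" for y
    proof -
      obtain z where z: "dist b z \<le> real n" "dist z y \<le> 1"
      proof (cases "dist b y \<le> 1")
        case True
        then show ?thesis using that[of b] by simp
      next
        case False
        obtain z where "dist b z = dist b y - 1" "dist z y = dist b y - (dist b y - 1)"
          using geodesic_point[of "dist b y - 1" b y] False by auto
        then show ?thesis using that[of z] y by simp
      qed
      obtain g where g: "g \<in> F" "dist (g b) z \<le> C"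
        using F(4)[OF z(1)] by blast
      have gi: "g \<in> isom_group" using g(1) F(2) by blast
      have "dist b (inv g y) = dist (g b) y"
        using isom_group_dist_inv[OF gi, of y b] by (simp add: dist_commute)
      also have "\<dots> \<le> C + 1"
        using dist_triangle[of "g b" y z] g(2) z(2) by linarith
      finally obtain f where f: "f \<in> F1" "dist (f b) (inv g y) \<le> C"
        using F1_cover by blast
      have "dist ((g \<circ> f) b) y = dist (f b) (inv g y)"
        using isom_group_dist_inv[OF gi, of y "f b"] by (simp add: dist_commute)
      then show ?thesis
        using f g(1) unfolding F'_def by (metis (no_types, lifting) case_prod_conv image_eqI mem_Sigma_iff)
    qed
    ultimately show ?case by blast
  qed
  have "\<exists>g\<in>isom_group. dist (g b) y \<le> C" for y
    using C0(2)[of y] by (force simp: C_def)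
  with cover N C0(1) show ?thesis
    by (intro that[of C N]) (auto simp: C_def)
qed

end

section \<open>Tail of the Gromov product along the walk\<close>

context walk_measure
begin

text \<open>By second countability the complement of the support is covered by countably many null
  base sets.\<close>

lemma AE_isom_support: "AE g in \<mu>. g \<in> isom_support \<mu>"
proof (rule AE_I')
  let ?N = "\<Union>F\<in>{F\<in>base_index. isom_base F \<in> null_sets \<mu>}. isom_base F"
  show "?N \<in> null_sets \<mu>"
    using countable_base_index by (intro null_sets_UN') (auto intro: countable_subset)
  show "{g \<in> space \<mu>. g \<notin> isom_support \<mu>} \<subseteq> ?N"
  proof
    fix g assume "g \<in> {g \<in> space \<mu>. g \<notin> isom_support \<mu>}"
    then obtain U where U: "openin isom_topology U" "g \<in> U" "emeasure \<mu> U = 0"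
      by (auto simp: isom_support_def zero_less_iff_neq_zero)
    from openin_isom_base[OF U(1,2)]
    obtain F where F: "F \<in> base_index" "g \<in> isom_base F" "isom_base F \<subseteq> U"
      by metis
    have "U \<in> null_sets \<mu>"
      using U openin_imp_sets_borel_on[OF U(1)] by (auto simp: null_sets_def sets_mu)
    then have "isom_base F \<in> null_sets \<mu>"
      using F isom_base_sets[OF F(1)] by (intro null_sets_subset[OF _ _ F(3)]) (auto simp: sets_mu)
    with F show "g \<in> ?N" by blast
  qed
qed

lemma AE_jump:
  assumes "bounded_isoms b (isom_support \<mu>)"
  shows "AE \<omega> in increments \<mu>. \<forall>k. dist (walk \<omega> k b) (walk \<omega> (Suc k) b) \<le> kappa b (isom_support \<mu>)"
proof -
  let ?\<kappa> = "kappa b (isom_support \<mu>)"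
  have "AE g in \<mu>. dist (g b) b \<le> ?\<kappa>"
    using AE_isom_support
  proof (rule AE_mp, intro AE_I2 impI)
    fix g assume "g \<in> isom_support \<mu>"
    then show "dist (g b) b \<le> ?\<kappa>"
      using assms unfolding kappa_def bounded_isoms_def by (intro cSUP_upper)
  qed
  then have "AE \<omega> in increments \<mu>. \<forall>k. dist (\<omega> k b) b \<le> ?\<kappa>"
    unfolding increments_def AE_all_countable
    by (intro allI AE_PiM_component) (auto intro: prob_space_axioms)
  then show ?thesis
  proof (rule AE_mp, intro AE_I2 impI allI)
    fix \<omega> k assume "\<omega> \<in> space (increments \<mu>)" "\<forall>k. dist (\<omega> k b) b \<le> ?\<kappa>"
    then show "dist (walk \<omega> k b) (walk \<omega> (Suc k) b) \<le> ?\<kappa>"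
      using isom_group_dist[OF walk_in_isom_group[of \<omega> k]] by (simp add: dist_commute)
  qed
qed

lemma gromov_product_event [measurable]:
  "{\<omega> \<in> space (increments \<mu>). t \<le> gromov_product b x (walk \<omega> n (y::'a))} \<in> sets (increments \<mu>)"
proof -
  have "(\<lambda>\<omega>. dist (walk \<omega> n y) z) \<in> borel_measurable (increments \<mu>)" for z
    by (rule measurable_compose[OF measurable_walk borel_measurable_isom_eval])
  then have "(\<lambda>\<omega>. gromov_product b x (walk \<omega> n y)) \<in> borel_measurable (increments \<mu>)"
    unfolding gromov_product_def dist_commute[of x "walk _ n y"] by (intro borel_measurable_divide borel_measurable_diff
        borel_measurable_add borel_measurable_const)
  then show ?thesis
    by (intro borel_measurable_le borel_measurable_const)
qed

end

section \<open>Elementary estimates for logarithmic radii\<close>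

lemma exists_power2_between: "\<exists>j. N \<le> 2 ^ j \<and> 2 ^ j \<le> 2 * N + (1::nat)"
proof (induction N)
  case 0
  show ?case by (rule exI[of _ 0]) simp
next
  case (Suc N)
  then obtain j where j: "N \<le> 2 ^ j" "2 ^ j \<le> 2 * N + (1::nat)" by blast
  show ?case
  proof (cases "Suc N \<le> 2 ^ j")
    case True
    with j show ?thesis by (intro exI[of _ j]) auto
  next
    case False
    with j have "N = 2 ^ j" by simp
    then show ?thesis by (intro exI[of _ "Suc j"]) auto
  qed
qed

text \<open>Collects the two polynomial losses: the number of candidate times and the exponential of
  a radius linear in \<open>j\<close>. As \<open>2 ^ j\<close> is at most \<open>2 * N + 1\<close>,
  the second is bounded by a power of \<open>t + 1\<close>, which any positive exponential rate
  \<epsilon> dominates.\<close>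

lemma logarithmic_radius_bound:
  fixes K w a d \<epsilon> :: real
  assumes K: "K \<ge> 0" and w: "w \<ge> 0" and d: "d \<ge> 0" and \<epsilon>: "\<epsilon> > 0"
  obtains C where "C \<ge> 0"
    "\<And>t N j. t \<ge> 0 \<Longrightarrow> real N \<le> K * (t + 1) + 1 \<Longrightarrow> 2 ^ j \<le> 2 * N + (1::nat) \<Longrightarrow>
      real (N + 1) * exp (w * (a + real (Suc j) * d)) \<le> C * exp (\<epsilon> * t)"
proof -
  \<comment> \<open>The degree of that power: \<open>j * ln 2 \<le> ln u\<close> turns
    \<open>w * d * j\<close> into at most \<open>e * ln u\<close>.\<close>
  define e where "e = w * d / ln 2"
  have e: "e \<ge> 0" using w d by (simp add: e_def)
  define B where "B = 2 * K + 3"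
  have B: "B > 0" using K by (simp add: B_def)
  \<comment> \<open>Chosen so that \<open>(1 + e) * \<eta> = \<epsilon>\<close>, for use with
    \<open>ln z \<le> z - 1\<close> at \<open>z = \<eta> * (t + 1)\<close>.\<close>
  define \<eta> where "\<eta> = \<epsilon> / (1 + e)"
  have \<eta>: "\<eta> > 0" using \<epsilon> e by (simp add: \<eta>_def)
  define C where "C = exp (w * (a + d)) * exp ((1 + e) * (ln B - ln \<eta>) + \<epsilon>)"
  have "real (N + 1) * exp (w * (a + real (Suc j) * d)) \<le> C * exp (\<epsilon> * t)"
    if t: "t \<ge> 0" and N: "real N \<le> K * (t + 1) + 1" and j: "2 ^ j \<le> 2 * N + (1::nat)" for t N j
  proof -
    define u where "u = B * (t + 1)"
    have u: "u > 0" using B t by (simp add: u_def)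
    have N2: "2 * real N + 1 \<le> u"
      using N K t by (simp add: u_def B_def algebra_simps)
    have "real (N + 1) \<le> u"
      using N2 N K t by (simp add: u_def B_def algebra_simps)
    then have 1: "real (N + 1) \<le> exp (ln u)"
      using u by simp
    have "real j * ln 2 = ln (2 ^ j)"
      by (simp add: ln_realpow)
    also have "\<dots> \<le> ln u"
    proof -
      have "(2::real) ^ j \<le> 2 * real N + 1"
        using j by (metis (mono_tags, lifting) of_nat_le_iff of_nat_power of_nat_numeral of_nat_mult of_nat_add of_nat_1)
      then show ?thesis
        using N2 u by simp
    qed
    finally have "e * (real j * ln 2) \<le> e * ln u"
      using e by (rule mult_left_mono)
    then have 2: "w * d * real j \<le> e * ln u"
      by (simp add: e_def field_simps)
    have "ln (\<eta> * (t + 1)) \<le> \<eta> * (t + 1) - 1"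
      using \<eta> t by (intro ln_le_minus_one) simp
    then have "ln u \<le> ln B - ln \<eta> + \<eta> * (t + 1)"
      using \<eta> t B by (simp add: u_def ln_mult)
    then have "(1 + e) * ln u \<le> (1 + e) * (ln B - ln \<eta> + \<eta> * (t + 1))"
      using e by (intro mult_left_mono) auto
    also have "\<dots> = (1 + e) * (ln B - ln \<eta>) + ((1 + e) * \<eta>) * (t + 1)"
      by (simp add: algebra_simps)
    also have "(1 + e) * \<eta> = \<epsilon>"
      using e by (simp add: \<eta>_def)
    finally have 3: "(1 + e) * ln u \<le> (1 + e) * (ln B - ln \<eta>) + \<epsilon> + \<epsilon> * t"
      by (simp add: algebra_simps)
    have "real (N + 1) * exp (w * (a + real (Suc j) * d)) \<le> exp (ln u) * exp (w * (a + d) + e * ln u)"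
      using 1 2 by (intro mult_mono) (auto simp: algebra_simps)
    also have "\<dots> = exp (w * (a + d)) * exp ((1 + e) * ln u)"
      by (simp add: exp_add[symmetric] algebra_simps)
    also have "\<dots> \<le> exp (w * (a + d)) * exp ((1 + e) * (ln B - ln \<eta>) + \<epsilon> + \<epsilon> * t)"
      using 3 by (intro mult_left_mono) auto
    also have "\<dots> = C * exp (\<epsilon> * t)"
      by (simp add: C_def exp_add)
    finally show ?thesis .
  qed
  then show ?thesis
    using that[of C] by (simp add: C_def)
qed

text \<open>All that is used of the operator norm: orbit balls have uniformly exponentially small probability.\<close>

locale decaying_walk = cocompact_space b + walk_measure b \<mu>
  for b :: "'a::metric_space" and \<mu> :: "('a \<Rightarrow> 'a) measure" +
  fixes \<delta> \<kappa> \<rho> :: real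
  assumes \<delta>: "\<delta> \<ge> 0"
    and hyp: "\<And>x y z p::'a. gromov_product p x y \<ge> min (gromov_product p x z) (gromov_product p z y) - \<delta>"
    and \<kappa>: "\<kappa> > 0"
    and jump: "AE \<omega> in increments \<mu>. \<forall>k. dist (walk \<omega> k b) (walk \<omega> (Suc k) b) \<le> \<kappa>"
    and \<rho>: "0 < \<rho>" "\<rho> < 1"
    and decay: "\<And>R. \<exists>C\<ge>0. \<forall>k. \<forall>g\<in>isom_group.
        measure (increments \<mu>) {\<omega> \<in> space (increments \<mu>). dist (walk \<omega> k b) (g b) \<le> R} \<le> C * \<rho> ^ k"
begin

sublocale P: prob_space "increments \<mu>"
  by (rule prob_space_increments)

section \<open>Ball, escape and tail probabilities of the walk\<close>

text \<open>The assumption \<open>decay\<close> does not say how its constant depends on the radius.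
  It is therefore applied to the single radius \<open>C0\<close>, and a larger ball is covered by
  orbit balls of that radius, whose number grows at rate \<open>v = ln N\<close>.\<close>

lemma ball_prob_le:
  obtains C v where "C \<ge> 0" "v \<ge> 0"
    "\<And>k y D. D \<ge> 0 \<Longrightarrow> P.prob {\<omega> \<in> space (increments \<mu>). dist (walk \<omega> k b) y \<le> D} \<le> C * exp (v * D) * \<rho> ^ k"
proof -
  obtain C0 N where C0: "C0 \<ge> 0" and N: "N \<ge> (1::nat)"
    and dense: "\<And>y. \<exists>g\<in>isom_group. dist (g b) y \<le> C0"
    and growth: "\<And>n. \<exists>F. finite F \<and> F \<subseteq> isom_group \<and> card F \<le> N ^ n \<and>
       (\<forall>y. dist b y \<le> real n \<longrightarrow> (\<exists>g\<in>F. dist (g b) y \<le> C0))"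
    using orbit_growth by metis
  obtain C where C: "C \<ge> 0" and dec: "\<And>k g. g \<in> isom_group \<Longrightarrow>
      P.prob {\<omega> \<in> space (increments \<mu>). dist (walk \<omega> k b) (g b) \<le> C0} \<le> C * \<rho> ^ k"
    using decay[of C0] by blast
  define v where "v = ln (real N)"
  have v: "v \<ge> 0" using N by (simp add: v_def)
  have "P.prob {\<omega> \<in> space (increments \<mu>). dist (walk \<omega> k b) y \<le> D}
      \<le> C * exp (v * (C0 + 1)) * exp (v * D) * \<rho> ^ k" if D: "D \<ge> 0" for k y D
  proof -
    obtain g where g: "g \<in> isom_group" "dist (g b) y \<le> C0"
      using dense by blast
    define n where "n = nat \<lceil>D + C0\<rceil>"
    have n: "D + C0 \<le> real n" "real n \<le> D + C0 + 1"
      using D C0 unfolding n_def by linarith+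
    obtain F where F: "finite F" "F \<subseteq> isom_group" "card F \<le> N ^ n"
       "\<And>y. dist b y \<le> real n \<Longrightarrow> \<exists>f\<in>F. dist (f b) y \<le> C0"
      using growth by metis
    let ?A = "\<lambda>f. {\<omega> \<in> space (increments \<mu>). dist (walk \<omega> k b) ((g \<circ> f) b) \<le> C0}"
    have "{\<omega> \<in> space (increments \<mu>). dist (walk \<omega> k b) y \<le> D} \<subseteq> (\<Union>f\<in>F. ?A f)"
    proof
      fix \<omega> assume \<omega>: "\<omega> \<in> {\<omega> \<in> space (increments \<mu>). dist (walk \<omega> k b) y \<le> D}"
      have "dist b (inv g (walk \<omega> k b)) = dist (g b) (walk \<omega> k b)"
        using isom_group_dist_inv[OF g(1), of "walk \<omega> k b" b] by (simp add: dist_commute)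
      also have "\<dots> \<le> real n"
        using dist_triangle2[of "g b" "walk \<omega> k b" y] \<omega> g(2) n(1) by simp
      finally obtain f where f: "f \<in> F" "dist (f b) (inv g (walk \<omega> k b)) \<le> C0"
        using F(4) by blast
      then have "dist (walk \<omega> k b) ((g \<circ> f) b) \<le> C0"
        using isom_group_dist_inv[OF g(1), of "walk \<omega> k b" "f b"] by (simp add: dist_commute)
      then show "\<omega> \<in> (\<Union>f\<in>F. ?A f)"
        using f(1) \<omega> by blast
    qed
    then have "P.prob {\<omega> \<in> space (increments \<mu>). dist (walk \<omega> k b) y \<le> D} \<le> P.prob (\<Union>f\<in>F. ?A f)"
      using F(1) by (intro P.finite_measure_mono sets.finite_UN walk_ball_event) auto
    also have "\<dots> \<le> (\<Sum>f\<in>F. P.prob (?A f))"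
      using F(1) walk_ball_event by (intro P.finite_measure_subadditive_finite) auto
    also have "\<dots> \<le> (\<Sum>f\<in>F. C * \<rho> ^ k)"
      using F(2) g(1) by (intro sum_mono dec isom_group_comp) auto
    also have "\<dots> = real (card F) * (C * \<rho> ^ k)"
      by simp
    also have "\<dots> \<le> exp (v * (D + C0 + 1)) * (C * \<rho> ^ k)"
    proof (rule mult_right_mono)
      have "real (card F) \<le> real N ^ n"
        using F(3) by (metis of_nat_le_iff of_nat_power)
      also have "\<dots> = exp (v * real n)"
        using N by (simp add: v_def exp_of_nat2_mult)
      also have "\<dots> \<le> exp (v * (D + C0 + 1))"
        using v n(2) by (simp add: mult_left_mono)
      finally show "real (card F) \<le> exp (v * (D + C0 + 1))" .
    qed (use C \<rho> in simp)
    also have "\<dots> = C * exp (v * (C0 + 1)) * exp (v * D) * \<rho> ^ k"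
      by (simp add: exp_add[symmetric] algebra_simps)
    finally show ?thesis .
  qed
  then show ?thesis
    using that[of "C * exp (v * (C0 + 1))" v] C v by simp
qed

lemma rho_power: "\<rho> ^ k = exp (- (ln (1 / \<rho>) * real k))"
proof -
  have "\<rho> ^ k = exp (ln \<rho>) ^ k"
    using \<rho> by simp
  also have "\<dots> = exp (real k * ln \<rho>)"
    by (rule exp_of_nat_mult[symmetric])
  also have "\<dots> = exp (- (ln (1 / \<rho>) * real k))"
    using \<rho> by (simp add: ln_div mult.commute)
  finally show ?thesis .
qed

lemma escape_prob_le:
  obtains C c where "C \<ge> 0" "c > 0"
    "\<And>N. P.prob {\<omega> \<in> space (increments \<mu>). \<exists>k\<ge>N. dist (walk \<omega> k b) b \<le> c * real k}
      \<le> C * exp (- (ln (1 / \<rho>) / 2 * real N))"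
proof -
  obtain C v where C: "C \<ge> 0" and v: "v \<ge> 0" and
    ball: "\<And>k y D. D \<ge> 0 \<Longrightarrow> P.prob {\<omega> \<in> space (increments \<mu>). dist (walk \<omega> k b) y \<le> D} \<le> C * exp (v * D) * \<rho> ^ k"
    by (rule ball_prob_le) blast
  define l where "l = ln (1 / \<rho>)"
  have l: "l > 0" using \<rho> by (simp add: l_def)
  \<comment> \<open>Slow enough that the growth \<open>exp (v * c * k)\<close> consumes at most half
    of the decay rate \<open>l\<close>; the other half makes the union over \<open>k \<ge> N\<close>
    summable. The \<open>+ 1\<close> allows for \<open>v = 0\<close>.\<close>
  define c where "c = l / (2 * (v + 1))"
  have c: "c > 0" "v * c \<le> l / 2"
    using l v by (simp_all add: c_def field_simps)
  define q where "q = exp (- (l / 2))"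
  have q: "0 < q" "q < 1" using l by (simp_all add: q_def)
  have single: "P.prob {\<omega> \<in> space (increments \<mu>). dist (walk \<omega> k b) b \<le> c * real k} \<le> C * q ^ k" for k
  proof -
    have "P.prob {\<omega> \<in> space (increments \<mu>). dist (walk \<omega> k b) b \<le> c * real k}
        \<le> C * exp (v * (c * real k)) * \<rho> ^ k"
      using c by (intro ball) simp
    also have "\<dots> = C * exp (v * c * real k - l * real k)"
      unfolding rho_power l_def by (simp add: exp_add[symmetric] algebra_simps)
    also have "\<dots> \<le> C * exp (real k * (- (l / 2)))"
      using C c(2) mult_right_mono[OF c(2), of "real k"]
      by (intro mult_left_mono) (auto simp: algebra_simps)
    also have "\<dots> = C * q ^ k"
      unfolding q_def exp_of_nat_mult ..
    finally show ?thesis .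
  qed
  have "P.prob {\<omega> \<in> space (increments \<mu>). \<exists>k\<ge>N. dist (walk \<omega> k b) b \<le> c * real k} \<le> C / (1 - q) * q ^ N" for N
  proof -
    let ?A = "\<lambda>i. {\<omega> \<in> space (increments \<mu>). dist (walk \<omega> (i + N) b) b \<le> c * real (i + N)}"
    have eq: "{\<omega> \<in> space (increments \<mu>). \<exists>k\<ge>N. dist (walk \<omega> k b) b \<le> c * real k} = (\<Union>i. ?A i)"
    proof (intro equalityI subsetI)
      fix \<omega> assume "\<omega> \<in> {\<omega> \<in> space (increments \<mu>). \<exists>k\<ge>N. dist (walk \<omega> k b) b \<le> c * real k}"
      then obtain k where k: "k \<ge> N" "\<omega> \<in> space (increments \<mu>)" "dist (walk \<omega> k b) b \<le> c * real k"
        by blast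
      then have "\<omega> \<in> ?A (k - N)"
        by simp
      then show "\<omega> \<in> (\<Union>i. ?A i)" by blast
    next
      fix \<omega> assume "\<omega> \<in> (\<Union>i. ?A i)"
      then obtain i where "\<omega> \<in> ?A i" by blast
      then show "\<omega> \<in> {\<omega> \<in> space (increments \<mu>). \<exists>k\<ge>N. dist (walk \<omega> k b) b \<le> c * real k}"
        by (auto intro!: exI[of _ "i + N"])
    qed
    have sums: "(\<lambda>i. C * q ^ (i + N)) sums (C * q ^ N * (1 / (1 - q)))"
      unfolding power_add using sums_mult[OF geometric_sums[of q], of "C * q ^ N"] q by (simp add: mult_ac)
    have summ: "summable (\<lambda>i. P.prob (?A i))"
      by (rule summable_comparison_test'[OF sums_summable[OF sums], of 0]) (simp add: single del: of_nat_add)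
    have "P.prob (\<Union>i. ?A i) \<le> (\<Sum>i. P.prob (?A i))"
      using walk_ball_event summ by (intro P.finite_measure_subadditive_countably) auto
    also have "\<dots> \<le> (\<Sum>i. C * q ^ (i + N))"
      by (intro suminf_le summ sums_summable[OF sums] single)
    also have "\<dots> = C / (1 - q) * q ^ N"
      using sums_unique[OF sums] by simp
    finally show ?thesis
      unfolding eq .
  qed
  moreover have "q ^ N = exp (- (l / 2 * real N))" for N
    using exp_of_nat_mult[of N "- (l / 2)"] by (simp add: q_def mult.commute)
  ultimately show ?thesis
    using that[of "C / (1 - q)" c] C c q by (simp add: l_def)
qed

theorem gromov_product_tail:
  assumes s: "0 \<le> s" "s < ln (1 / \<rho>) / \<kappa>"
  obtains C where "C \<ge> 0"
    "\<And>x n t. t \<ge> 0 \<Longrightarrow> P.prob {\<omega> \<in> space (increments \<mu>). t \<le> gromov_product b x (walk \<omega> n b)} \<le> C * exp (- s * t)"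
proof -
  define l where "l = ln (1 / \<rho>)"
  have l: "l > 0" using \<rho> by (simp add: l_def)
  obtain C v where C: "C \<ge> 0" and v: "v \<ge> 0" and
    ball: "\<And>k y D. D \<ge> 0 \<Longrightarrow> P.prob {\<omega> \<in> space (increments \<mu>). dist (walk \<omega> k b) y \<le> D} \<le> C * exp (v * D) * \<rho> ^ k"
    by (rule ball_prob_le) blast
  obtain Ce c where Ce: "Ce \<ge> 0" and c: "c > 0" and
    escape: "\<And>N. P.prob {\<omega> \<in> space (increments \<mu>). \<exists>k\<ge>N. dist (walk \<omega> k b) b \<le> c * real k} \<le> Ce * exp (- (l / 2 * real N))"
    unfolding l_def by (rule escape_prob_le) blast
  obtain L :: nat where L: "1 \<le> L" "\<delta> \<le> c * real L"
  proof -
    obtain L :: nat where "\<delta> / c \<le> real L" using real_arch_simple by blast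
    then have "\<delta> / c \<le> real (max 1 L)"
      by (rule order_trans) simp
    then have "\<delta> \<le> c * real (max 1 L)"
      using c by (simp add: pos_divide_le_eq mult.commute del: of_nat_max)
    then show ?thesis using that[of "max 1 L"] by simp
  qed
  define A where "A = real L * \<kappa> + \<delta>"
  have A: "A \<ge> 0" using \<kappa> \<delta> by (simp add: A_def)
  \<comment> \<open>Two demands on the cut-off \<open>N\<close>: the first term lets linear escape
    bring the product of the positions at times \<open>N\<close> and \<open>n\<close> up to
    \<open>t + \<delta>\<close>, the second makes a failure of escape of order at most
    \<open>exp (- s * t)\<close>.\<close>
  define K where "K = max ((1 + A + \<delta>) / c) (2 * s / l)"
  have K: "1 + A + \<delta> \<le> c * K" "s \<le> l / 2 * K" "K > 0"
  proof -
    have "(1 + A + \<delta>) / c \<le> K" "2 * s / l \<le> K" by (simp_all add: K_def)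
    then show "1 + A + \<delta> \<le> c * K" "s \<le> l / 2 * K"
      using c l by (simp_all add: field_simps)
    have "0 < (1 + A + \<delta>) / c" using A \<delta> c by simp
    then show "K > 0" unfolding K_def by simp
  qed
  \<comment> \<open>The radius \<open>D\<close> is paid for twice: \<open>v\<close> for the number
    of orbit balls, and \<open>l / \<kappa>\<close> because the walk may arrive
    \<open>D / \<kappa>\<close> steps earlier.\<close>
  define w where "w = v + l / \<kappa>"
  have w: "w \<ge> 0" using v l \<kappa> by (simp add: w_def)
  have "l / \<kappa> - s > 0" using s by (simp add: l_def)
  then obtain Cl where Cl: "Cl \<ge> 0" and log_bound: "\<And>t N j. t \<ge> 0 \<Longrightarrow> real N \<le> K * (t + 1) + 1 \<Longrightarrow> 2 ^ j \<le> 2 * N + (1::nat) \<Longrightarrow>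
      real (N + 1) * exp (w * (\<kappa> + real (Suc j) * \<delta>)) \<le> Cl * exp ((l / \<kappa> - s) * t)"
    using logarithmic_radius_bound[of K w \<delta> "l / \<kappa> - s" \<kappa>] K(3) w \<delta> by (metis less_imp_le)
  \<comment> \<open>The extra \<delta> is the price of replacing time \<open>n\<close> by the
    cut-off time \<open>N\<close>; it is removed at the end.\<close>
  have main: "P.prob {\<omega> \<in> space (increments \<mu>). t + \<delta> \<le> gromov_product b x (walk \<omega> n b)} \<le> (Ce + C * Cl) * exp (- s * t)"
    (is "P.prob ?E \<le> _") if t: "t \<ge> 0" for x n t
  proof (cases "t \<le> dist b x")
    \<comment> \<open>The geodesic to \<open>x\<close> is too short to carry \<open>p\<close>, but
      the Gromov product is at most \<open>dist b x\<close>, so the event is empty.\<close>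
    case False
    have E: "?E = {}"
    proof -
      have "\<not> t + \<delta> \<le> gromov_product b x (walk \<omega> n b)" for \<omega>
        using gromov_product_le_dist[of b x "walk \<omega> n b"] False \<delta> by (simp add: dist_commute)
      then show ?thesis by simp
    qed
    have "0 \<le> (Ce + C * Cl) * exp (- s * t)"
      using Ce C Cl by simp
    then show ?thesis unfolding E by simp
  next
    case True
    then obtain p where p: "dist b p = t" "dist p x = dist b x - t"
      using geodesic_point t by blast
    define N where "N = nat \<lceil>K * (t + 1)\<rceil>"
    have N: "K * (t + 1) \<le> real N" "real N \<le> K * (t + 1) + 1"
      using K(3) t unfolding N_def by (auto simp: real_nat_ceiling_ge intro!: less_imp_le)
    obtain j where j: "N \<le> 2 ^ j" "2 ^ j \<le> 2 * N + (1::nat)"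
      using exists_power2_between by blast
    define D where "D = \<kappa> + real (Suc j) * \<delta>"
    have D: "D \<ge> 0" using \<kappa> \<delta> by (simp add: D_def)
    have cN: "t + A + \<delta> \<le> c * real N"
    proof -
      have "t + A + \<delta> \<le> (1 + A + \<delta>) * (t + 1)"
        using t A \<delta> by (simp add: algebra_simps)
      also have "\<dots> \<le> c * K * (t + 1)"
        using K(1) t by (intro mult_right_mono) auto
      also have "\<dots> \<le> c * real N"
        using N(1) c by (simp add: mult.assoc)
      finally show ?thesis .
    qed
    \<comment> \<open>With jumps at most \<kappa> the walk cannot be within \<open>D\<close> of
      \<open>p\<close> before time \<open>(t - D) / \<kappa>\<close>; this restriction carries the
      sharp exponent.\<close>
    let ?I = "{k. k \<le> N \<and> t - D \<le> real k * \<kappa>}"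
    let ?A = "\<lambda>k. {\<omega> \<in> space (increments \<mu>). dist (walk \<omega> k b) p \<le> D}"
    let ?E1 = "{\<omega> \<in> space (increments \<mu>). \<exists>k\<ge>N. dist (walk \<omega> k b) b \<le> c * real k}"
    have I: "finite ?I" by simp
    have E1_sets: "?E1 \<in> P.events"
    proof -
      have "?E1 = (\<Union>k\<in>{N..}. {\<omega> \<in> space (increments \<mu>). dist (walk \<omega> k b) b \<le> c * real k})"
        by auto
      then show ?thesis by simp
    qed
    have A_sets: "?A k \<in> P.events" for k by simp
    have "P.prob ?E \<le> P.prob (?E1 \<union> (\<Union>k\<in>?I. ?A k))"
    proof (rule P.finite_measure_mono_AE)
      show "?E1 \<union> (\<Union>k\<in>?I. ?A k) \<in> P.events"
        using E1_sets I A_sets by (intro sets.Un sets.finite_UN) auto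
      show "AE \<omega> in increments \<mu>. \<omega> \<in> ?E \<longrightarrow> \<omega> \<in> ?E1 \<union> (\<Union>k\<in>?I. ?A k)"
        using jump
      proof (rule AE_mp, intro AE_I2 impI)
        fix \<omega> assume \<omega>: "\<omega> \<in> space (increments \<mu>)"
          and J: "\<forall>k. dist (walk \<omega> k b) (walk \<omega> (Suc k) b) \<le> \<kappa>" and E: "\<omega> \<in> ?E"
        define y where "y = (\<lambda>k. walk \<omega> k b)"
        have jy: "dist (y k) (y (Suc k)) \<le> \<kappa>" for k using J by (simp only: y_def)
        have y0: "y 0 = b" by (simp add: y_def)
        have tn: "t + \<delta> \<le> gromov_product b x (y n)" using E by (simp add: y_def)
        show "\<omega> \<in> ?E1 \<union> (\<Union>k\<in>?I. ?A k)"
        proof (cases "\<omega> \<in> ?E1")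
          case False
          then have away: "c * real k \<le> dist (y k) b" if "N \<le> k" for k
          proof -
            have "\<not> dist (walk \<omega> k b) b \<le> c * real k"
              using False \<omega> that by blast
            then show ?thesis by (simp add: y_def)
          qed
          \<comment> \<open>The path is stopped at time \<open>N\<close>. If \<open>n\<close> is
            later, the positions at both times have product at least \<open>t + \<delta>\<close>, so
            the one at time \<open>N\<close> keeps product at least \<open>t\<close> with
            \<open>x\<close>.\<close>
          define m' where "m' = min n N"
          have tm: "t \<le> gromov_product (y 0) x (y m')"
          proof (cases "n \<le> N")
            case True
            then show ?thesis using tn \<delta> by (simp add: m'_def y0)
          next
            case False
            then have "c * real N - real L * \<kappa> - \<delta> \<le> gromov_product b (y N) (y n)"
              by (intro escape_product[where N = N, OF hyp \<delta> _ c jy away L]) (use \<kappa> in auto)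
            then have "t + \<delta> \<le> gromov_product b (y n) (y N)"
              using cN by (simp add: A_def gromov_product_commute)
            then show ?thesis
              using hyp[of b x "y n" "y N"] tn False by (simp add: m'_def y0)
          qed
          have "m' \<le> 2 ^ j" using j(1) by (simp add: m'_def)
          from path_near_point[where y = y, OF hyp \<delta> less_imp_le[OF \<kappa>] jy this tm] p
          obtain k where k: "k \<le> m'" "dist (y k) p \<le> D"
            unfolding D_def y0 by metis
          have "t \<le> dist (y 0) (y (0 + k)) + dist (y k) p"
            using dist_triangle[of b p "y k"] p(1) by (simp add: y0)
          also have "\<dots> \<le> real k * \<kappa> + D"
            by (intro add_mono k(2) dist_path_le) (rule jy)
          finally have "k \<in> ?I" using k(1) by (simp add: m'_def)
          moreover have "\<omega> \<in> ?A k" using k(2) \<omega> by (simp add: y_def)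
          ultimately show ?thesis by blast
        qed simp
      qed
    qed
    also have "\<dots> \<le> P.prob ?E1 + P.prob (\<Union>k\<in>?I. ?A k)"
      using E1_sets I A_sets by (intro measure_Un_le sets.finite_UN) auto
    also have "P.prob (\<Union>k\<in>?I. ?A k) \<le> (\<Sum>k\<in>?I. P.prob (?A k))"
      using I A_sets by (intro P.finite_measure_subadditive_finite) auto
    also have "\<dots> \<le> (\<Sum>k\<in>?I. C * (exp (w * D) * exp (- (l / \<kappa> * t))))"
    proof (rule sum_mono)
      fix k assume k: "k \<in> ?I"
      have "(t - D) / \<kappa> \<le> real k" using k \<kappa> by (simp add: field_simps)
      then have "l * ((t - D) / \<kappa>) \<le> l * real k"
        using l by (intro mult_left_mono) auto
      then have "v * D - l * real k \<le> w * D - l / \<kappa> * t"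
        by (simp add: w_def algebra_simps diff_divide_distrib)
      then have "exp (v * D) * exp (- (l * real k)) \<le> exp (w * D) * exp (- (l / \<kappa> * t))"
        by (simp add: exp_add[symmetric])
      then have "C * (exp (v * D) * exp (- (l * real k))) \<le> C * (exp (w * D) * exp (- (l / \<kappa> * t)))"
        using C by (rule mult_left_mono)
      moreover have "P.prob (?A k) \<le> C * exp (v * D) * exp (- (l * real k))"
        using ball[OF D, of k p] unfolding rho_power l_def .
      ultimately show "P.prob (?A k) \<le> C * (exp (w * D) * exp (- (l / \<kappa> * t)))"
        by (simp add: mult.assoc)
    qed
    also have "\<dots> = real (card ?I) * (C * (exp (w * D) * exp (- (l / \<kappa> * t))))"
      by simp
    also have "\<dots> \<le> real (N + 1) * (C * (exp (w * D) * exp (- (l / \<kappa> * t))))"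
    proof (rule mult_right_mono)
      have "card ?I \<le> card {..N}" by (rule card_mono) auto
      then show "real (card ?I) \<le> real (N + 1)" by simp
    qed (use C in simp)
    also have "\<dots> = C * (real (N + 1) * exp (w * D)) * exp (- (l / \<kappa> * t))"
      by (simp add: mult_ac)
    also have "\<dots> \<le> C * (Cl * exp ((l / \<kappa> - s) * t)) * exp (- (l / \<kappa> * t))"
      unfolding D_def using C by (intro mult_right_mono mult_left_mono log_bound t N j) auto
    also have "\<dots> = C * Cl * exp (- s * t)"
      by (simp add: mult.assoc exp_add[symmetric] left_diff_distrib)
    also have "P.prob ?E1 \<le> Ce * exp (- s * t)"
    proof -
      have "s * t \<le> l / 2 * K * t"
        using K(2) t by (rule mult_right_mono)
      also have "\<dots> \<le> l / 2 * (K * (t + 1))"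
        using l K(3) t by (simp add: field_simps)
      also have "\<dots> \<le> l / 2 * real N"
        using N(1) l by (intro mult_left_mono) auto
      finally have "Ce * exp (- (l / 2 * real N)) \<le> Ce * exp (- s * t)"
        using Ce by (intro mult_left_mono) auto
      then show ?thesis using escape[of N] by linarith
    qed
    finally show ?thesis by (simp add: algebra_simps)
  qed
  \<comment> \<open>\<open>exp (s * \<delta>)\<close> undoes the shift of \<open>t\<close> by
    \<delta>; the \<open>+ 1\<close> makes the bound exceed 1 for
    \<open>t < \<delta>\<close>.\<close>
  define C1 where "C1 = (Ce + C * Cl + 1) * exp (s * \<delta>)"
  have "P.prob {\<omega> \<in> space (increments \<mu>). t \<le> gromov_product b x (walk \<omega> n b)} \<le> C1 * exp (- s * t)"
    if t: "t \<ge> 0" for x n t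
  proof (cases "t \<ge> \<delta>")
    case True
    have "P.prob {\<omega> \<in> space (increments \<mu>). t \<le> gromov_product b x (walk \<omega> n b)} \<le> (Ce + C * Cl) * exp (- s * (t - \<delta>))"
      using main[of "t - \<delta>" x n] True by simp
    also have "\<dots> \<le> (Ce + C * Cl + 1) * exp (- s * (t - \<delta>))"
      by (intro mult_right_mono) auto
    also have "\<dots> = C1 * exp (- s * t)"
      by (simp add: C1_def mult.assoc exp_add[symmetric] algebra_simps)
    finally show ?thesis .
  next
    case False
    have "P.prob {\<omega> \<in> space (increments \<mu>). t \<le> gromov_product b x (walk \<omega> n b)} \<le> 1"
      by (rule P.prob_le_1)
    also have "1 \<le> exp (s * (\<delta> - t))"
      using False s(1) by simp
    also have "\<dots> = 1 * exp (s * \<delta>) * exp (- s * t)"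
      by (simp add: exp_add[symmetric] algebra_simps)
    also have "\<dots> \<le> C1 * exp (- s * t)"
      unfolding C1_def using Ce C Cl by (intro mult_right_mono) auto
    finally show ?thesis .
  qed
  moreover have "C1 \<ge> 0" using Ce C Cl by (simp add: C1_def)
  ultimately show ?thesis using that[of C1] by blast
qed

end

section \<open>Neighbourhoods of boundary points and semicontinuity\<close>

lemma ereal_Liminf_real_ge:
  fixes f :: "_ \<Rightarrow> real"
  assumes "ereal r \<le> Liminf F (\<lambda>x. ereal (f x))" "e > 0"
  shows "eventually (\<lambda>x. r - e \<le> f x) F"
proof -
  have "ereal (r - e) < Liminf F (\<lambda>x. ereal (f x))"
    using assms by (metis diff_gt_0_iff_gt diff_diff_eq2 add_diff_cancel_left' diff_less_eq less_add_same_cancel1 less_ereal.simps(1) less_le_trans)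
  from less_LiminfD[OF this] show ?thesis
    by eventually_elim simp
qed

lemma Liminf_ereal_real_geI:
  fixes f :: "_ \<Rightarrow> real"
  assumes "eventually (\<lambda>x. r \<le> f x) F"
  shows "ereal r \<le> Liminf F (\<lambda>x. ereal (f x))"
  by (rule Liminf_bounded) (use assms in \<open>simp add: eventually_mono\<close>)

lemma filterlim_prod_at_top_iff:
  fixes f :: "nat \<Rightarrow> nat \<Rightarrow> real"
  shows "filterlim (\<lambda>(i, j). f i j) at_top (sequentially \<times>\<^sub>F sequentially) \<longleftrightarrow>
    (\<forall>r. \<exists>N. \<forall>i\<ge>N. \<forall>j\<ge>N. r \<le> f i j)"
  unfolding filterlim_at_top eventually_prod_sequentially prod.case by blast

lemma ext_gromov_product_le:
  assumes "limitin (bord_topology b) (\<lambda>n. Point (x n)) p sequentially"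
    and "limitin (bord_topology b) (\<lambda>n. Point (y n)) q sequentially"
  shows "ext_gromov_product b p q \<le> liminf (\<lambda>n. ereal (gromov_product b (x n) (y n)))"
  unfolding ext_gromov_product_def using assms by (intro Inf_lower) blast

lemma ext_gromov_product_nonneg: "0 \<le> ext_gromov_product b p q"
  unfolding ext_gromov_product_def
  by (rule Inf_greatest) (auto intro!: Liminf_bounded simp: gromov_product_nonneg)

lemma ideal_nhd_Point_iff:
  "Point y \<in> ideal_nhd b \<xi> r \<longleftrightarrow> (\<exists>x\<in>\<xi>. ereal r \<le> liminf (\<lambda>i. ereal (gromov_product b (x i) y)))"
  by (auto simp: ideal_nhd_def)

lemma ideal_nhd_Ideal_iff:
  "Ideal \<eta> \<in> ideal_nhd b \<xi> r \<longleftrightarrow> \<eta> \<in> gromov_classes b \<and> (\<exists>x\<in>\<xi>. \<exists>y\<in>\<eta>. ereal r \<le>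
     Liminf (sequentially \<times>\<^sub>F sequentially) (\<lambda>(i, j). ereal (gromov_product b (x i) (y j))))"
  by (auto simp: ideal_nhd_def)

text \<open>The eventual form of membership costs an arbitrarily small amount, here \<open>1/2\<close>.\<close>

lemma ideal_nhd_PointD:
  assumes "Point y \<in> ideal_nhd b \<xi> r"
  obtains x N where "x \<in> \<xi>" "\<And>i. i \<ge> N \<Longrightarrow> r - 1/2 \<le> gromov_product b (x i) y"
proof -
  obtain x where x: "x \<in> \<xi>" "ereal r \<le> liminf (\<lambda>i. ereal (gromov_product b (x i) y))"
    using assms unfolding ideal_nhd_Point_iff by blast
  from ereal_Liminf_real_ge[OF x(2), of "1/2"] obtain N where "\<And>i. i \<ge> N \<Longrightarrow> r - 1/2 \<le> gromov_product b (x i) y"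
    unfolding eventually_sequentially by auto
  with x(1) show ?thesis by (rule that)
qed

lemma ideal_nhd_PointI:
  assumes "x \<in> \<xi>" "\<And>i. i \<ge> N \<Longrightarrow> r \<le> gromov_product b (x i) y"
  shows "Point y \<in> ideal_nhd b \<xi> r"
proof -
  have "eventually (\<lambda>i. r \<le> gromov_product b (x i) y) sequentially"
    using assms(2) unfolding eventually_sequentially by blast
  from Liminf_ereal_real_geI[OF this] show ?thesis
    using assms(1) unfolding ideal_nhd_Point_iff by blast
qed

lemma ideal_nhd_IdealD:
  assumes "Ideal \<eta> \<in> ideal_nhd b \<xi> r"
  obtains x y N where "x \<in> \<xi>" "y \<in> \<eta>" "\<And>i j. i \<ge> N \<Longrightarrow> j \<ge> N \<Longrightarrow> r - 1/2 \<le> gromov_product b (x i) (y j)"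
proof -
  obtain x y where xy: "x \<in> \<xi>" "y \<in> \<eta>"
    "ereal r \<le> Liminf (sequentially \<times>\<^sub>F sequentially) (\<lambda>p. ereal (gromov_product b (x (fst p)) (y (snd p))))"
    using assms unfolding ideal_nhd_Ideal_iff case_prod_unfold by blast
  from ereal_Liminf_real_ge[OF xy(3), of "1/2"]
  obtain N where "\<And>i j. i \<ge> N \<Longrightarrow> j \<ge> N \<Longrightarrow> r - 1/2 \<le> gromov_product b (x i) (y j)"
    unfolding eventually_prod_sequentially by auto
  with xy(1,2) show ?thesis by (rule that)
qed

lemma ideal_nhd_IdealI:
  assumes "\<eta> \<in> gromov_classes b" "x \<in> \<xi>" "y \<in> \<eta>"
    and "\<And>i j. i \<ge> N \<Longrightarrow> j \<ge> N \<Longrightarrow> r \<le> gromov_product b (x i) (y j)"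
  shows "Ideal \<eta> \<in> ideal_nhd b \<xi> r"
proof -
  have "eventually (\<lambda>p. r \<le> gromov_product b (x (fst p)) (y (snd p))) (sequentially \<times>\<^sub>F sequentially)"
    unfolding eventually_prod_sequentially using assms(4) by auto
  from Liminf_ereal_real_geI[OF this] show ?thesis
    using assms(1-3) unfolding ideal_nhd_Ideal_iff case_prod_unfold by blast
qed

locale hyperbolic_space =
  fixes b :: "'a::metric_space" and \<delta> :: real
  assumes delta_nonneg: "\<delta> \<ge> 0"
    and hyp: "\<And>x y z p::'a. gromov_product p x y \<ge> min (gromov_product p x z) (gromov_product p z y) - \<delta>"
begin

lemma hyp_ge:
  assumes "r \<le> gromov_product b x z" "r \<le> gromov_product b z y"
  shows "r - \<delta> \<le> gromov_product b x y"
  using hyp[of b x z y] assms by linarith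

text \<open>Membership in a class is known only through its representative \<open>z\<close>.
  Comparing both sequences with one far point of \<open>z\<close> costs \<delta>, which asking for
  \<open>r + \<delta>\<close> covers; this stands in for transitivity of
  \<open>gromov_equiv\<close>.\<close>

lemma gromov_class_large:
  assumes "\<xi> \<in> gromov_classes b" "x \<in> \<xi>" "y \<in> \<xi>"
  obtains N where "\<And>i j. i \<ge> N \<Longrightarrow> j \<ge> N \<Longrightarrow> r \<le> gromov_product b (x i) (y j)"
proof -
  obtain z where z: "\<xi> = gromov_equiv b `` {z}"
    using assms(1) unfolding gromov_classes_def by (auto elim: quotientE)
  have "(z, x) \<in> gromov_equiv b" "(z, y) \<in> gromov_equiv b"
    using assms(2,3) by (auto simp: z)
  then have "\<exists>N. \<forall>i\<ge>N. \<forall>j\<ge>N. r + \<delta> \<le> gromov_product b (z i) (x j)"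
    "\<exists>N. \<forall>i\<ge>N. \<forall>j\<ge>N. r + \<delta> \<le> gromov_product b (z i) (y j)"
    unfolding gromov_equiv_def by (auto simp: filterlim_prod_at_top_iff)
  then obtain N N' where N: "\<And>i j. i \<ge> N \<Longrightarrow> j \<ge> N \<Longrightarrow> r + \<delta> \<le> gromov_product b (z i) (x j)"
    and N': "\<And>i j. i \<ge> N' \<Longrightarrow> j \<ge> N' \<Longrightarrow> r + \<delta> \<le> gromov_product b (z i) (y j)"
    by blast
  have "r \<le> gromov_product b (x i) (y j)" if "i \<ge> max N N'" "j \<ge> max N N'" for i j
    using hyp_ge[of "r + \<delta>" "x i" "z (max N N')" "y j"] N[of "max N N'" i] N'[of "max N N'" j] that
    by (simp add: gromov_product_commute)
  then show ?thesis using that by blast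
qed

lemma gromov_class_nonempty:
  assumes "\<xi> \<in> gromov_classes b"
  obtains x where "x \<in> \<xi>"
proof -
  obtain z where z: "\<xi> = gromov_equiv b `` {z}" "converges_to_infinity b z"
    using assms unfolding gromov_classes_def by (auto elim: quotientE)
  then have "z \<in> \<xi>"
    by (simp add: gromov_equiv_def converges_to_infinity_def)
  then show ?thesis by (rule that)
qed

lemma Ideal_in_ideal_nhd:
  assumes "\<xi> \<in> gromov_classes b"
  shows "Ideal \<xi> \<in> ideal_nhd b \<xi> r"
proof -
  obtain x where x: "x \<in> \<xi>" using gromov_class_nonempty[OF assms] .
  obtain N where "\<And>i j. i \<ge> N \<Longrightarrow> j \<ge> N \<Longrightarrow> r \<le> gromov_product b (x i) (x j)"
    using gromov_class_large[OF assms x x] by blast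
  with assms x show ?thesis by (intro ideal_nhd_IdealI)
qed

text \<open>Gromov products are 1-Lipschitz in each variable. Of the margin 2, one unit is for the
  move and \<open>1/2\<close> for the eventual form.\<close>

lemma ideal_nhd_near_Point:
  assumes "Point z \<in> ideal_nhd b \<xi> (r + 2)" "dist z z' < 1"
  shows "Point z' \<in> ideal_nhd b \<xi> r"
proof -
  obtain x N where x: "x \<in> \<xi>" "\<And>i. i \<ge> N \<Longrightarrow> r + 2 - 1/2 \<le> gromov_product b (x i) z"
    using ideal_nhd_PointD[OF assms(1)] by metis
  have "gromov_product b (x i) z - 1 \<le> gromov_product b (x i) z'" for i
    unfolding gromov_product_def using dist_triangle[of z b z'] dist_triangle[of "x i" z' z] assms(2)
    by (simp add: field_simps dist_commute)
  then have "r \<le> gromov_product b (x i) z'" if "i \<ge> N" for i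
    using x(2)[OF that] by (smt (verit) field_sum_of_halves)
  with x(1) show ?thesis by (rule ideal_nhd_PointI)
qed

text \<open>Three products are chained, from \<open>x\<close> to \<open>y\<close>, between the
  representatives \<open>y\<close> and \<open>y'\<close> of the middle class, and from
  \<open>y'\<close> to the target: hence two losses of \<delta>. The remaining 1 covers the eventual
  form.\<close>

lemma ideal_nhd_trans:
  assumes \<zeta>: "\<zeta> \<in> gromov_classes b"
    and 1: "Ideal \<zeta> \<in> ideal_nhd b \<xi> (r + 2 * \<delta> + 1)"
    and 2: "q \<in> ideal_nhd b \<zeta> (r + 2 * \<delta> + 1)"
  shows "q \<in> ideal_nhd b \<xi> r"
proof -
  obtain x y N where x: "x \<in> \<xi>" and y: "y \<in> \<zeta>"
    and xy: "\<And>i j. i \<ge> N \<Longrightarrow> j \<ge> N \<Longrightarrow> r + 2 * \<delta> + 1 - 1/2 \<le> gromov_product b (x i) (y j)"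
    using ideal_nhd_IdealD[OF 1] by metis
  show ?thesis
  proof (cases q)
    case (Point z)
    obtain y' N' where y': "y' \<in> \<zeta>"
      and z: "\<And>i. i \<ge> N' \<Longrightarrow> r + 2 * \<delta> + 1 - 1/2 \<le> gromov_product b (y' i) z"
      using ideal_nhd_PointD[OF 2[unfolded Point]] by metis
    obtain N'' where N'': "\<And>i j. i \<ge> N'' \<Longrightarrow> j \<ge> N'' \<Longrightarrow> r + 2 * \<delta> + 1 - 1/2 \<le> gromov_product b (y i) (y' j)"
      using gromov_class_large[OF \<zeta> y y'] by metis
    define M where "M = max N (max N' N'')"
    have M: "M \<ge> N" "M \<ge> N'" "M \<ge> N''" by (auto simp: M_def)
    have "r + \<delta> + 1/2 \<le> gromov_product b (y M) z"
      using hyp_ge[OF N''[OF M(3) M(3)] z[OF M(2)]] by simp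
    moreover have "r + \<delta> + 1/2 \<le> gromov_product b (x i) (y M)" if "i \<ge> N" for i
      using xy[OF that M(1)] delta_nonneg by simp
    ultimately have "r + 1/2 \<le> gromov_product b (x i) z" if "i \<ge> N" for i
      using hyp_ge[of "r + \<delta> + 1/2" "x i" "y M" z] that by simp
    then have "r \<le> gromov_product b (x i) z" if "i \<ge> N" for i
      using that by force
    with x show ?thesis unfolding Point by (rule ideal_nhd_PointI)
  next
    case (Ideal \<eta>)
    obtain y' z N' where y': "y' \<in> \<zeta>" and z: "z \<in> \<eta>"
      and yz: "\<And>i j. i \<ge> N' \<Longrightarrow> j \<ge> N' \<Longrightarrow> r + 2 * \<delta> + 1 - 1/2 \<le> gromov_product b (y' i) (z j)"
      using ideal_nhd_IdealD[OF 2[unfolded Ideal]] by metis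
    obtain N'' where N'': "\<And>i j. i \<ge> N'' \<Longrightarrow> j \<ge> N'' \<Longrightarrow> r + 2 * \<delta> + 1 - 1/2 \<le> gromov_product b (y i) (y' j)"
      using gromov_class_large[OF \<zeta> y y'] by metis
    define M where "M = max N (max N' N'')"
    have M: "M \<ge> N" "M \<ge> N'" "M \<ge> N''" by (auto simp: M_def)
    have "r + \<delta> + 1/2 \<le> gromov_product b (y M) (z j)" if "j \<ge> M" for j
      using hyp_ge[OF N''[OF M(3) M(3)] yz[OF M(2)], of j] that M(2) by simp
    moreover have "r + \<delta> + 1/2 \<le> gromov_product b (x i) (y M)" if "i \<ge> M" for i
      using xy[OF _ M(1), of i] that M(1) delta_nonneg by simp
    ultimately have "r + 1/2 \<le> gromov_product b (x i) (z j)" if "i \<ge> M" "j \<ge> M" for i j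
      using hyp_ge[of "r + \<delta> + 1/2" "x i" "y M" "z j"] that by simp
    then have "r \<le> gromov_product b (x i) (z j)" if "i \<ge> M" "j \<ge> M" for i j
      using that by force
    moreover have "\<eta> \<in> gromov_classes b"
      using 2 unfolding Ideal ideal_nhd_Ideal_iff by blast
    ultimately show ?thesis
      unfolding Ideal using x z by (intro ideal_nhd_IdealI)
  qed
qed

text \<open>As \<open>ideal_nhd\<close> may fail to be open, an open set inside it is assembled from
  the metric interior on \<open>M\<close> and the boundary points owning some neighbourhood inside.
  Its openness at boundary points rests on the two preceding lemmas.\<close>

lemma ideal_nhd_contains_open:
  assumes \<xi>: "\<xi> \<in> gromov_classes b"
  obtains U where "openin (bord_topology b) U" "Ideal \<xi> \<in> U" "U \<subseteq> ideal_nhd b \<xi> r"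
proof -
  let ?N = "ideal_nhd b \<xi> r"
  define U where "U = Point ` interior (Point -` ?N) \<union>
     {Ideal \<eta> | \<eta>. \<eta> \<in> gromov_classes b \<and> (\<exists>r'. ideal_nhd b \<eta> r' \<subseteq> ?N)}"
  have "bord_open b U"
    unfolding bord_open_def
  proof (intro conjI allI impI)
    show "U \<subseteq> bordification b"
      by (auto simp: U_def bordification_def gromov_boundary_def)
    have "Point -` U = interior (Point -` ?N)"
      by (auto simp: U_def)
    then show "open (Point -` U)" by simp
    fix \<eta> assume "Ideal \<eta> \<in> U"
    then obtain r' where \<eta>: "\<eta> \<in> gromov_classes b" "ideal_nhd b \<eta> r' \<subseteq> ?N"
      by (auto simp: U_def)
    \<comment> \<open>Large enough for both margins, 2 at points of \<open>M\<close> and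
      \<open>2 * \<delta> + 1\<close> at boundary points.\<close>
    define s where "s = r' + 2 * \<delta> + 2"
    have "ideal_nhd b \<eta> s \<subseteq> U"
    proof
      fix q assume q: "q \<in> ideal_nhd b \<eta> s"
      show "q \<in> U"
      proof (cases q)
        case (Point z)
        have "Point z \<in> ideal_nhd b \<eta> (r' + 2)"
          using q ideal_nhd_antimono[of "r' + 2" s] delta_nonneg by (auto simp: Point s_def)
        then have "ball z 1 \<subseteq> Point -` ?N"
          using ideal_nhd_near_Point[of z \<eta> r'] \<eta>(2) by (auto simp: subset_iff)
        then have "z \<in> interior (Point -` ?N)"
          by (meson centre_in_ball interiorI open_ball zero_less_one)
        then show ?thesis by (simp add: U_def Point)
      next
        case (Ideal \<zeta>)
        have \<zeta>: "\<zeta> \<in> gromov_classes b"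
          using q unfolding Ideal ideal_nhd_Ideal_iff by blast
        have "Ideal \<zeta> \<in> ideal_nhd b \<eta> (r' + 2 * \<delta> + 1)"
          using q ideal_nhd_antimono[of "r' + 2 * \<delta> + 1" s] by (auto simp: Ideal s_def)
        then have "ideal_nhd b \<zeta> (r' + 2 * \<delta> + 1) \<subseteq> ?N"
          using ideal_nhd_trans[OF \<zeta>] \<eta>(2) by blast
        then show ?thesis using \<zeta> by (auto simp: U_def Ideal)
      qed
    qed
    then show "\<exists>r. ideal_nhd b \<eta> r \<subseteq> U" by blast
  qed
  then have "openin (bord_topology b) U"
    by (simp add: openin_bord_topology)
  moreover have "Ideal \<xi> \<in> U"
    using \<xi> by (auto simp: U_def)
  moreover have "U \<subseteq> ?N"
    using interior_subset[of "Point -` ?N"] Ideal_in_ideal_nhd by (auto simp: U_def)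
  ultimately show ?thesis by (rule that)
qed

text \<open>Decreasing neighbourhoods indexed by naturals at metric and ideal points alike; this is
  what makes diagonal sequences available.\<close>

definition basic_nhd :: "'a bord \<Rightarrow> nat \<Rightarrow> 'a bord set" where
  "basic_nhd p k = (case p of Point x \<Rightarrow> Point ` ball x (1 / real (Suc k)) | Ideal \<xi> \<Rightarrow> ideal_nhd b \<xi> (real k))"

lemma basic_nhd_antimono: "k \<le> l \<Longrightarrow> basic_nhd p l \<subseteq> basic_nhd p k"
proof (cases p)
  case (Point x)
  assume "k \<le> l"
  then have "1 / real (Suc l) \<le> 1 / real (Suc k)"
    by (simp add: frac_le)
  then show ?thesis
    unfolding basic_nhd_def Point by (auto simp del: of_nat_Suc)
next
  case (Ideal \<xi>)
  assume "k \<le> l"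
  then show ?thesis
    using ideal_nhd_antimono[of "real k" "real l"] by (simp add: basic_nhd_def Ideal)
qed

lemma limitin_Point_iff:
  assumes p: "p \<in> bordification b"
  shows "limitin (bord_topology b) (\<lambda>n. Point (y n)) p sequentially \<longleftrightarrow>
    (\<forall>k. eventually (\<lambda>n. Point (y n) \<in> basic_nhd p k) sequentially)" (is "?L \<longleftrightarrow> ?R")
proof
  assume L: ?L
  show ?R
  proof
    fix k
    obtain U where U: "openin (bord_topology b) U" "p \<in> U" "U \<subseteq> basic_nhd p k"
    proof (cases p)
      case (Point x)
      have "Point -` Point ` ball x (1 / real (Suc k)) = ball x (1 / real (Suc k))"
        by auto
      then have "bord_open b (Point ` ball x (1 / real (Suc k)))"
        by (auto simp: bord_open_def bordification_def)
      then show ?thesis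
        using that[of "Point ` ball x (1 / real (Suc k))"]
        by (simp add: basic_nhd_def Point openin_bord_topology del: of_nat_Suc)
    next
      case (Ideal \<xi>)
      then have "\<xi> \<in> gromov_classes b"
        using p by (auto simp: bordification_def gromov_boundary_def)
      from ideal_nhd_contains_open[OF this, of "real k"] show ?thesis
        using that by (auto simp: basic_nhd_def Ideal)
    qed
    have "eventually (\<lambda>n. Point (y n) \<in> U) sequentially"
      using L U(1,2) unfolding limitin_def by blast
    then show "eventually (\<lambda>n. Point (y n) \<in> basic_nhd p k) sequentially"
      by eventually_elim (use U(3) in blast)
  qed
next
  assume R: ?R
  show ?L
    unfolding limitin_def
  proof (intro conjI allI impI)
    show "p \<in> topspace (bord_topology b)"
      using p by (simp add: topspace_bord_topology)
    fix U assume U: "openin (bord_topology b) U \<and> p \<in> U"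
    then have bo: "bord_open b U" by (simp add: openin_bord_topology)
    have "\<exists>k. basic_nhd p k \<subseteq> U"
    proof (cases p)
      case (Point x)
      then have "open (Point -` U)" "x \<in> Point -` U"
        using bo U by (auto simp: bord_open_def)
      then obtain e where e: "e > 0" "ball x e \<subseteq> Point -` U"
        using open_contains_ball by blast
      obtain k where "1 / real (Suc k) < e"
        using nat_approx_posE[OF e(1)] by blast
      then show ?thesis
        using e(2) by (intro exI[of _ k]) (auto simp: basic_nhd_def Point subset_iff simp del: of_nat_Suc)
    next
      case (Ideal \<xi>)
      then obtain r where r: "ideal_nhd b \<xi> r \<subseteq> U"
        using bo U by (auto simp: bord_open_def)
      obtain k :: nat where "r \<le> real k" using real_arch_simple by blast
      then have "basic_nhd p k \<subseteq> U"
        using ideal_nhd_antimono[of r "real k" b \<xi>] r by (auto simp: basic_nhd_def Ideal)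
      then show ?thesis by blast
    qed
    then obtain k where k: "basic_nhd p k \<subseteq> U" by blast
    from R show "eventually (\<lambda>n. Point (y n) \<in> U) sequentially"
      by (metis (mono_tags, lifting) eventually_mono k subset_iff)
  qed
qed

lemma bordification_limit_of_points:
  assumes p: "p \<in> bordification b"
  obtains x where "limitin (bord_topology b) (\<lambda>n. Point (x n)) p sequentially"
proof (cases p)
  case (Point x)
  have "limitin (bord_topology b) (\<lambda>n. Point x) p sequentially"
    using p by (simp add: Point topspace_bord_topology)
  then show ?thesis by (rule that)
next
  case (Ideal \<xi>)
  then have \<xi>: "\<xi> \<in> gromov_classes b"
    using p by (auto simp: bordification_def gromov_boundary_def)
  obtain x where x: "x \<in> \<xi>" using gromov_class_nonempty[OF \<xi>] .
  have "limitin (bord_topology b) (\<lambda>n. Point (x n)) p sequentially"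
    unfolding limitin_Point_iff[OF p]
  proof
    fix k
    obtain N where "\<And>i j. i \<ge> N \<Longrightarrow> j \<ge> N \<Longrightarrow> real k \<le> gromov_product b (x i) (x j)"
      using gromov_class_large[OF \<xi> x x] by blast
    then have "Point (x n) \<in> basic_nhd p k" if "n \<ge> N" for n
      unfolding basic_nhd_def Ideal bord.case using that x by (intro ideal_nhd_PointI[of x _ N]) auto
    then show "eventually (\<lambda>n. Point (x n) \<in> basic_nhd p k) sequentially"
      unfolding eventually_sequentially by blast
  qed
  then show ?thesis by (rule that)
qed

section \<open>Lower semicontinuity and measurability of the extended product\<close>

text \<open>A diagonal argument: values at most \<open>c\<close> at boundary points tending to \<xi>
  yield pairs \<open>X k\<close>, \<open>Y k\<close> of product below \<open>c'\<close>, and these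
  form sequences converging to \<open>p\<close> and \<xi>, hence admissible in the infimum at
  \<xi>.\<close>

lemma ext_gromov_product_lsc:
  assumes p: "p \<in> bordification b" and \<xi>: "\<xi> \<in> gromov_classes b"
    and c: "c < ext_gromov_product b p (Ideal \<xi>)"
  obtains k where "\<And>\<eta>. Ideal \<eta> \<in> ideal_nhd b \<xi> (real k) \<Longrightarrow> c < ext_gromov_product b p (Ideal \<eta>)"
proof -
  have "\<exists>k. \<forall>\<eta>. Ideal \<eta> \<in> ideal_nhd b \<xi> (real k) \<longrightarrow> c < ext_gromov_product b p (Ideal \<eta>)"
  proof (rule ccontr)
    assume neg: "\<nexists>k. \<forall>\<eta>. Ideal \<eta> \<in> ideal_nhd b \<xi> (real k) \<longrightarrow> c < ext_gromov_product b p (Ideal \<eta>)"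
    \<comment> \<open>The infimum at a nearby \<eta> may equal \<open>c\<close> without being
      attained, so strict room is made below the value at \<xi>.\<close>
    obtain c' where c': "c < c'" "c' < ext_gromov_product b p (Ideal \<xi>)"
      using dense[OF c] by blast
    have "\<exists>X Y. Point X \<in> basic_nhd p k \<and> ereal (gromov_product b X Y) < c' \<and>
        Point Y \<in> ideal_nhd b \<xi> (real k - 2 * \<delta> - 1)" for k
    proof -
      obtain \<eta> where \<eta>: "Ideal \<eta> \<in> ideal_nhd b \<xi> (real k)" "ext_gromov_product b p (Ideal \<eta>) \<le> c"
        using neg by (auto simp: not_less)
      have \<eta>cl: "\<eta> \<in> gromov_classes b"
        using \<eta>(1) unfolding ideal_nhd_Ideal_iff by blast
      then have \<eta>b: "Ideal \<eta> \<in> bordification b"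
        by (auto simp: bordification_def gromov_boundary_def)
      have "ext_gromov_product b p (Ideal \<eta>) < c'"
        using \<eta>(2) c'(1) by (rule le_less_trans)
      then obtain x y where x: "limitin (bord_topology b) (\<lambda>n. Point (x n)) p sequentially"
        and y: "limitin (bord_topology b) (\<lambda>n. Point (y n)) (Ideal \<eta>) sequentially"
        and xy: "liminf (\<lambda>n. ereal (gromov_product b (x n) (y n))) < c'"
        unfolding ext_gromov_product_def Inf_less_iff by blast
      have 1: "eventually (\<lambda>n. Point (x n) \<in> basic_nhd p k) sequentially"
        using x unfolding limitin_Point_iff[OF p] by blast
      have 2: "eventually (\<lambda>n. Point (y n) \<in> ideal_nhd b \<eta> (real k)) sequentially"
        using y unfolding limitin_Point_iff[OF \<eta>b] by (auto simp: basic_nhd_def)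
      have "\<exists>n. Point (x n) \<in> basic_nhd p k \<and> Point (y n) \<in> ideal_nhd b \<eta> (real k) \<and>
          ereal (gromov_product b (x n) (y n)) < c'"
      proof (rule ccontr)
        assume no: "\<nexists>n. Point (x n) \<in> basic_nhd p k \<and> Point (y n) \<in> ideal_nhd b \<eta> (real k) \<and>
          ereal (gromov_product b (x n) (y n)) < c'"
        have "eventually (\<lambda>n. c' \<le> ereal (gromov_product b (x n) (y n))) sequentially"
          using 1 2 by eventually_elim (use no in \<open>auto simp: not_less\<close>)
        then have "c' \<le> liminf (\<lambda>n. ereal (gromov_product b (x n) (y n)))"
          by (rule Liminf_bounded)
        with xy show False by simp
      qed
      then obtain n where n: "Point (x n) \<in> basic_nhd p k" "Point (y n) \<in> ideal_nhd b \<eta> (real k)"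
          "ereal (gromov_product b (x n) (y n)) < c'" by blast
      have "Point (y n) \<in> ideal_nhd b \<xi> (real k - 2 * \<delta> - 1)"
        by (rule ideal_nhd_trans[OF \<eta>cl]) (use \<eta>(1) n(2) in simp_all)
      with n show ?thesis by blast
    qed
    then obtain X Y where XY: "\<And>k. Point (X k) \<in> basic_nhd p k"
       "\<And>k. ereal (gromov_product b (X k) (Y k)) < c'"
       "\<And>k. Point (Y k) \<in> ideal_nhd b \<xi> (real k - 2 * \<delta> - 1)"
      by metis
    have \<xi>b: "Ideal \<xi> \<in> bordification b"
      using \<xi> by (auto simp: bordification_def gromov_boundary_def)
    have "limitin (bord_topology b) (\<lambda>n. Point (X n)) p sequentially"
      unfolding limitin_Point_iff[OF p] eventually_sequentially
      using XY(1) basic_nhd_antimono by blast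
    moreover have "limitin (bord_topology b) (\<lambda>n. Point (Y n)) (Ideal \<xi>) sequentially"
      unfolding limitin_Point_iff[OF \<xi>b]
    proof
      fix k
      obtain M :: nat where M: "real k + 2 * \<delta> + 1 \<le> real M" using real_arch_simple by blast
      have "Point (Y n) \<in> basic_nhd (Ideal \<xi>) k" if "n \<ge> M" for n
      proof -
        have "real k \<le> real n - 2 * \<delta> - 1" using that M by linarith
        from ideal_nhd_antimono[OF this] show ?thesis
          using XY(3)[of n] by (auto simp: basic_nhd_def)
      qed
      then show "eventually (\<lambda>n. Point (Y n) \<in> basic_nhd (Ideal \<xi>) k) sequentially"
        unfolding eventually_sequentially by blast
    qed
    ultimately have "ext_gromov_product b p (Ideal \<xi>) \<le> liminf (\<lambda>n. ereal (gromov_product b (X n) (Y n)))"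
      by (rule ext_gromov_product_le)
    also have "\<dots> \<le> liminf (\<lambda>n. c')"
      using XY(2) by (intro Liminf_mono) (auto intro!: always_eventually less_imp_le)
    also have "\<dots> = c'" by (simp add: Liminf_const)
    finally show False using c'(2) by simp
  qed
  then show ?thesis using that by blast
qed

lemma borel_measurable_ext_gromov_product:
  assumes p: "p \<in> bordification b"
  shows "ext_gromov_product b p \<in> borel_measurable (boundary_borel b)"
proof (rule borel_measurableI_greater)
  fix c
  let ?T = "subtopology (bord_topology b) (gromov_boundary b)"
  have top: "topspace ?T = gromov_boundary b"
    by (auto simp: topspace_bord_topology bordification_def)
  let ?S = "{q \<in> gromov_boundary b. c < ext_gromov_product b p q}"
  have "openin ?T ?S"
  proof (subst openin_subopen, rule ballI)
    fix q assume "q \<in> ?S"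
    then obtain \<xi> where \<xi>: "q = Ideal \<xi>" "\<xi> \<in> gromov_classes b" "c < ext_gromov_product b p (Ideal \<xi>)"
      by (auto simp: gromov_boundary_def)
    obtain k where k: "\<And>\<eta>. Ideal \<eta> \<in> ideal_nhd b \<xi> (real k) \<Longrightarrow> c < ext_gromov_product b p (Ideal \<eta>)"
      using ext_gromov_product_lsc[OF p \<xi>(2,3)] by blast
    obtain U where U: "openin (bord_topology b) U" "Ideal \<xi> \<in> U" "U \<subseteq> ideal_nhd b \<xi> (real k)"
      using ideal_nhd_contains_open[OF \<xi>(2)] by blast
    have "U \<inter> gromov_boundary b \<subseteq> ?S"
    proof
      fix q' assume q': "q' \<in> U \<inter> gromov_boundary b"
      then obtain \<eta> where \<eta>: "q' = Ideal \<eta>" by (auto simp: gromov_boundary_def)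
      then have "c < ext_gromov_product b p (Ideal \<eta>)"
        using q' U(3) by (intro k) blast
      then show "q' \<in> ?S" using q' \<eta> by simp
    qed
    then show "\<exists>V. openin ?T V \<and> q \<in> V \<and> V \<subseteq> ?S"
      using U(1,2) \<xi>(1,2) unfolding openin_subtopology gromov_boundary_def by blast
  qed
  then have "?S \<in> sets (boundary_borel b)"
    unfolding boundary_borel_def by (rule openin_imp_sets_borel_on)
  moreover have "space (boundary_borel b) = gromov_boundary b"
    unfolding boundary_borel_def space_borel_on by (rule top)
  ultimately show "{q \<in> space (boundary_borel b). c < ext_gromov_product b p q} \<in> sets (boundary_borel b)"
    by simp
qed

end

section \<open>Integrals against the harmonic measure\<close>

lemma space_boundary_borel: "space (boundary_borel b) = gromov_boundary b"
  by (auto simp: boundary_borel_def topspace_bord_topology bordification_def)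

text \<open>For finite \<open>X\<close> the term with \<open>j\<close> the integer part of
  \<open>X\<close> alone suffices; rounding down accounts for the 1 added in the exponent.\<close>

lemma ereal_exp_layer_cake:
  assumes "0 \<le> s" "0 \<le> X"
  shows "ereal_exp (ereal s * X) \<le> (\<Sum>j. ennreal (exp (s * (real j + 1))) * (if ereal (real j) \<le> X then 1 else 0))"
    (is "_ \<le> (\<Sum>j. ?f j)")
proof (cases X)
  case (real x)
  then have x: "0 \<le> x" using assms(2) by simp
  define j where "j = nat \<lfloor>x\<rfloor>"
  have j: "real j \<le> x" "x \<le> real j + 1"
    using x unfolding j_def by linarith+
  have "ereal_exp (ereal s * X) = ennreal (exp (s * x))"
    by (simp add: real ereal_exp_def)
  also have "\<dots> \<le> ennreal (exp (s * (real j + 1)))"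
    using assms(1) j(2) by (intro ennreal_leI) (simp add: mult_left_mono)
  also have "\<dots> = ?f j"
    using j(1) by (simp add: real)
  also have "\<dots> = (\<Sum>i\<in>{j}. ?f i)"
    by simp
  also have "\<dots> \<le> (\<Sum>i. ?f i)"
    by (rule sum_le_suminf) auto
  finally show ?thesis .
next
  case PInf
  \<comment> \<open>All indicators are 1 and, as \<open>s \<ge> 0\<close>, each term is at least 1,
    so the series diverges.\<close>
  have "(\<Sum>j. ?f j) = \<top>"
  proof -
    have "(\<top>::ennreal) = (\<Sum>j::nat. 1)"
      using nn_integral_count_space_nat[of "\<lambda>_. 1"] by simp
    also have "\<dots> \<le> (\<Sum>j. ?f j)"
      using assms(1) PInf by (intro suminf_le) auto
    finally show ?thesis by (simp add: top_unique)
  qed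
  then show ?thesis by simp
next
  case MInf
  then show ?thesis using assms(2) by simp
qed

context decaying_walk
begin

sublocale H: hyperbolic_space b \<delta>
  using \<delta> hyp by unfold_locales auto

lemma ext_gromov_product_tail:
  assumes s: "0 \<le> s" "s < ln (1 / \<rho>) / \<kappa>"
    and Z: "Z \<in> measurable (increments \<mu>) (boundary_borel b)"
    and lim: "AE \<omega> in increments \<mu>.
           limitin (bord_topology b) (\<lambda>n. Point (walk \<omega> n b)) (Z \<omega>) sequentially"
  obtains C where "C \<ge> 0"
    "\<And>p j. p \<in> bordification b \<Longrightarrow>
      P.prob {\<omega> \<in> space (increments \<mu>). ereal (real j) \<le> ext_gromov_product b p (Z \<omega>)} \<le> C * exp (- s * real j)"
proof -
  obtain C where C: "C \<ge> 0"
    "\<And>x n t. t \<ge> 0 \<Longrightarrow> P.prob {\<omega> \<in> space (increments \<mu>). t \<le> gromov_product b x (walk \<omega> n b)} \<le> C * exp (- s * t)"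
    by (rule gromov_product_tail[OF s]) blast
  have "P.prob {\<omega> \<in> space (increments \<mu>). ereal (real j) \<le> ext_gromov_product b p (Z \<omega>)}
      \<le> (1 + C) * exp s * exp (- s * real j)" (is "P.prob ?E \<le> _") if p: "p \<in> bordification b" for p j
  proof (cases "j = 0")
    case True
    have "P.prob ?E \<le> 1" by (rule P.prob_le_1)
    also have "1 \<le> (1 + C) * exp s"
      using C(1) s(1) mult_mono[of 1 "1 + C" 1 "exp s"] by simp
    finally show ?thesis using True by simp
  next
    case False
    \<comment> \<open>One unit is given up when the bound on the limit inferior becomes an eventual
      bound; it reappears as the factor \<open>exp s\<close>.\<close>
    define t where "t = real j - 1"
    have t: "t \<ge> 0" using False by (simp add: t_def)
    obtain x where x: "limitin (bord_topology b) (\<lambda>n. Point (x n)) p sequentially"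
      using H.bordification_limit_of_points[OF p] .
    let ?A = "\<lambda>n. {\<omega> \<in> space (increments \<mu>). t \<le> gromov_product b (x n) (walk \<omega> n b)}"
    \<comment> \<open>These events increase with \<open>N\<close>, and each lies in the single-time
      event \<open>?A N\<close>, whose bound is uniform in \<open>N\<close>. Continuity from below
      passes that bound to their union.\<close>
    let ?B = "\<lambda>N. {\<omega> \<in> space (increments \<mu>). \<forall>n\<ge>N. t \<le> gromov_product b (x n) (walk \<omega> n b)}"
    have B_eq: "?B N = (\<Inter>n\<in>{N..}. ?A n)" for N by auto
    have B_sets: "?B N \<in> P.events" for N
      unfolding B_eq by (intro sets.countable_INT') auto
    have "P.prob ?E \<le> P.prob (\<Union>N. ?B N)"
    proof (rule P.finite_measure_mono_AE)
      show "(\<Union>N. ?B N) \<in> P.events" using B_sets by auto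
      show "AE \<omega> in increments \<mu>. \<omega> \<in> ?E \<longrightarrow> \<omega> \<in> (\<Union>N. ?B N)"
        using lim
      proof (rule AE_mp, intro AE_I2 impI)
        fix \<omega> assume \<omega>: "\<omega> \<in> space (increments \<mu>)" "\<omega> \<in> ?E"
          and l: "limitin (bord_topology b) (\<lambda>n. Point (walk \<omega> n b)) (Z \<omega>) sequentially"
        have "ereal (real j) \<le> liminf (\<lambda>n. ereal (gromov_product b (x n) (walk \<omega> n b)))"
          using \<omega>(2) ext_gromov_product_le[OF x l] by (blast intro: order_trans)
        from ereal_Liminf_real_ge[OF this, of 1]
        obtain N where "\<forall>n\<ge>N. t \<le> gromov_product b (x n) (walk \<omega> n b)"
          unfolding eventually_sequentially t_def by auto
        then show "\<omega> \<in> (\<Union>N. ?B N)" using \<omega>(1) by blast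
      qed
    qed
    also have "P.prob (\<Union>N. ?B N) \<le> C * exp (- s * t)"
    proof (rule LIMSEQ_le_const2)
      show "(\<lambda>N. P.prob (?B N)) \<longlonglongrightarrow> P.prob (\<Union>N. ?B N)"
        using B_sets by (intro P.finite_Lim_measure_incseq) (auto simp: incseq_def)
      have "P.prob (?B N) \<le> C * exp (- s * t)" for N
      proof -
        have "P.prob (?B N) \<le> P.prob (?A N)"
          by (rule P.finite_measure_mono) auto
        also have "\<dots> \<le> C * exp (- s * t)"
          by (rule C(2)[OF t])
        finally show ?thesis .
      qed
      then show "\<exists>N. \<forall>n\<ge>N. P.prob (?B n) \<le> C * exp (- s * t)" by blast
    qed
    also have "\<dots> = C * exp s * exp (- s * real j)"
      by (simp add: t_def exp_add[symmetric] algebra_simps)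
    also have "\<dots> \<le> (1 + C) * exp s * exp (- s * real j)"
      by (intro mult_right_mono) auto
    finally show ?thesis .
  qed
  then show ?thesis
    using that[of "(1 + C) * exp s"] C(1) by simp
qed

theorem K_const_finite:
  assumes s: "0 \<le> s" "s < ln (1 / \<rho>) / \<kappa>" and \<nu>: "is_harmonic_measure b \<mu> \<nu>"
  shows "K_const b \<nu> s < \<infinity>"
proof -
  obtain Z where Z [measurable]: "Z \<in> measurable (increments \<mu>) (boundary_borel b)"
    and lim: "AE \<omega> in increments \<mu>.
           limitin (bord_topology b) (\<lambda>n. Point (walk \<omega> n b)) (Z \<omega>) sequentially"
    and \<nu>_eq: "\<nu> = distr (increments \<mu>) (boundary_borel b) Z"
    using \<nu> unfolding is_harmonic_measure_def by blast
  \<comment> \<open>With a tail bound of rate \<open>s\<close> all layers would contribute equally;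
    the room between \<open>s\<close> and \<open>s'\<close> turns the series into a geometric one of
    ratio \<open>q\<close>.\<close>
  obtain s' where s': "s < s'" "s' < ln (1 / \<rho>) / \<kappa>"
    using dense[OF s(2)] by blast
  then have "0 \<le> s'" using s(1) by simp
  from ext_gromov_product_tail[OF this s'(2) Z lim]
  obtain C where C: "C \<ge> 0" and tail:
    "\<And>p j. p \<in> bordification b \<Longrightarrow>
      P.prob {\<omega> \<in> space (increments \<mu>). ereal (real j) \<le> ext_gromov_product b p (Z \<omega>)} \<le> C * exp (- s' * real j)"
    by blast
  define q where "q = exp (s - s')"
  have q: "0 < q" "q < 1" using s'(1) by (simp_all add: q_def)
  have bound: "(\<integral>\<^sup>+ q. ereal_exp (ereal s * ext_gromov_product b p q) \<partial>\<nu>) \<le> ennreal (C * exp s * (1 / (1 - q)))"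
    if p: "p \<in> bordification b" for p
  proof -
    let ?X = "ext_gromov_product b p"
    note [measurable] = H.borel_measurable_ext_gromov_product[OF p]
    have sets: "{z \<in> space \<nu>. ereal (real j) \<le> ?X z} \<in> sets \<nu>" for j
      unfolding \<nu>_eq by simp
    have em: "emeasure \<nu> {z \<in> space \<nu>. ereal (real j) \<le> ?X z} \<le> ennreal (C * exp (- s' * real j))" for j
    proof -
      have "emeasure \<nu> {z \<in> space \<nu>. ereal (real j) \<le> ?X z}
          = emeasure (increments \<mu>) {\<omega> \<in> space (increments \<mu>). ereal (real j) \<le> ?X (Z \<omega>)}"
        using sets[of j] unfolding \<nu>_eq
        by (subst emeasure_distr[OF Z]) (auto intro!: arg_cong2[where f = emeasure] measurable_space[OF Z])
      also have "\<dots> = ennreal (P.prob {\<omega> \<in> space (increments \<mu>). ereal (real j) \<le> ?X (Z \<omega>)})"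
        by (rule P.emeasure_eq_measure)
      finally show ?thesis
        using tail[OF p, of j] by (simp add: ennreal_leI)
    qed
    have "(\<integral>\<^sup>+ z. ereal_exp (ereal s * ?X z) \<partial>\<nu>)
        \<le> (\<integral>\<^sup>+ z. (\<Sum>j. ennreal (exp (s * (real j + 1))) * indicator {z \<in> space \<nu>. ereal (real j) \<le> ?X z} z) \<partial>\<nu>)"
    proof (rule nn_integral_mono)
      fix z assume z: "z \<in> space \<nu>"
      show "ereal_exp (ereal s * ?X z) \<le> (\<Sum>j. ennreal (exp (s * (real j + 1))) * indicator {z \<in> space \<nu>. ereal (real j) \<le> ?X z} z)"
        using ereal_exp_layer_cake[OF s(1) ext_gromov_product_nonneg[of b p z]] z
        by (simp add: indicator_def of_bool_def)
    qed
    also have "\<dots> = (\<Sum>j. \<integral>\<^sup>+ z. ennreal (exp (s * (real j + 1))) * indicator {z \<in> space \<nu>. ereal (real j) \<le> ?X z} z \<partial>\<nu>)"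
      using sets by (intro nn_integral_suminf) auto
    also have "\<dots> = (\<Sum>j. ennreal (exp (s * (real j + 1))) * emeasure \<nu> {z \<in> space \<nu>. ereal (real j) \<le> ?X z})"
      using sets by (simp add: nn_integral_cmult_indicator)
    also have "\<dots> \<le> (\<Sum>j. ennreal (exp (s * (real j + 1))) * ennreal (C * exp (- s' * real j)))"
      by (intro suminf_le mult_left_mono em) auto
    also have "\<dots> = (\<Sum>j. ennreal (C * exp s * q ^ j))"
    proof (rule suminf_cong)
      fix j
      have "exp (s * (real j + 1)) * (C * exp (- s' * real j)) = C * exp s * exp (real j * (s - s'))"
        by (simp add: exp_add[symmetric] algebra_simps)
      also have "\<dots> = C * exp s * q ^ j"
        unfolding q_def exp_of_nat_mult ..
      finally have e: "exp (s * (real j + 1)) * (C * exp (- s' * real j)) = C * exp s * q ^ j" .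
      show "ennreal (exp (s * (real j + 1))) * ennreal (C * exp (- s' * real j)) = ennreal (C * exp s * q ^ j)"
        unfolding e[symmetric] by (rule ennreal_mult'[symmetric]) simp
    qed
    also have "\<dots> = ennreal (C * exp s * (1 / (1 - q)))"
      using C q by (intro suminf_ennreal_eq sums_mult geometric_sums) auto
    finally show ?thesis .
  qed
  then have "K_const b \<nu> s \<le> ennreal (C * exp s * (1 / (1 - q)))"
    unfolding K_const_def by (intro SUP_least)
  then show ?thesis
    using ennreal_less_top le_less_trans by (metis infinity_ennreal_def)
qed

end

text \<open>The product is nonnegative, so for negative \<open>s\<close> the integrand is at most 1;
  an infinite product contributes \<open>exp (-\<infinity>) = 0\<close>.\<close>

lemma K_const_finite_neg:
  assumes "s < 0" "emeasure \<nu> (space \<nu>) < \<infinity>"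
  shows "K_const b \<nu> s < \<infinity>"
proof -
  have "ereal_exp (ereal s * ext_gromov_product b p q) \<le> 1" for p q
  proof (cases "ext_gromov_product b p q")
    case (real x)
    then have "0 \<le> x" using ext_gromov_product_nonneg[of b p q] by simp
    then show ?thesis
      using assms(1) by (simp add: real ereal_exp_def mult_nonpos_nonneg)
  next
    case PInf
    then show ?thesis
      using assms(1) by (simp add: ereal_exp_def)
  next
    case MInf
    then show ?thesis using ext_gromov_product_nonneg[of b p q] by simp
  qed
  then have "(\<integral>\<^sup>+ q. ereal_exp (ereal s * ext_gromov_product b p q) \<partial>\<nu>) \<le> (\<integral>\<^sup>+ q. 1 \<partial>\<nu>)" for p
    by (intro nn_integral_mono)
  then have "K_const b \<nu> s \<le> emeasure \<nu> (space \<nu>)"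
    unfolding K_const_def by (intro SUP_least) simp
  then show ?thesis using assms(2) by (rule le_less_trans)
qed

text \<open>Markov's inequality; multiplying by \<open>exp (- s * t)\<close> at the end avoids a
  division in the extended nonnegative reals.\<close>

lemma tail_le_K_const:
  assumes "s > 0" and p: "p \<in> bordification b" 
    and X: "ext_gromov_product b p \<in> borel_measurable \<nu>" and \<nu>: "space \<nu> = gromov_boundary b"
  shows "emeasure \<nu> {q \<in> gromov_boundary b. ext_gromov_product b p q \<ge> ereal t}
              \<le> K_const b \<nu> s * ennreal (exp (- s * t))"
proof -
  let ?A = "{q \<in> gromov_boundary b. ext_gromov_product b p q \<ge> ereal t}"
  have A: "?A \<in> sets \<nu>"
    using borel_measurable_le[OF borel_measurable_const X] by (simp add: \<nu>)
  have le: "ennreal (exp (s * t)) * indicator ?A q \<le> ereal_exp (ereal s * ext_gromov_product b p q)" for q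
  proof (cases "q \<in> ?A")
    case True
    then show ?thesis
      using assms(1) by (cases "ext_gromov_product b p q") (auto simp: ereal_exp_def)
  qed simp
  have "ennreal (exp (s * t)) * emeasure \<nu> ?A = (\<integral>\<^sup>+ q. ennreal (exp (s * t)) * indicator ?A q \<partial>\<nu>)"
    using A by (simp add: nn_integral_cmult_indicator)
  also have "\<dots> \<le> (\<integral>\<^sup>+ q. ereal_exp (ereal s * ext_gromov_product b p q) \<partial>\<nu>)"
    using le by (rule nn_integral_mono)
  also have "\<dots> \<le> K_const b \<nu> s"
    unfolding K_const_def using p by (intro SUP_upper)
  finally have "ennreal (exp (- s * t)) * (ennreal (exp (s * t)) * emeasure \<nu> ?A) \<le> ennreal (exp (- s * t)) * K_const b \<nu> s"
    by (rule mult_left_mono) simp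
  moreover have "ennreal (exp (- s * t)) * ennreal (exp (s * t)) = 1"
    by (simp add: ennreal_mult'[symmetric] exp_add[symmetric])
  ultimately show ?thesis
    by (simp add: mult.assoc[symmetric] mult.commute)
qed

theorem proposition4p10:
  fixes b :: "'a::metric_space"
    and \<mu> m :: "('a \<Rightarrow> 'a) measure"
    and \<nu> :: "'a bord measure"
    and s :: real
  assumes "proper_space TYPE('a)" and "geodesic_space TYPE('a)" and "gromov_hyperbolic TYPE('a)"
    and "cocompact_isom_action TYPE('a)"
    and "left_haar_measure m"
    and "prob_space \<mu>" and "sets \<mu> = sets (borel_on isom_topology)"
    and "non_elementary b \<mu>"
    and "bounded_isoms b (isom_support \<mu>)"
    and "is_harmonic_measure b \<mu> \<nu>"
    and "ereal s < (SUP r\<in>{0..<1}.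
           ereal (1 / kappa b (isom_support \<mu>) * ln (1 / left_regular_norm m (lazy_measure r \<mu>))))"
  shows "(\<forall>p\<in>bordification b. ext_gromov_product b p \<in> borel_measurable \<nu>) \<and>
         K_const b \<nu> s < \<infinity> \<and>
         (s > 0 \<longrightarrow> (\<forall>x t. t \<ge> 0 \<longrightarrow>
            emeasure \<nu> {q \<in> gromov_boundary b. ext_gromov_product b (Point x) q \<ge> ereal t}
              \<le> K_const b \<nu> s * ennreal (exp (- s * t))))"
proof -
  interpret mu: prob_space \<mu> by fact
  interpret haar_walk b m \<mu>
    using assms(1,5,7) by unfold_locales auto
  interpret cocompact_space b
    using assms(2,4) by unfold_locales auto
  obtain \<delta> where \<delta>: "\<delta> \<ge> 0"
    "\<And>x y z p::'a. gromov_product p x y \<ge> min (gromov_product p x z) (gromov_product p z y) - \<delta>"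
    using assms(3) unfolding gromov_hyperbolic_def by blast
  interpret H: hyperbolic_space b \<delta>
    using \<delta> by unfold_locales auto
  obtain Z where Z: "Z \<in> measurable (increments \<mu>) (boundary_borel b)"
    and \<nu>_eq: "\<nu> = distr (increments \<mu>) (boundary_borel b) Z"
    using assms(10) unfolding is_harmonic_measure_def by blast
  have sets_\<nu>: "sets \<nu> = sets (boundary_borel b)" and space_\<nu>: "space \<nu> = gromov_boundary b"
    by (simp_all add: \<nu>_eq space_boundary_borel)
  have meas: "ext_gromov_product b p \<in> borel_measurable \<nu>" if "p \<in> bordification b" for p
    using H.borel_measurable_ext_gromov_product[OF that] measurable_cong_sets[OF sets_\<nu> refl] by blast
  have "K_const b \<nu> s < \<infinity>"
  proof (cases "s < 0")
    case True
    interpret N: prob_space \<nu>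
      unfolding \<nu>_eq by (rule prob_space.prob_space_distr[OF mu.prob_space_increments Z])
    show ?thesis
      using True N.emeasure_space_1 by (intro K_const_finite_neg) auto
  next
    case False
    obtain r where r: "0 \<le> r" "r < 1"
      and sr: "s < 1 / kappa b (isom_support \<mu>) * ln (1 / left_regular_norm m (lazy_measure r \<mu>))"
      using assms(11) unfolding less_SUP_iff by auto
    define \<kappa> where "\<kappa> = kappa b (isom_support \<mu>)"
    define \<rho> where "\<rho> = left_regular_norm m (lazy_measure r \<mu>)"
    interpret L: walk_measure b "lazy_measure r \<mu>"
      by (rule mu.walk_measure_lazy[OF r])
    interpret L: haar_walk b m "lazy_measure r \<mu>" ..
    have \<rho>0: "\<rho> \<ge> 0"
      unfolding \<rho>_def by (rule L.left_regular_norm_nonneg)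
    \<comment> \<open>A point of the support is what shows \<open>\<kappa> \<ge> 0\<close>, since
      \<kappa> is a supremum of reals taken over the support.\<close>
    have "isom_support \<mu> \<noteq> {}"
    proof
      assume "isom_support \<mu> = {}"
      then have "AE g in \<mu>. False" using mu.AE_isom_support by simp
      then show False by (simp add: mu.AE_False)
    qed
    then obtain g where "g \<in> isom_support \<mu>" by blast
    then have "dist (g b) b \<le> \<kappa>"
      using assms(9) unfolding \<kappa>_def kappa_def bounded_isoms_def by (intro cSUP_upper)
    then have \<kappa>0: "\<kappa> \<ge> 0"
      by (rule order_trans[OF zero_le_dist])
    \<comment> \<open>Here \<open>s \<ge> 0\<close>, so the right-hand side is positive. By the
      conventions \<open>1 / 0 = 0\<close> and \<open>ln 0 = 0\<close> this excludes
      \<open>\<kappa> = 0\<close> and \<open>\<rho> = 0\<close>, and then gives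
      \<open>\<rho> < 1\<close>.\<close>
    have pos: "0 < 1 / \<kappa> * ln (1 / \<rho>)"
      using sr False by (simp add: \<kappa>_def \<rho>_def)
    then have \<kappa>: "\<kappa> > 0"
      using \<kappa>0 by (cases "\<kappa> = 0") auto
    then have "ln (1 / \<rho>) > 0"
      using pos by (simp add: zero_less_divide_iff)
    then have \<rho>: "0 < \<rho>" "\<rho> < 1"
      using \<rho>0 by (cases "\<rho> = 0"; simp add: ln_div)+
    interpret D: decaying_walk b \<mu> \<delta> \<kappa> \<rho>
    proof unfold_locales
      show "AE \<omega> in increments \<mu>. \<forall>k. dist (walk \<omega> k b) (walk \<omega> (Suc k) b) \<le> \<kappa>"
        unfolding \<kappa>_def by (rule mu.AE_jump[OF assms(9)])
      show "\<exists>C\<ge>0. \<forall>k. \<forall>g\<in>isom_group.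
        measure (increments \<mu>) {\<omega> \<in> space (increments \<mu>). dist (walk \<omega> k b) (g b) \<le> R} \<le> C * \<rho> ^ k" for R
        by (rule walk_ball_prob_le[OF r \<rho>(2)[unfolded \<rho>_def], of R]) (unfold \<rho>_def, blast)
    qed (use \<delta> \<kappa> \<rho> in auto)
    show ?thesis
      using sr False by (intro D.K_const_finite assms(10)) (auto simp: \<kappa>_def \<rho>_def)
  qed
  moreover have "emeasure \<nu> {q \<in> gromov_boundary b. ext_gromov_product b (Point x) q \<ge> ereal t}
              \<le> K_const b \<nu> s * ennreal (exp (- s * t))" if "s > 0" for x t
    using that by (intro tail_le_K_const meas space_\<nu>) (auto simp: bordification_def)
  ultimately show ?thesis
    using meas by blast
qed

end
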